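(* Let $m\ge2$ and $\gamma\in\mathcal{A}^{m+2}$, and let $u,v\in T_\gamma\mathcal{A}^m$ be (linearly independent) vector fields. Then the sectional curvature $K=K(u,v)$ of $\mathcal{A}^m$ at $\gamma$ in the section spanned by $u$ and $v$ is $$K=\frac{\int_{-1}^1\int_{-1}^1G(s,x)\big(\lvert u'(s)\rvert^2\lvert v'(x)\rvert^2-\langle u'(x),v'(x)\rangle\langle u'(s),v'(s)\rangle\big)\,ds\,dx}{\int_{-1}^1\int_{-1}^1\big(\lvert u(s)\rvert^2\lvert v(x)\rvert^2-\langle u(x),v(x)\rangle\langle u(s),v(s)\rangle\big)\,ds\,dx},$$ where $G$ is the Green function satisfying $\partial_s^2G(s,x)-\lvert\gamma''(s)\rvert^2G(s,x)=-\delta(s-x)$, $G(\pm1,x)=0$. The curvature satisfies $K\ge e^{-\varrho}/(1+\varrho)$, where $\varrho=\int_0^1(1-s)\lvert\gamma''(s)\rvert^2\,ds$; in particular it is always positive, but it is never bounded above (for each such $\gamma$, $K(u,v)$ takes arbitrarily large values as $u,v$ vary).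
   Context: Fix $N\ge 2$. For integers $j,k\ge 0$ and $\eta\colon[-1,1]\to\mathbb{R}^N$ put $\lVert \eta\rVert_{j,k}^2=\int_{-1}^1(1-s^2)^j\lvert\partial_s^k\eta(s)\rvert^2\,ds$. $\mathcal{K}^m$ is the Hilbert space of odd curves $\eta\colon[-1,1]\to\mathbb{R}^N$ ($\eta(-s)=-\eta(s)$) with $\lVert\eta\rVert_{j,j}<\infty$ for $0\le j\le m$, with squared norm $\sum_{j=0}^m\lVert\eta\rVert_{j,j}^2$. $\mathcal{A}^m=\{\eta\in\mathcal{K}^m:\lvert\eta'\rvert\equiv1\}$, $T_\gamma\mathcal{A}^m=\{v\in\mathcal{K}^m:\langle v',\gamma'\rangle\equiv0\}$. The Riemannian metric is the weak metric $\langle\!\langle u,v\rangle\!\rangle=\int_{-1}^1\langle u(s),v(s)\rangle\,ds$ on the flat space $\mathcal{K}^m$ and its restriction to $\mathcal{A}^m$. The sectional curvature is the one given by the Gauss–Codazzi formula for $\mathcal{A}^m\subset\mathcal{K}^m$: $$K(u,v)=\frac{\langle\!\langle S(u,u),S(v,v)\rangle\!\rangle-\langle\!\langle S(u,v),S(u,v)\rangle\!\rangle}{\langle\!\langle u,u\rangle\!\rangle\langle\!\langle v,v\rangle\!\rangle-\langle\!\langle u,v\rangle\!\rangle^2},$$ where the second fundamental form is $S(u,v)=\frac{d}{ds}(\sigma_{uv}\gamma')$ with $\sigma_{uv}''-\lvert\gamma''\rvert^2\sigma_{uv}=-\langle u',v'\rangle$, $\sigma_{uv}(\pm1)=0$.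 *)

theory Defs
  imports "HOL-Analysis.Analysis"
begin

text \<open>
  A curve \<open>[-1,1] \<rightarrow> \<real>\<^sup>N\<close> is a function on all of \<^typ>\<open>real\<close> of which only the values on
  \<open>[-1,1]\<close> matter. Derivatives are only ever used at points of the open interval, up to null sets
  (the two end points are a null set for every integral below).
\<close>

definition ds :: "(real \<Rightarrow> 'a::real_normed_vector) \<Rightarrow> real \<Rightarrow> 'a" where
  "ds f = (\<lambda>s. vector_derivative f (at s))"

text \<open>
  Local absolute continuity on \<open>(-1,1)\<close>, in the form of the fundamental theorem of calculus for the
  Lebesgue integral. For such functions the almost everywhere derivative \<^const>\<open>ds\<close> is the
  weak derivative, so that the Sobolev functions of one variable below are represented by their
  continuous representatives.
\<close>

definition locally_AC :: "(real \<Rightarrow> 'a::euclidean_space) \<Rightarrow> bool" where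
  "locally_AC f \<longleftrightarrow>
     (\<forall>a b. -1 < a \<and> a \<le> b \<and> b < 1 \<longrightarrow>
        set_integrable lborel {a..b} (ds f) \<and>
        (LINT s:{a..b}|lborel. ds f s) = f b - f a)"

text \<open>The square of the weighted seminorm with indices \<open>j, k\<close>; it may be infinite.\<close>

definition wnorm2 :: "nat \<Rightarrow> nat \<Rightarrow> (real \<Rightarrow> real ^ 'n) \<Rightarrow> ennreal" where
  "wnorm2 j k \<eta> =
     (\<integral>\<^sup>+ s\<in>{-1..1}. ennreal ((1 - s\<^sup>2) ^ j * (norm ((ds ^^ k) \<eta> s))\<^sup>2) \<partial>lborel)"

definition Kspace :: "nat \<Rightarrow> (real \<Rightarrow> real ^ 'n) set" where
  "Kspace m = {\<eta>.
     set_borel_measurable lborel {-1..1} \<eta> \<and>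
     (\<forall>s\<in>{-1..1}. \<eta> (- s) = - \<eta> s) \<and>
     (\<forall>k<m. locally_AC ((ds ^^ k) \<eta>)) \<and>
     (\<forall>j\<le>m. wnorm2 j j \<eta> < \<infinity>)}"

definition Aspace :: "nat \<Rightarrow> (real \<Rightarrow> real ^ 'n) set" where
  "Aspace m = {\<eta> \<in> Kspace m. AE s in lborel. s \<in> {-1<..<1} \<longrightarrow> norm (ds \<eta> s) = 1}"

definition tangent :: "nat \<Rightarrow> (real \<Rightarrow> real ^ 'n) \<Rightarrow> (real \<Rightarrow> real ^ 'n) set" where
  "tangent m \<gamma> =
     {v \<in> Kspace m. AE s in lborel. s \<in> {-1<..<1} \<longrightarrow> ds v s \<bullet> ds \<gamma> s = 0}"

definition lin_indep2 :: "(real \<Rightarrow> real ^ 'n) \<Rightarrow> (real \<Rightarrow> real ^ 'n) \<Rightarrow> bool" where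
  "lin_indep2 u v \<longleftrightarrow>
     (\<forall>a b. (AE s in lborel. s \<in> {-1..1} \<longrightarrow> a *\<^sub>R u s + b *\<^sub>R v s = 0) \<longrightarrow> a = 0 \<and> b = 0)"

definition weak_metric :: "(real \<Rightarrow> real ^ 'n) \<Rightarrow> (real \<Rightarrow> real ^ 'n) \<Rightarrow> real" where
  "weak_metric u v = (LINT s:{-1..1}|lborel. u s \<bullet> v s)"

text \<open>
  The boundary value problem for \<open>\<sigma>\<^sub>u\<^sub>v\<close>, in the classical sense: its coefficient and right-hand side
  are continuous on \<open>(-1,1)\<close> when \<open>\<gamma> \<in> Kspace 3\<close> and \<open>u, v \<in> Kspace 2\<close>.
\<close>

definition solves_sigma ::
  "(real \<Rightarrow> real ^ 'n) \<Rightarrow> (real \<Rightarrow> real ^ 'n) \<Rightarrow> (real \<Rightarrow> real ^ 'n) \<Rightarrow> (real \<Rightarrow> real) \<Rightarrow> bool" where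
  "solves_sigma \<gamma> u v \<sigma> \<longleftrightarrow>
     continuous_on {-1..1} \<sigma> \<and> \<sigma> (-1) = 0 \<and> \<sigma> 1 = 0 \<and>
     (\<forall>s\<in>{-1<..<1}.
        \<sigma> differentiable (at s) \<and> ds \<sigma> differentiable (at s) \<and>
        (ds ^^ 2) \<sigma> s - (norm ((ds ^^ 2) \<gamma> s))\<^sup>2 * \<sigma> s = - (ds u s \<bullet> ds v s))"

text \<open>The value 0 outside \<open>[-1,1]\<close> only serves to make the solution unique as a total function.\<close>

definition sigma ::
  "(real \<Rightarrow> real ^ 'n) \<Rightarrow> (real \<Rightarrow> real ^ 'n) \<Rightarrow> (real \<Rightarrow> real ^ 'n) \<Rightarrow> real \<Rightarrow> real" where
  "sigma \<gamma> u v = (THE \<sigma>. solves_sigma \<gamma> u v \<sigma> \<and> (\<forall>s. s \<notin> {-1..1} \<longrightarrow> \<sigma> s = 0))"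

definition second_ff ::
  "(real \<Rightarrow> real ^ 'n) \<Rightarrow> (real \<Rightarrow> real ^ 'n) \<Rightarrow> (real \<Rightarrow> real ^ 'n) \<Rightarrow> real \<Rightarrow> real ^ 'n" where
  "second_ff \<gamma> u v = ds (\<lambda>s. sigma \<gamma> u v s *\<^sub>R ds \<gamma> s)"

definition sec_curv ::
  "(real \<Rightarrow> real ^ 'n) \<Rightarrow> (real \<Rightarrow> real ^ 'n) \<Rightarrow> (real \<Rightarrow> real ^ 'n) \<Rightarrow> real" where
  "sec_curv \<gamma> u v =
     (weak_metric (second_ff \<gamma> u u) (second_ff \<gamma> v v) - weak_metric (second_ff \<gamma> u v) (second_ff \<gamma> u v)) /
     (weak_metric u u * weak_metric v v - (weak_metric u v)\<^sup>2)"

definition test_function :: "(real \<Rightarrow> real) \<Rightarrow> bool" where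
  "test_function \<phi> \<longleftrightarrow>
     (\<forall>n s. (ds ^^ n) \<phi> differentiable (at s)) \<and>
     (\<exists>a b. -1 < a \<and> b < 1 \<and> (\<forall>s. s \<notin> {a..b} \<longrightarrow> \<phi> s = 0))"

text \<open>
  The equation with right-hand side \<open>-\<delta>(s - x)\<close> is understood in the sense of distributions
  in \<open>s \<in> (-1,1)\<close>, for each source point \<open>x \<in> (-1,1)\<close>.
\<close>

definition green_function ::
  "(real \<Rightarrow> real ^ 'n) \<Rightarrow> (real \<Rightarrow> real \<Rightarrow> real) \<Rightarrow> bool" where
  "green_function \<gamma> G \<longleftrightarrow>
     (\<forall>x\<in>{-1<..<1}.
        continuous_on {-1..1} (\<lambda>s. G s x) \<and> G (-1) x = 0 \<and> G 1 x = 0 \<and>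
        (\<forall>\<phi>. test_function \<phi> \<longrightarrow>
           (LINT s:{-1..1}|lborel.
              G s x * ((ds ^^ 2) \<phi> s - (norm ((ds ^^ 2) \<gamma> s))\<^sup>2 * \<phi> s)) = - \<phi> x))"

definition varrho :: "(real \<Rightarrow> real ^ 'n) \<Rightarrow> real" where
  "varrho \<gamma> = (LINT s:{0..1}|lborel. (1 - s) * (norm ((ds ^^ 2) \<gamma> s))\<^sup>2)"

end

theory Submission
  imports Defs "HOL-Computational_Algebra.Polynomial"
begin

text \<open>
  Put \<open>q = \<bar>\<gamma>''\<bar>\<^sup>2\<close>. By Hardy's inequality \<open>q\<close> and \<open>\<bar>u'\<bar>\<^sup>2\<close> are integrable, so \<open>\<sigma>'' - q \<sigma> = - f\<close>, \<open>\<sigma>(\<plusminus>1) = 0\<close>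
  is solved by \<open>\<sigma>\<^sub>f = \<integral> G f\<close> with \<open>G(s,x) = \<phi>(min s x) \<phi>(- max s x) / \<phi>(1)\<close>, where
  \<open>\<phi>'' = q \<phi>\<close>, \<open>\<phi>(-1) = 0\<close>, \<open>\<phi>'(-1) = 1\<close>. Since \<open>\<gamma>'\<close> is a unit vector orthogonal to \<open>\<gamma>''\<close>, the inner product of
  two values of the second fundamental form is \<open>\<integral> \<sigma>\<^sub>f' \<sigma>\<^sub>g' + q \<sigma>\<^sub>f \<sigma>\<^sub>g = \<integral> \<sigma>\<^sub>f g\<close>, which gives the formula for \<open>K\<close>.

  The Gronwall inequality for \<open>\<phi>(s) + \<phi>(-s)\<close> yields \<open>G(s,x) + G(-s,x) \<ge> e\<^sup>-\<^sup>\<rho> (1 - s\<^sup>2)(1 - x\<^sup>2) / 2\<close>. All functions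
  integrated against \<open>G\<close> are even, so the numerator of \<open>K\<close> is at least \<open>e\<^sup>-\<^sup>\<rho> / 4\<close> times the Gram
  determinant of \<open>u, v\<close> for the form \<open>\<integral> (1 - s\<^sup>2) \<langle>u', v'\<rangle>\<close>. On odd functions this form is at least twice the
  \<open>L\<^sup>2\<close> form (Legendre operator), hence \<open>K \<ge> e\<^sup>-\<^sup>\<rho>\<close>. Two pulses of width \<open>\<epsilon>\<close> with disjoint supports
  make the same lower bound of order \<open>\<epsilon>\<^sup>-\<^sup>2\<close>.
\<close>

section \<open>Finitely differentiable functions and bumps\<close>

text \<open>The integrand of the numerator, \<open>A s * B x - C x * C s\<close> with
  \<open>A\<close>, \<open>B\<close>, \<open>C\<close> the pointwise inner products of the
  derivatives, has no sign. Symmetrized in \<open>u\<close> and \<open>v\<close> it is nonnegative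
  by Cauchy-Schwarz, so a lower bound for the kernel may be inserted. That bound is a product of one
  function of \<open>s\<close> and the same function of \<open>x\<close>; hence the double integral
  becomes a 2x2 determinant. Pairing \<open>s\<close> with \<open>-s\<close> brings in the even
  solution \<open>sol x + sol (- x)\<close>, whose growth involves only the half interval [0,1];
  this is how \<rho> arises. The factor 1/4 is 1/2 from the kernel bound times 1/2 from averaging
  over the pair. The spectral gap 2 enters a 2x2 determinant squared, and the resulting 4 cancels
  it. Each use of Hardy's inequality lowers the order of the derivative by one and the exponent of
  the weight by two. So integrability of |u'|^2 costs two derivatives and that of |gamma''|^2 costs
  four, which is where m + 2 >= 4 enters. A function satisfying \<open>green_function\<close> is
  given only distributionally, so the curvature formula for it requires a uniqueness theorem for
  distributional solutions.\<close>

primrec Ck :: "real set \<Rightarrow> nat \<Rightarrow> (real \<Rightarrow> 'a::real_normed_vector) \<Rightarrow> bool" where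
  "Ck S 0 f \<longleftrightarrow> continuous_on S f"
| "Ck S (Suc n) f \<longleftrightarrow> (\<exists>f'. (\<forall>x\<in>S. (f has_vector_derivative f' x) (at x)) \<and> Ck S n f')"

lemma Ck_SucI:
  "(\<And>x. x \<in> S \<Longrightarrow> (f has_vector_derivative f' x) (at x)) \<Longrightarrow> Ck S n f' \<Longrightarrow> Ck S (Suc n) f"
  by auto

lemma Ck_SucD: "Ck S (Suc n) f \<Longrightarrow> Ck S n f"
proof (induction n arbitrary: f)
  case 0
  then show ?case
    by (auto intro!: continuous_at_imp_continuous_on dest!: bspec intro: has_vector_derivative_continuous)
next
  case (Suc n)
  then show ?case by (metis Ck.simps(2))
qed

lemma Ck_le: "Ck S n f \<Longrightarrow> k \<le> n \<Longrightarrow> Ck S k f"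
  by (induction n) (auto simp: le_Suc_eq simp del: Ck.simps dest: Ck_SucD)

lemma Ck_continuous: "Ck S n f \<Longrightarrow> continuous_on S f"
  using Ck_le[of S n f 0] by simp

lemma Ck_cong:
  assumes "open S" "\<And>x. x \<in> S \<Longrightarrow> f x = g x" "Ck S n f"
  shows "Ck S n g"
proof (cases n)
  case 0
  then show ?thesis using assms continuous_on_cong[of S S f g] by auto
next
  case (Suc k)
  then obtain f' where "\<And>x. x \<in> S \<Longrightarrow> (f has_vector_derivative f' x) (at x)" "Ck S k f'"
    using assms by auto
  moreover have "(g has_vector_derivative d) (at x)" if "x \<in> S" "(f has_vector_derivative d) (at x)" for x d
    by (rule has_vector_derivative_transform_within_open[OF that(2) assms(1) that(1) assms(2)])
  ultimately show ?thesis unfolding Suc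
    by (intro Ck_SucI[of S g f']) blast+
qed

text \<open>\<open>Ck\<close> carries the derivative as an existential witness, so that its
  induction needs no choice of representative. Uniqueness of derivatives identifies the witness with
  \<open>ds\<close> on an open set.\<close>

lemma Ck_ds:
  assumes "open S" "Ck S (Suc n) f"
  shows "Ck S n (ds f)" and "x \<in> S \<Longrightarrow> (f has_vector_derivative ds f x) (at x)"
proof -
  obtain f' where f': "\<And>x. x \<in> S \<Longrightarrow> (f has_vector_derivative f' x) (at x)" "Ck S n f'"
    using assms by auto
  have eq: "ds f x = f' x" if "x \<in> S" for x
    using f'(1)[OF that] by (simp add: ds_def vector_derivative_at)
  show "Ck S n (ds f)"
    by (rule Ck_cong[OF assms(1) _ f'(2)]) (simp add: eq)
  show "x \<in> S \<Longrightarrow> (f has_vector_derivative ds f x) (at x)"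
    using f'(1) eq by simp
qed

lemma Ck_funpow_ds: "open S \<Longrightarrow> Ck S (n + k) f \<Longrightarrow> Ck S n ((ds ^^ k) f)"
proof (induction k arbitrary: n)
  case (Suc k)
  then show ?case
    using Suc.IH[of "Suc n"] by (auto simp del: Ck.simps intro: Ck_ds(1))
qed auto

lemma Ck_const [simp]: "Ck S n (\<lambda>x. c)"
proof (induction n arbitrary: c)
  case (Suc n)
  show ?case by (rule Ck_SucI[OF _ Suc[of 0]]) simp
qed simp

lemma Ck_add: "Ck S n f \<Longrightarrow> Ck S n g \<Longrightarrow> Ck S n (\<lambda>x. f x + g x)"
proof (induction n arbitrary: f g)
  case 0
  then show ?case by (auto intro: continuous_intros)
next
  case (Suc n)
  from Suc.prems obtain f' g' where "\<And>x. x \<in> S \<Longrightarrow> (f has_vector_derivative f' x) (at x)" "Ck S n f'"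
    "\<And>x. x \<in> S \<Longrightarrow> (g has_vector_derivative g' x) (at x)" "Ck S n g'" by auto
  then show ?case
    by (intro Ck_SucI[where f' = "\<lambda>x. f' x + g' x"] Suc.IH has_vector_derivative_add)
qed

lemma (in bounded_bilinear) Ck:
  "Ck S n f \<Longrightarrow> Ck S n g \<Longrightarrow> Ck S n (\<lambda>x. prod (f x) (g x))"
proof (induction n arbitrary: f g)
  case 0
  then show ?case by (auto intro: continuous_on)
next
  case (Suc n)
  from Suc.prems obtain f' g' where "\<And>x. x \<in> S \<Longrightarrow> (f has_vector_derivative f' x) (at x)" "Ck S n f'"
    "\<And>x. x \<in> S \<Longrightarrow> (g has_vector_derivative g' x) (at x)" "Ck S n g'" by auto
  then show ?case
    by (intro Ck_SucI[where f' = "\<lambda>x. prod (f x) (g' x) + prod (f' x) (g x)"] Ck_add Suc.IH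
      has_vector_derivative Ck_SucD[OF Suc.prems(1)] Ck_SucD[OF Suc.prems(2)])
qed

lemmas Ck_mult = bounded_bilinear.Ck[OF bounded_bilinear_mult]
lemmas Ck_scaleR = bounded_bilinear.Ck[OF bounded_bilinear_scaleR]
lemmas Ck_inner = bounded_bilinear.Ck[OF bounded_bilinear_inner]

lemma Ck_affine:
  "Ck S n f \<Longrightarrow> (\<And>x. x \<in> T \<Longrightarrow> c * x + d \<in> S) \<Longrightarrow> Ck T n (\<lambda>x. f (c * x + d))"
proof (induction n arbitrary: f)
  case 0
  then show ?case by (auto intro!: continuous_on_compose2[of S f] continuous_intros)
next
  case (Suc n)
  from Suc.prems obtain f' where f': "\<And>x. x \<in> S \<Longrightarrow> (f has_vector_derivative f' x) (at x)" "Ck S n f'" by auto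
  have "((\<lambda>x. f (c * x + d)) has_vector_derivative c *\<^sub>R f' (c * x + d)) (at x)" if "x \<in> T" for x
  proof -
    have "((\<lambda>x. c * x + d) has_vector_derivative c) (at x)"
      by (auto intro!: derivative_eq_intros simp flip: has_real_derivative_iff_has_vector_derivative)
    from vector_diff_chain_at[OF this] f'(1)[OF Suc.prems(2)[OF that]] show ?thesis
      by (simp add: o_def)
  qed
  then show ?case
    by (intro Ck_SucI[where f' = "\<lambda>x. c *\<^sub>R f' (c * x + d)"] Ck_scaleR Ck_const Suc.IH f'(2) Suc.prems(2))
qed

section \<open>A smooth bump built from exp(-1/x)\<close>

lemma poly_exp_minus_tendsto_0: "((\<lambda>t. poly p t * exp (- t)) \<longlongrightarrow> (0::real)) at_top"
proof -
  have "((\<lambda>t. \<Sum>i\<le>degree p. coeff p i * (t ^ i / exp t)) \<longlongrightarrow> (\<Sum>i\<le>degree p. coeff p i * 0)) at_top"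
    by (intro tendsto_intros tendsto_power_div_exp_0)
  moreover have "(\<lambda>t. \<Sum>i\<le>degree p. coeff p i * (t ^ i / exp t)) = (\<lambda>t. poly p t * exp (- t))"
    by (simp add: poly_altdef sum_distrib_right exp_minus field_simps sum_divide_distrib)
  ultimately show ?thesis by simp
qed

text \<open>The functions \<open>p(1/x) e\<^sup>-\<^sup>1\<^sup>/\<^sup>x\<close>, cut off at \<open>0\<close>, are closed under differentiation, hence smooth.\<close>

definition flat :: "real poly \<Rightarrow> real \<Rightarrow> real" where
  "flat p x = (if x \<le> 0 then 0 else poly p (1 / x) * exp (- (1 / x)))"

text \<open>With t = 1/x one has dt/dx = -t^2, so p(t) exp(-t) has derivative t^2 (p(t) - p'(t))
  exp(-t), which is again of the same form.\<close>

lemma flat_deriv: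
  "(flat p has_real_derivative flat ([:0, 0, 1:] * (p - pderiv p)) x) (at x)"
proof -
  consider "x < 0" | "x > 0" | "x = 0" by linarith
  then show ?thesis
  proof cases
    case 1
    have "((\<lambda>x. 0) has_real_derivative 0) (at x)" by simp
    then have "(flat p has_real_derivative 0) (at x)"
      by (rule has_field_derivative_transform_within_open[of _ _ _ "{..<0}"]) (use 1 in \<open>auto simp: flat_def\<close>)
    then show ?thesis using 1 by (simp add: flat_def)
  next
    case 2
    have "((\<lambda>x. poly p (1 / x) * exp (- (1 / x))) has_real_derivative
       flat ([:0, 0, 1:] * (p - pderiv p)) x) (at x)"
      using 2 unfolding flat_def
      by (auto intro!: derivative_eq_intros simp: power2_eq_square divide_simps) (simp add: algebra_simps)?
    then show ?thesis
      by (rule has_field_derivative_transform_within_open[of _ _ _ "{0<..}"]) (use 2 in \<open>auto simp: flat_def\<close>)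
  next
    case 3
    \<comment> \<open>Dividing by h multiplies the polynomial in t = 1/h by t, so the right
      difference quotient at 0 is again a polynomial times exp(-t) with t tending to
      infinity.\<close>
    have "((\<lambda>x. poly ([:0, 1:] * p) (inverse x) * exp (- inverse x)) \<longlongrightarrow> 0) (at_right 0)"
      by (rule filterlim_compose[OF poly_exp_minus_tendsto_0 filterlim_inverse_at_top_right])
    then have r: "((\<lambda>h. (flat p (0 + h) - flat p 0) / h) \<longlongrightarrow> 0) (at_right 0)"
      by (rule Lim_transform_eventually)
        (auto simp: flat_def eventually_at_filter field_simps)
    have l: "((\<lambda>h. (flat p (0 + h) - flat p 0) / h) \<longlongrightarrow> 0) (at_left 0)"
      by (rule Lim_transform_eventually[OF tendsto_const])
        (auto simp: flat_def eventually_at_filter)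
    have "(flat p has_real_derivative 0) (at 0)"
      unfolding DERIV_def using filterlim_split_at[OF l r] .
    then show ?thesis using 3 by (simp add: flat_def)
  qed
qed

lemma Ck_flat: "Ck S n (flat p)"
proof (induction n arbitrary: p)
  case 0
  have "continuous_on UNIV (flat p)"
    using DERIV_isCont[OF flat_deriv] by (auto intro: continuous_at_imp_continuous_on)
  then show ?case by (auto intro: continuous_on_subset)
next
  case (Suc n)
  show ?case
    by (rule Ck_SucI[OF _ Suc.IH])
      (use flat_deriv in \<open>auto simp: has_real_derivative_iff_has_vector_derivative\<close>)
qed

definition bump :: "real \<Rightarrow> real" where
  "bump x = flat 1 (1 + x) * flat 1 (1 - x)"

lemma Ck_bump: "Ck S n bump"
proof -
  have "Ck S n (\<lambda>x. flat 1 (1 * x + 1) * flat 1 (- 1 * x + 1))"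
    by (intro Ck_mult Ck_affine[OF Ck_flat[of UNIV]]) auto
  then show ?thesis by (simp add: bump_def[abs_def] add.commute)
qed

lemma bump_nonneg: "0 \<le> bump x" and bump_pos: "\<bar>x\<bar> < 1 \<Longrightarrow> 0 < bump x"
  and bump_zero: "1 \<le> \<bar>x\<bar> \<Longrightarrow> bump x = 0"
  by (auto simp: bump_def flat_def)

lemma bump_le_1: "bump x \<le> 1"
  by (auto simp: bump_def flat_def intro!: mult_le_one)

section \<open>The boundary value problem\<close>

definition prim :: "(real \<Rightarrow> real) \<Rightarrow> real \<Rightarrow> real" where
  "prim h s = integral {-1..s} h"

lemma prim_left [simp]: "prim h (-1) = 0"
  by (simp add: prim_def)

lemma continuous_on_prim:
  "h integrable_on {-1..1} \<Longrightarrow> continuous_on {-1..1} (prim h)"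
  unfolding prim_def by (rule indefinite_integral_continuous_1)

text \<open>Only interior continuity is assumed: the potential and the right-hand sides may blow up
  at the ends while staying integrable.\<close>

lemma prim_has_real_derivative:
  assumes "h integrable_on {-1..1}" "continuous_on {-1<..<1} h" "s \<in> {-1<..<1}"
  shows "(prim h has_real_derivative h s) (at s)"
proof -
  have c: "continuous (at s) h"
    using assms(2,3) continuous_on_eq_continuous_at[of "{-1<..<1}" h] by auto
  have "((\<lambda>u. integral {-1..u} h) has_vector_derivative h s) (at s within {-1..1})"
    using assms(1,3) integral_has_vector_derivative_continuous_at[of h "-1" 1 s "{}"]
    by (auto intro: continuous_at_imp_continuous_at_within c)
  moreover have "at s within {-1..1} = at s"
    using assms(3) by (intro at_within_interior) auto
  ultimately show ?thesis
    by (simp add: prim_def[abs_def] has_real_derivative_iff_has_vector_derivative)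
qed

lemma prim_mono:
  assumes "f integrable_on {-1..1}" "g integrable_on {-1..1}" "s \<le> 1"
    "\<And>t. t \<in> {-1..s} \<Longrightarrow> f t \<le> g t"
  shows "prim f s \<le> prim g s"
  unfolding prim_def
  using assms by (intro integral_le) (auto intro: integrable_on_subinterval)

lemma prim_nonneg:
  assumes "f integrable_on {-1..1}" "s \<le> 1" "\<And>t. t \<in> {-1..s} \<Longrightarrow> 0 \<le> f t"
  shows "0 \<le> prim f s"
  unfolding prim_def
  using assms by (intro integral_nonneg) (auto intro: integrable_on_subinterval)

lemma prim_increasing:
  assumes "f integrable_on {-1..1}" "-1 \<le> s" "s \<le> t" "t \<le> 1" "\<And>t. t \<in> {-1..1} \<Longrightarrow> 0 \<le> f t"
  shows "prim f s \<le> prim f t"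
  unfolding prim_def
  using assms by (intro integral_subset_le) (auto intro: integrable_on_subinterval)

text \<open>Absolute integrability, unlike gauge integrability, survives multiplication by a bounded
  measurable factor. This is why it is the hypothesis on all coefficients.\<close>

lemma absolutely_integrable_mult_continuous:
  fixes f g :: "real \<Rightarrow> real"
  assumes "f absolutely_integrable_on {a..b}" "continuous_on {a..b} g"
  shows "(\<lambda>x. g x * f x) absolutely_integrable_on {a..b}"
proof -
  have "bounded (g ` {a..b})"
    using assms by (intro compact_imp_bounded compact_continuous_image) auto
  moreover have "g \<in> borel_measurable (lebesgue_on {a..b})"
    using assms by (intro continuous_imp_measurable_on_sets_lebesgue) auto
  ultimately show ?thesis
    using absolutely_integrable_bounded_measurable_product_real[of g "{a..b}" f] assms by auto
qed

text \<open>Positivity of \<open>q\<close> makes \<open>(D D')'\<close> nonnegative, so that \<open>D\<^sup>2\<close> is convex.\<close>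

lemma homogeneous_bvp_unique:
  fixes q D D1 :: "real \<Rightarrow> real"
  assumes q: "\<And>s. 0 \<le> q s"
    and cont: "continuous_on {-1..1} D" and bd: "D (-1) = 0" "D 1 = 0"
    and D: "\<And>s. s \<in> {-1<..<1} \<Longrightarrow> (D has_real_derivative D1 s) (at s)"
    and D1: "\<And>s. s \<in> {-1<..<1} \<Longrightarrow> (D1 has_real_derivative q s * D s) (at s)"
    and s: "s \<in> {-1..1}"
  shows "D s = 0"
proof (rule ccontr)
  assume ne: "D s \<noteq> 0"
  with s bd have s': "-1 < s" "s < 1" by (auto simp: less_le)
  have d2: "((\<lambda>x. (D x)\<^sup>2) has_real_derivative 2 * (D x * D1 x)) (at x)" if "x \<in> {-1<..<1}" for x
    by (rule derivative_eq_intros D that refl)+ (simp add: algebra_simps)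
  have mono: "D x * D1 x \<le> D y * D1 y" if "-1 < x" "x \<le> y" "y < 1" for x y
  proof (rule DERIV_nonneg_imp_nondecreasing[OF that(2)])
    fix z assume z: "x \<le> z" "z \<le> y"
    then have zz: "z \<in> {-1<..<1}" using that by auto
    have "((\<lambda>x. D x * D1 x) has_real_derivative D1 z * D1 z + q z * D z * D z) (at z)"
      by (auto intro!: derivative_eq_intros D D1 zz)
    moreover have "D1 z * D1 z + q z * D z * D z \<ge> 0"
      using q[of z] by (simp add: mult.assoc)
    ultimately show "\<exists>l. ((\<lambda>x. D x * D1 x) has_real_derivative l) (at z) \<and> 0 \<le> l" by blast
  qed
  have c2: "continuous_on A (\<lambda>x. (D x)\<^sup>2)" if "A \<subseteq> {-1..1}" for A
    using continuous_on_subset[OF cont that] by (intro continuous_intros)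
  have mv: "\<exists>z. a < z \<and> z < b \<and> (D b)\<^sup>2 - (D a)\<^sup>2 = (b - a) * (2 * (D z * D1 z))"
    if ab: "-1 \<le> a" "a < b" "b \<le> 1" for a b
  proof -
    obtain l z where "a < z" "z < b" "DERIV (\<lambda>x. (D x)\<^sup>2) z :> l" "(D b)\<^sup>2 - (D a)\<^sup>2 = (b - a) * l"
      using MVT[OF ab(2) c2] d2 ab
      by (smt (verit, best) atLeastAtMost_iff atLeastatMost_subset_iff greaterThanLessThan_iff real_differentiable_def)
    moreover from this have "l = 2 * (D z * D1 z)"
      using d2[of z] ab by (intro DERIV_unique) auto
    ultimately show ?thesis by blast
  qed
  \<comment> \<open>\<open>D\<close> squared rises from 0 to a positive value at \<open>s\<close>
    and falls back to 0. By the mean value theorem \<open>D * D1\<close> is positive somewhere on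
    the left of \<open>s\<close> and negative somewhere on the right, against its
    monotonicity.\<close>
  obtain z where z: "-1 < z" "z < s" "(D s)\<^sup>2 = (s + 1) * (2 * (D z * D1 z))"
    using mv[of "-1" s] s' bd by auto
  obtain w where w: "s < w" "w < 1" "- (D s)\<^sup>2 = (1 - s) * (2 * (D w * D1 w))"
    using mv[of s 1] s' bd by auto
  have pos: "0 < (D s)\<^sup>2" using ne by simp
  have "0 < D z * D1 z"
    using pos z s' by (simp add: zero_less_mult_iff)
  moreover have "(1 - s) * (2 * (D w * D1 w)) < 0"
    using pos w by linarith
  then have "D w * D1 w < 0"
    using s' by (simp add: mult_less_0_iff)
  ultimately show False
    using mono[of z w] z w by linarith
qed

text \<open>Abstracts q = |gamma''|^2, which is continuous inside, integrable up to the ends, but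
  possibly unbounded there. Evenness makes the reflection of a solution a solution again.\<close>

locale potential =
  fixes q :: "real \<Rightarrow> real"
  assumes q_nonneg: "0 \<le> q s"
    and q_cont: "continuous_on {-1<..<1} q"
    and q_int: "q absolutely_integrable_on {-1..1}"
    and q_even: "s \<in> {-1<..<1} \<Longrightarrow> q (- s) = q s"
begin

lemma q_mult_int: "continuous_on {-1..1} f \<Longrightarrow> (\<lambda>t. q t * f t) absolutely_integrable_on {-1..1}"
  using absolutely_integrable_mult_continuous[OF q_int, of f] by (simp add: mult.commute)

lemma q_mult_integrable: "continuous_on {-1..1} f \<Longrightarrow> (\<lambda>t. q t * f t) integrable_on {-1..1}"
  using q_mult_int set_lebesgue_integral_eq_integral(1) by blast

lemma q_integrable: "q integrable_on {-1..1}"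
  using q_int set_lebesgue_integral_eq_integral(1) by blast

text \<open>Picard iterates of the integral form of the initial value problem. Starting from 0 with
  nonnegative \<open>q\<close> makes them increase, so that a pointwise majorant and dominated
  convergence suffice for the limit.\<close>

primrec approx_sol :: "nat \<Rightarrow> real \<Rightarrow> real" where
  "approx_sol 0 = (\<lambda>s. 0)"
| "approx_sol (Suc n) = (\<lambda>s. s + 1 + prim (prim (\<lambda>t. q t * approx_sol n t)) s)"

lemma approx_sol_cont: "continuous_on {-1..1} (approx_sol n)"
proof (induction n)
  case (Suc n)
  have "continuous_on {-1..1} (prim (\<lambda>t. q t * approx_sol n t))"
    by (intro continuous_on_prim q_mult_integrable Suc)
  then have "prim (\<lambda>t. q t * approx_sol n t) integrable_on {-1..1}"
    by (rule integrable_continuous_interval)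
  then show ?case
    by (auto intro!: continuous_intros continuous_on_prim)
qed auto

lemma prim_approx_integrable: "prim (\<lambda>t. q t * approx_sol n t) integrable_on {-1..1}"
  by (intro integrable_continuous_interval continuous_on_prim q_mult_integrable approx_sol_cont)

lemma approx_sol_mono: "s \<in> {-1..1} \<Longrightarrow> 0 \<le> approx_sol n s \<and> approx_sol n s \<le> approx_sol (Suc n) s"
proof (induction n arbitrary: s)
  case 0
  have "prim (\<lambda>t. 0) = (\<lambda>t. 0)" by (auto simp: prim_def)
  then show ?case using 0 by simp
next
  case (Suc n)
  have "prim (\<lambda>t. q t * approx_sol n t) t \<le> prim (\<lambda>t. q t * approx_sol (Suc n) t) t" if "t \<in> {-1..1}" for t
    using that Suc.IH q_nonneg
    by (intro prim_mono q_mult_integrable approx_sol_cont mult_left_mono) auto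
  then have "prim (prim (\<lambda>t. q t * approx_sol n t)) s \<le> prim (prim (\<lambda>t. q t * approx_sol (Suc n) t)) s"
    using Suc.prems by (intro prim_mono[OF prim_approx_integrable prim_approx_integrable]) auto
  moreover have "0 \<le> approx_sol (Suc n) s"
    using Suc.IH[OF Suc.prems] by linarith
  ultimately show ?case by simp
qed

definition Q where "Q = prim q"

lemma Q_cont: "continuous_on {-1..1} Q"
  unfolding Q_def by (intro continuous_on_prim q_integrable)

lemma Q_deriv: "s \<in> {-1<..<1} \<Longrightarrow> (Q has_real_derivative q s) (at s)"
  unfolding Q_def by (intro prim_has_real_derivative q_integrable q_cont)

lemma Q_mono: "-1 \<le> s \<Longrightarrow> s \<le> t \<Longrightarrow> t \<le> 1 \<Longrightarrow> Q s \<le> Q t"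
  unfolding Q_def by (intro prim_increasing q_integrable q_nonneg)

lemma prim_q_exp:
  assumes "s \<in> {-1..1}"
  shows "prim (\<lambda>t. q t * (2 * exp (2 * Q t))) s = exp (2 * Q s) - 1"
proof -
  have "((\<lambda>t. q t * (2 * exp (2 * Q t))) has_integral (exp (2 * Q s) - exp (2 * Q (-1)))) {-1..s}"
  proof (rule fundamental_theorem_of_calculus_interior)
    show "continuous_on {-1..s} (\<lambda>t. exp (2 * Q t))"
      using assms by (intro continuous_intros continuous_on_subset[OF Q_cont]) auto
    show "((\<lambda>t. exp (2 * Q t)) has_vector_derivative q t * (2 * exp (2 * Q t))) (at t)" if "t \<in> {-1<..<s}" for t
      unfolding has_real_derivative_iff_has_vector_derivative[symmetric]
      using assms that by (auto intro!: derivative_eq_intros Q_deriv)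
  qed (use assms in auto)
  then show ?thesis
    by (simp add: prim_def Q_def integral_unique)
qed

text \<open>The majorant is stable under the iteration: by \<open>prim_q_exp\<close> the inner
  integral of it is exp(2 Q) - 1, and the outer integral multiplies by at most \<open>s + 1\<close>.
  Both factors 2 come from \<open>s + 1\<close> being at most 2.\<close>

lemma approx_sol_bound: "s \<in> {-1..1} \<Longrightarrow> approx_sol n s \<le> 2 * exp (2 * Q s)"
proof (induction n arbitrary: s)
  case (Suc n)
  have c: "continuous_on {-1..1} (\<lambda>t. 2 * exp (2 * Q t))"
    by (intro continuous_intros Q_cont)
  have 1: "prim (\<lambda>t. q t * approx_sol n t) t \<le> exp (2 * Q s) - 1" if "t \<in> {-1..s}" for t
  proof -
    have "prim (\<lambda>t. q t * approx_sol n t) t \<le> prim (\<lambda>t. q t * (2 * exp (2 * Q t))) t"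
      using that Suc q_nonneg
      by (intro prim_mono q_mult_integrable approx_sol_cont mult_left_mono c) auto
    also have "\<dots> = exp (2 * Q t) - 1" using that Suc.prems by (intro prim_q_exp) auto
    also have "\<dots> \<le> exp (2 * Q s) - 1"
      using that Suc.prems Q_mono[of t s] by auto
    finally show ?thesis .
  qed
  have "prim (prim (\<lambda>t. q t * approx_sol n t)) s \<le> prim (\<lambda>t. exp (2 * Q s) - 1) s"
    using Suc.prems 1 by (intro prim_mono prim_approx_integrable) auto
  also have "\<dots> = (s + 1) * (exp (2 * Q s) - 1)"
    using Suc.prems by (simp add: prim_def)
  also have "\<dots> \<le> 2 * (exp (2 * Q s) - 1)"
    using Suc.prems Q_mono[of "-1" s] by (intro mult_right_mono) (auto simp: Q_def)
  finally show ?case using Suc.prems by simp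
qed auto

text \<open>The solution of \<open>\<phi>'' = q \<phi>\<close>, \<open>\<phi> (-1) = 0\<close>, \<open>\<phi>' (-1) = 1\<close>, as the limit of the increasing
  Picard iteration.\<close>

definition sol :: "real \<Rightarrow> real" where "sol s = lim (\<lambda>n. approx_sol n s)"

definition dsol :: "real \<Rightarrow> real" where "dsol s = 1 + prim (\<lambda>t. q t * sol t) s"

lemma approx_sol_tendsto:
  assumes "s \<in> {-1..1}"
  shows "(\<lambda>n. approx_sol n s) \<longlonglongrightarrow> sol s"
proof -
  have "convergent (\<lambda>n. approx_sol n s)"
  proof (rule Bseq_mono_convergent)
    show "Bseq (\<lambda>n. approx_sol n s)"
      using approx_sol_mono[OF assms] approx_sol_bound[OF assms]
      by (intro BseqI'[of _ "2 * exp (2 * Q s)"]) auto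
    show "\<forall>m n. m \<le> n \<longrightarrow> approx_sol m s \<le> approx_sol n s"
      using approx_sol_mono[OF assms] lift_Suc_mono_le[of "\<lambda>n. approx_sol n s"] by blast
  qed
  then show ?thesis by (simp add: sol_def convergent_LIMSEQ_iff)
qed

text \<open>The products with \<open>q\<close> are dominated by \<open>q\<close> times the majorant
  of \<open>approx_sol_bound\<close>, so integrability of the limit and convergence of the integrals
  come together.\<close>

lemma sol_int: "(\<lambda>t. q t * sol t) integrable_on {-1..1}"
  and prim_approx_tendsto: "s \<in> {-1..1} \<Longrightarrow>
    (\<lambda>n. prim (\<lambda>t. q t * approx_sol n t) s) \<longlonglongrightarrow> prim (\<lambda>t. q t * sol t) s"
proof -
  have *: "(\<lambda>t. q t * sol t) integrable_on {-1..s} \<and>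
    (\<lambda>n. integral {-1..s} (\<lambda>t. q t * approx_sol n t)) \<longlonglongrightarrow> integral {-1..s} (\<lambda>t. q t * sol t)"
    if s: "s \<in> {-1..1}" for s
  proof (rule conjI)
    have sub: "h integrable_on {-1..s}" if "h integrable_on {-1..1}" for h :: "real \<Rightarrow> real"
      using that s by (auto intro: integrable_on_subinterval)
    have c: "continuous_on {-1..1} (\<lambda>t. 2 * exp (2 * Q t))"
      by (intro continuous_intros Q_cont)
    note i = sub[OF q_mult_integrable[OF c]] sub[OF q_mult_integrable[OF approx_sol_cont]]
    have b: "norm (q t * approx_sol n t) \<le> q t * (2 * exp (2 * Q t))" if "t \<in> {-1..s}" for t n
      using that s approx_sol_mono[of t n] approx_sol_bound[of t n] q_nonneg[of t]
      by (auto simp: abs_mult intro!: mult_left_mono)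
    have l: "(\<lambda>n. q t * approx_sol n t) \<longlonglongrightarrow> q t * sol t" if "t \<in> {-1..s}" for t
      using that s by (intro tendsto_intros approx_sol_tendsto) auto
    show "(\<lambda>t. q t * sol t) integrable_on {-1..s}"
      using b l by (rule dominated_convergence(1)[OF i(2) i(1)])
    show "(\<lambda>n. integral {-1..s} (\<lambda>t. q t * approx_sol n t)) \<longlonglongrightarrow> integral {-1..s} (\<lambda>t. q t * sol t)"
      using b l by (rule dominated_convergence(2)[OF i(2) i(1)])
  qed
  show "(\<lambda>t. q t * sol t) integrable_on {-1..1}" using *[of 1] by auto
  show "s \<in> {-1..1} \<Longrightarrow> (\<lambda>n. prim (\<lambda>t. q t * approx_sol n t) s) \<longlonglongrightarrow> prim (\<lambda>t. q t * sol t) s"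
    using * by (simp add: prim_def)
qed

lemma sol_nonneg: "s \<in> {-1..1} \<Longrightarrow> 0 \<le> sol s"
  using approx_sol_mono by (intro LIMSEQ_le_const[OF approx_sol_tendsto]) auto

lemma dsol_cont: "continuous_on {-1..1} dsol"
  unfolding dsol_def by (intro continuous_intros continuous_on_prim sol_int)

lemma sol_eq:
  assumes s: "s \<in> {-1..1}"
  shows "sol s = s + 1 + prim (prim (\<lambda>t. q t * sol t)) s"
proof -
  let ?h = "prim (\<lambda>t. q t * sol t)"
  have ci: "continuous_on {-1..1} ?h" by (intro continuous_on_prim sol_int)
  have "(\<lambda>n. integral {-1..s} (prim (\<lambda>t. q t * approx_sol n t))) \<longlonglongrightarrow> integral {-1..s} ?h"
  proof (rule dominated_convergence(2))
    show "prim (\<lambda>t. q t * approx_sol n t) integrable_on {-1..s}" for n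
      using s by (intro integrable_on_subinterval[OF prim_approx_integrable]) auto
    show "?h integrable_on {-1..s}"
      using s by (intro integrable_on_subinterval[OF integrable_continuous_interval[OF ci]]) auto
    \<comment> \<open>Since the iterates increase to their limit, the inner integral of the limit
      itself serves as dominating function.\<close>
    show "norm (prim (\<lambda>t. q t * approx_sol n t) t) \<le> ?h t" if "t \<in> {-1..s}" for n t
    proof -
      have "0 \<le> prim (\<lambda>t. q t * approx_sol n t) t"
        using that s approx_sol_mono q_nonneg
        by (intro prim_nonneg q_mult_integrable approx_sol_cont) (auto intro!: mult_nonneg_nonneg)
      moreover have "approx_sol n r \<le> sol r" if "r \<in> {-1..1}" for r
        using approx_sol_mono[OF that] lift_Suc_mono_le[of "\<lambda>n. approx_sol n r"]
        by (intro LIMSEQ_le_const[OF approx_sol_tendsto[OF that]]) blast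
      then have "prim (\<lambda>t. q t * approx_sol n t) t \<le> ?h t"
        using that s q_nonneg
        by (intro prim_mono q_mult_integrable approx_sol_cont sol_int mult_left_mono) auto
      ultimately show ?thesis by simp
    qed
    show "(\<lambda>n. prim (\<lambda>t. q t * approx_sol n t) t) \<longlonglongrightarrow> ?h t" if "t \<in> {-1..s}" for t
      using that s by (intro prim_approx_tendsto) auto
  qed
  then have "(\<lambda>n. approx_sol (Suc n) s) \<longlonglongrightarrow> s + 1 + prim ?h s"
    by (auto simp: prim_def[of "prim _"] intro!: tendsto_intros)
  moreover have "(\<lambda>n. approx_sol (Suc n) s) \<longlonglongrightarrow> sol s"
    using approx_sol_tendsto[OF s] by (rule LIMSEQ_Suc)
  ultimately show ?thesis by (rule LIMSEQ_unique[rotated])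
qed

lemma sol_cont: "continuous_on {-1..1} sol"
proof -
  have "continuous_on {-1..1} (\<lambda>s. s + 1 + prim (prim (\<lambda>t. q t * sol t)) s)"
    by (intro continuous_intros continuous_on_prim integrable_continuous_interval sol_int)
  then show ?thesis
    by (rule continuous_on_eq) (rule sol_eq[symmetric])
qed

lemma sol_deriv:
  assumes s: "s \<in> {-1<..<1}"
  shows "(sol has_real_derivative dsol s) (at s)"
proof -
  have c: "continuous_on {-1..1} (prim (\<lambda>t. q t * sol t))"
    by (intro continuous_on_prim sol_int)
  have "((\<lambda>s. s + 1 + prim (prim (\<lambda>t. q t * sol t)) s) has_real_derivative dsol s) (at s)"
    unfolding dsol_def using s
    by (auto intro!: derivative_eq_intros prim_has_real_derivative
      integrable_continuous_interval[OF c] continuous_on_subset[OF c])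
  then show ?thesis
    by (rule has_field_derivative_transform_within_open[of _ _ _ "{-1<..<1}"])
      (use s sol_eq in auto)
qed

lemma dsol_deriv: "s \<in> {-1<..<1} \<Longrightarrow> (dsol has_real_derivative q s * sol s) (at s)"
  unfolding dsol_def
  by (auto intro!: derivative_eq_intros prim_has_real_derivative sol_int continuous_intros q_cont
    continuous_on_subset[OF sol_cont])

lemma sol_left: "sol (-1) = 0" and dsol_left: "dsol (-1) = 1"
  using sol_eq[of "-1"] by (auto simp: dsol_def)

lemma sol_ge: "s \<in> {-1..1} \<Longrightarrow> s + 1 \<le> sol s"
  using q_nonneg sol_nonneg
  by (subst sol_eq)
   (auto intro!: prim_nonneg sol_int integrable_continuous_interval continuous_on_prim)

lemma continuous_on_sol_compose:
  "continuous_on A g \<Longrightarrow> g ` A \<subseteq> {-1..1} \<Longrightarrow> continuous_on A (\<lambda>x. sol (g x))"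
  by (rule continuous_on_compose2[OF sol_cont])

lemma sol_reflect_cont: "continuous_on {-1..1} (\<lambda>s. sol (- s))"
  by (rule continuous_on_compose2[OF sol_cont]) (auto intro!: continuous_intros)

lemma dsol_reflect_cont: "continuous_on {-1..1} (\<lambda>s. dsol (- s))"
  by (rule continuous_on_compose2[OF dsol_cont]) (auto intro!: continuous_intros)

lemma sol_reflect_deriv:
  "s \<in> {-1<..<1} \<Longrightarrow> ((\<lambda>s. sol (- s)) has_real_derivative - dsol (- s)) (at s)"
  using DERIV_chain2[where f=sol and g="\<lambda>s. - s", OF sol_deriv[of "- s"] DERIV_minus[OF DERIV_ident]]
  by simp

lemma dsol_reflect_deriv:
  "s \<in> {-1<..<1} \<Longrightarrow> ((\<lambda>s. dsol (- s)) has_real_derivative - (q s * sol (- s))) (at s)"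
  using DERIV_chain2[where f=dsol and g="\<lambda>s. - s", OF dsol_deriv[of "- s"] DERIV_minus[OF DERIV_ident]] q_even[of s]
  by simp

text \<open>By evenness of \<open>q\<close> the reflected function solves the same equation, so this
  Wronskian is constant; the plus sign comes from the inner derivative of the reflection. Its value
  is read off at -1 from the initial data.\<close>

lemma wronskian:
  assumes "s \<in> {-1..1}"
  shows "dsol s * sol (- s) + sol s * dsol (- s) = sol 1"
proof -
  let ?w = "\<lambda>s. dsol s * sol (- s) + sol s * dsol (- s)"
  have c: "continuous_on {-1..1} ?w"
    by (intro continuous_intros sol_cont dsol_cont sol_reflect_cont dsol_reflect_cont)
  have d: "(?w has_real_derivative 0) (at x)" if "-1 < x" "x < 1" for x
    using that by (auto intro!: derivative_eq_intros sol_deriv dsol_deriv sol_reflect_deriv dsol_reflect_deriv)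
  have "?w s = ?w (-1)" "?w 1 = ?w (-1)"
    using assms DERIV_isconst2[OF _ c d] by auto
  then show ?thesis
    by (simp add: sol_left dsol_left)
qed

lemma sol_1_ge: "2 \<le> sol 1" using sol_ge[of 1] by simp

section \<open>The Green function and the inhomogeneous problem\<close>

definition green :: "real \<Rightarrow> real \<Rightarrow> real" where
  "green s x = sol (min s x) * sol (- max s x) / sol 1"

text \<open>The integral of \<open>green s x * f x\<close> over \<open>x\<close>, split at
  \<open>x = s\<close>. Written with primitives from -1, it can be differentiated in
  \<open>s\<close> by the product rule alone; the second bracket is the integral from
  \<open>s\<close> to 1.\<close>

definition bvp_sol :: "(real \<Rightarrow> real) \<Rightarrow> real \<Rightarrow> real" where
  "bvp_sol f s = (sol (- s) * prim (\<lambda>x. sol x * f x) s +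
     sol s * (prim (\<lambda>x. sol (- x) * f x) 1 - prim (\<lambda>x. sol (- x) * f x) s)) / sol 1"

text \<open>The derivative of \<open>bvp_sol f\<close>. The two terms in which a primitive is
  differentiated are both \<open>sol s * sol (- s) * f s\<close>, with opposite signs, and
  cancel.\<close>

definition dbvp_sol :: "(real \<Rightarrow> real) \<Rightarrow> real \<Rightarrow> real" where
  "dbvp_sol f s = (- dsol (- s) * prim (\<lambda>x. sol x * f x) s +
     dsol s * (prim (\<lambda>x. sol (- x) * f x) 1 - prim (\<lambda>x. sol (- x) * f x) s)) / sol 1"

lemma green_sym: "green s x = green x s"
  by (simp add: green_def min.commute max.commute)

lemma green_reflect: "green (- s) (- x) = green s x"
  by (auto simp: green_def min_def max_def)

lemma green_cont1: "x \<in> {-1..1} \<Longrightarrow> continuous_on {-1..1} (\<lambda>s. green s x)"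
  unfolding green_def using sol_1_ge
  by (intro continuous_on_divide continuous_on_mult continuous_on_sol_compose continuous_on_min
      continuous_on_max continuous_on_minus continuous_on_id continuous_on_const) auto

lemma green_left: "x \<in> {-1..1} \<Longrightarrow> green (-1) x = 0" and green_right: "x \<in> {-1..1} \<Longrightarrow> green 1 x = 0"
  by (auto simp: green_def sol_left min_def max_def)

context
  fixes f :: "real \<Rightarrow> real"
  assumes f_int: "f absolutely_integrable_on {-1..1}" and f_cont: "continuous_on {-1<..<1} f"
begin

lemma mult_f_int: "continuous_on {-1..1} g \<Longrightarrow> (\<lambda>x. g x * f x) integrable_on {-1..1}"
  using absolutely_integrable_mult_continuous[OF f_int] set_lebesgue_integral_eq_integral(1) by blast

lemma mult_f_cont: "continuous_on {-1..1} g \<Longrightarrow> continuous_on {-1<..<1} (\<lambda>x. g x * f x)"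
  by (intro continuous_intros f_cont) (auto intro: continuous_on_subset)

lemmas mult_f_sol_int = mult_f_int[OF sol_cont] mult_f_int[OF sol_reflect_cont]
lemmas mult_f_sol_cont = mult_f_cont[OF sol_cont] mult_f_cont[OF sol_reflect_cont]

lemma bvp_sol_cont: "continuous_on {-1..1} (bvp_sol f)"
  unfolding bvp_sol_def using sol_1_ge
  by (intro continuous_intros sol_cont sol_reflect_cont continuous_on_prim mult_f_sol_int) auto

lemma dbvp_sol_cont: "continuous_on {-1..1} (dbvp_sol f)"
  unfolding dbvp_sol_def using sol_1_ge
  by (intro continuous_intros dsol_cont dsol_reflect_cont continuous_on_prim mult_f_sol_int) auto

lemma bvp_sol_left: "bvp_sol f (-1) = 0" and bvp_sol_right: "bvp_sol f 1 = 0"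
  by (simp_all add: bvp_sol_def sol_left)

lemma bvp_sol_deriv:
  assumes "s \<in> {-1<..<1}"
  shows "(bvp_sol f has_real_derivative dbvp_sol f s) (at s)"
proof -
  define A B where "A = prim (\<lambda>x. sol x * f x)" and "B = prim (\<lambda>x. sol (- x) * f x)"
  have A: "(A has_real_derivative sol s * f s) (at s)"
    and B: "(B has_real_derivative sol (- s) * f s) (at s)"
    unfolding A_def B_def by (intro prim_has_real_derivative mult_f_sol_int mult_f_sol_cont assms)+
  have "((\<lambda>s. (sol (- s) * A s + sol s * (B 1 - B s)) / sol 1) has_real_derivative
     ((- dsol (- s)) * A s + sol s * f s * sol (- s) + (dsol s * (B 1 - B s) + (0 - sol (- s) * f s) * sol s)) / sol 1) (at s)"
    by (intro DERIV_cdivide DERIV_add DERIV_mult DERIV_diff DERIV_const A B sol_deriv sol_reflect_deriv assms)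
  then show ?thesis
    by (simp add: bvp_sol_def[abs_def] dbvp_sol_def A_def B_def algebra_simps)
qed

lemma dbvp_sol_deriv:
  assumes "s \<in> {-1<..<1}"
  shows "(dbvp_sol f has_real_derivative q s * bvp_sol f s - f s) (at s)"
proof -
  define A B where "A = prim (\<lambda>x. sol x * f x)" and "B = prim (\<lambda>x. sol (- x) * f x)"
  have A: "(A has_real_derivative sol s * f s) (at s)"
    and B: "(B has_real_derivative sol (- s) * f s) (at s)"
    unfolding A_def B_def by (intro prim_has_real_derivative mult_f_sol_int mult_f_sol_cont assms)+
  let ?d = "(- (- (q s * sol (- s))) * A s + sol s * f s * (- dsol (- s)) +
       (q s * sol s * (B 1 - B s) + (0 - sol (- s) * f s) * dsol s)) / sol 1"
  have "((\<lambda>s. (- dsol (- s) * A s + dsol s * (B 1 - B s)) / sol 1) has_real_derivative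
     ?d) (at s)"
    by (intro DERIV_cdivide DERIV_add DERIV_mult DERIV_diff DERIV_const DERIV_minus A B
        dsol_deriv dsol_reflect_deriv assms)
  then have "(dbvp_sol f has_real_derivative
     ?d) (at s)"
    by (simp only: dbvp_sol_def[abs_def] A_def B_def)
  \<comment> \<open>This time the terms from the moving end point do not cancel: they combine to the
    Wronskian divided by \<open>sol 1\<close>, that is to 1, and produce the right-hand side
    \<open>- f s\<close>.\<close>
  moreover have "?d
     = q s * bvp_sol f s - f s * ((dsol s * sol (- s) + sol s * dsol (- s)) / sol 1)"
    unfolding bvp_sol_def A_def[symmetric] B_def[symmetric]
    using sol_1_ge by (simp add: divide_simps) (simp add: algebra_simps)
  moreover have "(dsol s * sol (- s) + sol s * dsol (- s)) / sol 1 = 1"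
    using sol_1_ge assms by (subst wronskian) auto
  ultimately show ?thesis by simp
qed

lemma bvp_sol_eq_integral:
  assumes s: "s \<in> {-1..1}"
  shows "bvp_sol f s = integral {-1..1} (\<lambda>x. green s x * f x)"
proof -
  let ?A = "\<lambda>x. sol x * f x" and ?B = "\<lambda>x. sol (- x) * f x"
  have i: "(\<lambda>x. green s x * f x) integrable_on {-1..1}"
    using s by (intro mult_f_int) (simp add: green_cont1 green_sym[of s])
  have sub: "h integrable_on {a..b}" if "h integrable_on {-1..1}" "-1 \<le> a" "b \<le> 1" for h :: "real \<Rightarrow> real" and a b
    using that by (auto intro: integrable_on_subinterval)
  have "integral {-1..1} (\<lambda>x. green s x * f x)
      = integral {-1..s} (\<lambda>x. green s x * f x) + integral {s..1} (\<lambda>x. green s x * f x)"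
    using s i by (intro Henstock_Kurzweil_Integration.integral_combine[symmetric]) auto
  also have "integral {-1..s} (\<lambda>x. green s x * f x) = integral {-1..s} (\<lambda>x. sol (- s) / sol 1 * ?A x)"
    by (intro integral_cong) (auto simp: green_def min_def max_def)
  also have "\<dots> = sol (- s) / sol 1 * prim ?A s" by (simp only: integral_mult_right prim_def)
  also have "integral {s..1} (\<lambda>x. green s x * f x) = integral {s..1} (\<lambda>x. sol s / sol 1 * ?B x)"
    by (intro integral_cong) (auto simp: green_def min_def max_def)
  also have "\<dots> = sol s / sol 1 * integral {s..1} ?B" by (simp only: integral_mult_right)
  also have "integral {s..1} ?B = prim ?B 1 - prim ?B s"
    using s mult_f_sol_int(2) Henstock_Kurzweil_Integration.integral_combine[of "-1" s 1 ?B] by (auto simp: prim_def)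
  finally show ?thesis
    by (simp add: bvp_sol_def add_divide_distrib)
qed

lemma bvp_sol_unique:
  assumes cont: "continuous_on {-1..1} g" and bd: "g (-1) = 0" "g 1 = 0"
    and g: "\<And>s. s \<in> {-1<..<1} \<Longrightarrow> (g has_real_derivative g1 s) (at s)"
    and g1: "\<And>s. s \<in> {-1<..<1} \<Longrightarrow> (g1 has_real_derivative q s * g s - f s) (at s)"
    and s: "s \<in> {-1..1}"
  shows "g s = bvp_sol f s"
proof -
  have "g s - bvp_sol f s = 0"
  proof (rule homogeneous_bvp_unique[where q=q and D="\<lambda>s. g s - bvp_sol f s" and ?D1.0 = "\<lambda>s. g1 s - dbvp_sol f s"])
    show "continuous_on {-1..1} (\<lambda>s. g s - bvp_sol f s)"
      by (intro continuous_intros cont bvp_sol_cont)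
    show "((\<lambda>s. g s - bvp_sol f s) has_real_derivative g1 s - dbvp_sol f s) (at s)" if "s \<in> {-1<..<1}" for s
      by (intro derivative_intros g bvp_sol_deriv that)
    show "((\<lambda>s. g1 s - dbvp_sol f s) has_real_derivative q s * (g s - bvp_sol f s)) (at s)" if "s \<in> {-1<..<1}" for s
      using DERIV_diff[OF g1[OF that] dbvp_sol_deriv[OF that]] by (simp add: algebra_simps)
  qed (use bd s q_nonneg bvp_sol_left bvp_sol_right in auto)
  then show ?thesis by simp
qed

end

text \<open>Integration by parts for \<open>bvp_sol f * dbvp_sol g\<close>; the boundary terms
  vanish because \<open>bvp_sol f\<close> does. The left integrand is symmetric in \<open>f\<close>
  and \<open>g\<close>, so the right-hand side is too.\<close>

lemma energy_identity:
  assumes f: "f absolutely_integrable_on {-1..1}" "continuous_on {-1<..<1} f"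
    and g: "g absolutely_integrable_on {-1..1}" "continuous_on {-1<..<1} g"
  shows "((\<lambda>s. dbvp_sol f s * dbvp_sol g s + q s * bvp_sol f s * bvp_sol g s)
     has_integral integral {-1..1} (\<lambda>s. bvp_sol f s * g s)) {-1..1}"
proof -
  have "((\<lambda>s. dbvp_sol f s * dbvp_sol g s + bvp_sol f s * (q s * bvp_sol g s - g s)) has_integral
     (bvp_sol f 1 * dbvp_sol g 1 - bvp_sol f (-1) * dbvp_sol g (-1))) {-1..1}"
  proof (rule fundamental_theorem_of_calculus_interior)
    show "continuous_on {-1..1} (\<lambda>s. bvp_sol f s * dbvp_sol g s)"
      using f g by (intro continuous_intros bvp_sol_cont dbvp_sol_cont)
    show "((\<lambda>s. bvp_sol f s * dbvp_sol g s) has_vector_derivative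
       dbvp_sol f s * dbvp_sol g s + bvp_sol f s * (q s * bvp_sol g s - g s)) (at s)" if "s \<in> {-1<..<1}" for s
      unfolding has_real_derivative_iff_has_vector_derivative[symmetric]
      using DERIV_mult[OF bvp_sol_deriv[OF f that] dbvp_sol_deriv[OF g that]] by (simp add: algebra_simps)
  qed auto
  from has_integral_add[OF this integrable_integral[OF mult_f_int[OF g bvp_sol_cont[OF f]]]]
  show ?thesis
    using bvp_sol_left[OF f] bvp_sol_right[OF f] by (simp add: algebra_simps)
qed

text \<open>The even solution \<open>y s = \<phi> s + \<phi> (- s)\<close> grows at most by the factor \<open>e\<^sup>\<rho>\<close> on \<open>[0,1]\<close>, because
  \<open>y' \<le> y \<integral>\<^sub>0\<^sup>t q\<close>.\<close>

lemma even_sol_bounds: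
  fixes \<rho> defines "\<rho> \<equiv> integral {0..1} (\<lambda>s. (1 - s) * q s)"
  shows "x \<in> {0..1} \<Longrightarrow> sol 0 + sol 0 \<le> sol x + sol (- x)"
    and "sol 1 \<le> exp \<rho> * (sol 0 + sol 0)"
proof -
  define y where "y = (\<lambda>s. sol s + sol (- s))"
  define y1 where "y1 = (\<lambda>s. dsol s - dsol (- s))"
  have yc: "continuous_on {-1..1} y" and y1c: "continuous_on {-1..1} y1"
    unfolding y_def y1_def
    by (intro continuous_intros sol_cont dsol_cont sol_reflect_cont dsol_reflect_cont)+
  have yd: "(y has_real_derivative y1 s) (at s)" if "-1 < s" "s < 1" for s
    unfolding y_def y1_def using DERIV_add[OF sol_deriv sol_reflect_deriv] that by simp
  have y1d: "(y1 has_real_derivative q s * y s) (at s)" if "-1 < s" "s < 1" for s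
    unfolding y_def y1_def using DERIV_diff[OF dsol_deriv dsol_reflect_deriv] that by (simp add: algebra_simps)
  have ypos: "0 \<le> y s" if "-1 \<le> s" "s \<le> 1" for s
    using that sol_nonneg by (auto simp: y_def)
  have y1pos: "0 \<le> y1 s" if "0 \<le> s" "s \<le> 1" for s
  proof -
    have "y1 0 \<le> y1 s"
      using that ypos q_nonneg
      by (intro DERIV_nonneg_imp_increasing_open[of 0 s y1])
        (auto intro!: exI y1d mult_nonneg_nonneg continuous_on_subset[OF y1c])
    then show ?thesis by (simp add: y1_def)
  qed
  show "sol 0 + sol 0 \<le> sol x + sol (- x)" if "x \<in> {0..1}"
  proof -
    have "y 0 \<le> y x"
      using that
      by (intro DERIV_nonneg_imp_increasing_open[of 0 x y])
        (auto intro!: exI yd y1pos continuous_on_subset[OF yc])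
    then show ?thesis by (simp add: y_def)
  qed
  \<comment> \<open>\<open>P1 t\<close> is the integral of \<open>q\<close> from 0 to
    \<open>t\<close>. The increment of its primitive \<open>P\<close> over [0,1] equals \<rho> after
    an integration by parts.\<close>
  define P1 where "P1 = (\<lambda>t. Q t - Q 0)"
  define P where "P = prim P1"
  have P1c: "continuous_on {-1..1} P1" unfolding P1_def by (intro continuous_intros Q_cont)
  have P1d: "(P1 has_real_derivative q s) (at s)" if "-1 < s" "s < 1" for s
    unfolding P1_def using that by (auto intro!: derivative_eq_intros Q_deriv)
  have P1i: "P1 integrable_on {-1..1}" by (intro integrable_continuous_interval P1c)
  have Pc: "continuous_on {-1..1} P" unfolding P_def by (intro continuous_on_prim P1i)
  have Pd: "(P has_real_derivative P1 s) (at s)" if "-1 < s" "s < 1" for s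
    unfolding P_def using that by (intro prim_has_real_derivative P1i) (auto intro: continuous_on_subset[OF P1c])
  have key: "y1 s \<le> y s * P1 s" if "0 \<le> s" "s \<le> 1" for s
  proof -
    \<comment> \<open>Differentiating, the two terms \<open>q * y\<close> cancel and
      \<open>y1 * P1\<close> remains, which is nonnegative. At 0 both \<open>P1\<close> and
      \<open>y1\<close> vanish.\<close>
    have "y 0 * P1 0 - y1 0 \<le> y s * P1 s - y1 s"
    proof (rule DERIV_nonneg_imp_increasing_open[OF that(1), where f="\<lambda>s. y s * P1 s - y1 s"])
      fix x assume x: "0 < x" "x < s"
      have "((\<lambda>s. y s * P1 s - y1 s) has_real_derivative (y1 x * P1 x + q x * y x) - q x * y x) (at x)"
        using x that by (intro DERIV_diff DERIV_mult yd P1d y1d) auto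
      moreover have "0 \<le> y1 x * P1 x"
        using x that y1pos[of x] Q_mono[of 0 x] by (auto simp: P1_def)
      ultimately show "\<exists>l. ((\<lambda>s. y s * P1 s - y1 s) has_real_derivative l) (at x) \<and> 0 \<le> l"
        by auto
    qed (use that in \<open>auto intro!: continuous_intros continuous_on_subset[OF yc] continuous_on_subset[OF y1c] continuous_on_subset[OF P1c]\<close>)
    then show ?thesis by (simp add: y1_def P1_def)
  qed
  have "y 1 * exp (- P 1) \<le> y 0 * exp (- P 0)"
  proof (rule DERIV_nonpos_imp_decreasing_open[where f="\<lambda>s. y s * exp (- P s)" and a=0 and b=1])
    fix x :: real assume x: "0 < x" "x < 1"
    have "((\<lambda>s. y s * exp (- P s)) has_real_derivative (y1 x - y x * P1 x) * exp (- P x)) (at x)"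
      using x by (auto intro!: derivative_eq_intros yd Pd simp: algebra_simps)
    moreover have "(y1 x - y x * P1 x) * exp (- P x) \<le> 0"
      using key[of x] x by (intro mult_nonpos_nonneg) auto
    ultimately show "\<exists>l. ((\<lambda>s. y s * exp (- P s)) has_real_derivative l) (at x) \<and> l \<le> 0"
      by blast
  qed (auto intro!: continuous_intros continuous_on_subset[OF yc] continuous_on_subset[OF Pc])
  moreover have "P 1 - P 0 = \<rho>"
  proof -
    have "((\<lambda>s. (1 - s) * q s) has_integral ((P 1 + (1 - 1) * P1 1) - (P 0 + (1 - 0) * P1 0))) {0..1}"
    proof (rule fundamental_theorem_of_calculus_interior[where f="\<lambda>s. P s + (1 - s) * P1 s"])
      show "((\<lambda>s. P s + (1 - s) * P1 s) has_vector_derivative (1 - s) * q s) (at s)" if "s \<in> {0<..<1}" for s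
        unfolding has_real_derivative_iff_has_vector_derivative[symmetric]
        using that by (auto intro!: derivative_eq_intros Pd P1d)
    qed (auto intro!: continuous_intros continuous_on_subset[OF P1c] continuous_on_subset[OF Pc])
    then show ?thesis by (simp add: \<rho>_def integral_unique P1_def)
  qed
  ultimately have "y 1 \<le> exp \<rho> * y 0"
    by (simp add: exp_minus exp_diff field_simps flip: \<open>P 1 - P 0 = \<rho>\<close>)
  then show "sol 1 \<le> exp \<rho> * (sol 0 + sol 0)"
    by (simp add: y_def sol_left)
qed

text \<open>For 0 <= x <= s the sum is \<open>sol (- s) * (sol x + sol (- x)) / sol 1\<close>. Here
  \<open>sol (- s)\<close> is at least \<open>1 - s\<close>, and the remaining quotient is at least
  exp(-\<rho>) by \<open>even_sol_bounds\<close>. Symmetry and reflection of \<open>green\<close>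
  give all other positions of \<open>s\<close> and \<open>x\<close>.\<close>

lemma green_lower:
  fixes \<rho> defines "\<rho> \<equiv> integral {0..1} (\<lambda>s. (1 - s) * q s)"
  assumes s: "s \<in> {-1..1}" and x: "x \<in> {-1..1}"
  shows "exp (- \<rho>) / 2 * ((1 - s\<^sup>2) * (1 - x\<^sup>2)) \<le> green s x + green (- s) x"
proof -
  have ordered: "exp (- \<rho>) / 2 * ((1 - s\<^sup>2) * (1 - x\<^sup>2)) \<le> green s x + green (- s) x"
    if "0 \<le> x" "x \<le> s" "s \<le> 1" for s x
  proof -
    have "green s x + green (- s) x = sol (- s) * (sol x + sol (- x)) / sol 1"
      using that by (simp add: green_def min_def max_def add_divide_distrib algebra_simps)
    moreover have "(1 - s) * (sol 0 + sol 0) / sol 1 \<le> sol (- s) * (sol x + sol (- x)) / sol 1"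
      using that sol_ge[of "- s"] even_sol_bounds(1)[of x] sol_1_ge sol_nonneg[of 0]
      by (intro divide_right_mono mult_mono) auto
    moreover have "exp (- \<rho>) * (1 - s) \<le> (1 - s) * (sol 0 + sol 0) / sol 1"
    proof -
      have "exp (- \<rho>) * sol 1 \<le> sol 0 + sol 0"
        using even_sol_bounds(2) by (simp add: \<rho>_def exp_minus field_simps)
      from mult_left_mono[OF this, of "1 - s"] that sol_1_ge show ?thesis
        by (simp add: field_simps)
    qed
    \<comment> \<open>The sharper factor \<open>1 - s\<close> is valid only for the larger variable.
      It is weakened to a product in \<open>s\<close> and \<open>x\<close>, with the weight of the
      Legendre operator.\<close>
    moreover have "exp (- \<rho>) / 2 * ((1 - s\<^sup>2) * (1 - x\<^sup>2)) \<le> exp (- \<rho>) * (1 - s)"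
    proof -
      have "(1 - s\<^sup>2) * (1 - x\<^sup>2) \<le> (1 - s\<^sup>2) * 1"
        using that by (intro mult_left_mono) (auto simp: abs_square_le_1)
      also have "\<dots> = (1 - s) * (1 + s)" by (simp add: power2_eq_square algebra_simps)
      also have "\<dots> \<le> (1 - s) * 2" using that by (intro mult_left_mono) auto
      finally show ?thesis by simp
    qed
    ultimately show ?thesis by linarith
  qed
  have swap: "green s x + green (- s) x = green x s + green (- x) s" for s x
    using green_sym[of s x] green_sym[of "-s" x] green_reflect[of x "-s"] by simp
  have nonneg: "exp (- \<rho>) / 2 * ((1 - s\<^sup>2) * (1 - x\<^sup>2)) \<le> green s x + green (- s) x"
    if "0 \<le> x" "0 \<le> s" "s \<le> 1" "x \<le> 1" for s x
    using ordered[of x s] ordered[of s x] that swap[of s x] by (cases "x \<le> s") (auto simp: mult.commute)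
  have "green s x + green (- s) x = green \<bar>s\<bar> \<bar>x\<bar> + green (- \<bar>s\<bar>) \<bar>x\<bar>"
    using green_reflect[of s x] green_reflect[of "-s" x] by (auto simp: abs_if)
  then show ?thesis
    using nonneg[of "\<bar>x\<bar>" "\<bar>s\<bar>"] s x by (simp add: abs_le_iff)
qed

end

section \<open>Distributional solutions\<close>

lemma continuous_antiderivative_exists:
  fixes f :: "real \<Rightarrow> 'a::euclidean_space"
  assumes "continuous_on UNIV f"
  obtains F where "F a = 0" "\<And>x. (F has_vector_derivative f x) (at x)"
proof -
  let ?F = "\<lambda>x. (LBINT t=a..x. f t)"
  have "?F a = 0" by simp
  moreover have "(?F has_vector_derivative f x) (at x)" for x
  proof -
    have "(?F has_vector_derivative f x) (at x within {min a x - 1..max a x + 1})"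
      by (rule interval_integral_FTC2) (auto intro: continuous_on_subset[OF assms])
    moreover have "at x within {min a x - 1..max a x + 1} = at x"
      by (rule at_within_interior) auto
    ultimately show ?thesis by simp
  qed
  ultimately show thesis by (rule that)
qed

text \<open>Both primitives vanish on the left of the support. On the right \<open>B1\<close> is the
  mass \<open>c\<close> and \<open>B2\<close> is affine, so a combination of shifted bumps with zero
  mass and zero first moment has a compactly supported second primitive.\<close>

lemma bump_primitives:
  obtains B1 B2 :: "real \<Rightarrow> real" and c where
    "\<And>x. (B1 has_real_derivative bump x) (at x)" "\<And>x. (B2 has_real_derivative B1 x) (at x)"
    "\<And>x. x \<le> -1 \<Longrightarrow> B1 x = 0" "\<And>x. x \<le> -1 \<Longrightarrow> B2 x = 0"
    "\<And>x. 1 \<le> x \<Longrightarrow> B1 x = c" "\<And>x. 1 \<le> x \<Longrightarrow> B2 x = B2 1 + c * (x - 1)" "0 < c"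
proof -
  obtain B1 where B1: "B1 (-1) = 0" "\<And>x. (B1 has_real_derivative bump x) (at x)"
    using continuous_antiderivative_exists[OF Ck_continuous[OF Ck_bump], of "-1"]
    by (auto simp: has_real_derivative_iff_has_vector_derivative)
  have "continuous_on UNIV B1"
    using DERIV_isCont[OF B1(2)] by (auto intro: continuous_at_imp_continuous_on)
  then obtain B2 where B2: "B2 (-1) = 0" "\<And>x. (B2 has_real_derivative B1 x) (at x)"
    using continuous_antiderivative_exists[of B1 "-1"]
    by (auto simp: has_real_derivative_iff_has_vector_derivative)
  have const: "f x = f y" if "x \<le> y" "\<And>z. x < z \<Longrightarrow> z < y \<Longrightarrow> (f has_real_derivative 0) (at z)"
    "\<And>z. isCont f z" for f :: "real \<Rightarrow> real" and x y
  proof -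
    have "continuous_on {x..y} f" using that(3) by (auto intro: continuous_at_imp_continuous_on)
    then show ?thesis using that(1,2) DERIV_isconst_end[of x y f] by (cases "x = y") auto
  qed
  have l1: "B1 x = 0" if "x \<le> -1" for x
    using const[OF that, of B1] B1 DERIV_isCont[OF B1(2)] bump_zero by (smt (verit))
  have l2: "B2 x = 0" if "x \<le> -1" for x
    using const[OF that, of B2] B2 l1 by (metis DERIV_isCont less_eq_real_def)
  have r1: "B1 x = B1 1" if "1 \<le> x" for x
    using const[OF that, of B1] B1 bump_zero by (smt (verit) DERIV_isCont)
  have r2: "B2 x = B2 1 + B1 1 * (x - 1)" if "1 \<le> x" for x
  proof -
    have "(\<lambda>x. B2 x - B1 1 * (x - 1)) 1 = (\<lambda>x. B2 x - B1 1 * (x - 1)) x"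
    proof (rule const[OF that])
      show "((\<lambda>x. B2 x - B1 1 * (x - 1)) has_real_derivative 0) (at z)" if "1 < z" for z
        using r1[of z] that by (auto intro!: derivative_eq_intros B2)
      show "isCont (\<lambda>x. B2 x - B1 1 * (x - 1)) z" for z
        using DERIV_isCont[OF B2(2)] by (intro continuous_intros)
    qed
    then show ?thesis by simp
  qed
  have "B1 (-1) < B1 1"
    by (rule DERIV_pos_imp_increasing_open)
      (auto intro!: exI B1 bump_pos continuous_at_imp_continuous_on DERIV_isCont[OF B1(2)])
  then show ?thesis using that[OF B1(2) B2(2) l1 l2 r1 r2] B1(1) by simp
qed

lemma test_functionI:
  assumes "\<And>n. Ck UNIV n \<phi>" "-1 < a" "b < 1" "\<And>s. s \<notin> {a..b} \<Longrightarrow> \<phi> s = 0"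
  shows "test_function \<phi>"
  unfolding test_function_def
proof (intro conjI allI)
  show "(ds ^^ n) \<phi> differentiable at s" for n s
  proof -
    have "Ck UNIV (Suc 0) ((ds ^^ n) \<phi>)"
      using assms(1)[of "Suc 0 + n"] by (intro Ck_funpow_ds) auto
    from Ck_ds(2)[OF open_UNIV this, of s] show ?thesis
      by (auto intro: differentiableI_vector)
  qed
qed (use assms(2-) in blast)

lemma test_function_deriv:
  assumes "test_function \<phi>"
  shows "(\<phi> has_real_derivative ds \<phi> s) (at s)"
    and "(ds \<phi> has_real_derivative (ds ^^ 2) \<phi> s) (at s)"
    and "isCont ((ds ^^ 2) \<phi>) s"
    and "\<phi> 1 = 0" "\<phi> (-1) = 0" "ds \<phi> 1 = 0" "ds \<phi> (-1) = 0"
proof -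
  have d: "(ds ^^ n) \<phi> differentiable (at s)" for n s
    using assms by (auto simp: test_function_def)
  then have d': "((ds ^^ n) \<phi> has_real_derivative (ds ^^ Suc n) \<phi> s) (at s)" for n s
    by (simp add: has_real_derivative_iff_has_vector_derivative ds_def vector_derivative_works)
  show d0: "(\<phi> has_real_derivative ds \<phi> s) (at s)" for s using d'[of 0] by simp
  show "(ds \<phi> has_real_derivative (ds ^^ 2) \<phi> s) (at s)" using d'[of 1 s] by (simp add: numeral_2_eq_2)
  show "isCont ((ds ^^ 2) \<phi>) s" using d[of 2 s] by (rule differentiable_imp_continuous_within)
  obtain a b where ab: "-1 < a" "b < 1" "\<And>s. s \<notin> {a..b} \<Longrightarrow> \<phi> s = 0"
    using assms by (auto simp: test_function_def)
  show "\<phi> 1 = 0" "\<phi> (-1) = 0" using ab by auto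
  have z: "ds \<phi> s = 0" if "s \<in> - {a..b}" for s
  proof -
    have "((\<lambda>x. 0) has_real_derivative 0) (at s)" by simp
    then have "(\<phi> has_real_derivative 0) (at s)"
      by (rule has_field_derivative_transform_within_open[of _ _ _ "- {a..b}"]) (use that ab(3) in auto)
    with d0 show ?thesis by (metis DERIV_unique)
  qed
  show "ds \<phi> 1 = 0" "ds \<phi> (-1) = 0" using z ab by auto
qed

text \<open>The rescaled bump has mass \<open>\<epsilon> * c\<close>; divided by it, the bumps form
  an approximate identity at \<open>a\<close>. The support is kept inside [-1,1] and inside the
  radius where \<open>h\<close> varies by less than \<delta>.\<close>

lemma integral_bump_approx:
  fixes h :: "real \<Rightarrow> real"
  assumes h: "continuous_on {-1..1} h" and a: "a \<in> {-1<..<1}" and "0 < \<delta>"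
    and B1: "\<And>x. (B1 has_real_derivative bump x) (at x)"
    and B1l: "\<And>x. x \<le> -1 \<Longrightarrow> B1 x = 0" and B1r: "\<And>x. 1 \<le> x \<Longrightarrow> B1 x = c"
  shows "\<exists>e>0. \<forall>\<epsilon>. 0 < \<epsilon> \<and> \<epsilon> < e \<longrightarrow>
    \<bar>integral {-1..1} (\<lambda>t. h t * bump ((t - a) / \<epsilon>)) - h a * (\<epsilon> * c)\<bar> \<le> \<delta> * (\<epsilon> * c)"
proof -
  obtain r where r: "r > 0" "\<And>t. t \<in> {-1..1} \<Longrightarrow> dist t a < r \<Longrightarrow> dist (h t) (h a) < \<delta>"
    using h a \<open>0 < \<delta>\<close> unfolding continuous_on_iff by (metis greaterThanLessThan_subseteq_atLeastAtMost_iff order_refl subset_iff)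
  define e where "e = min r (min (1 - a) (a + 1))"
  have "e > 0" using r a by (auto simp: e_def)
  moreover have "\<bar>integral {-1..1} (\<lambda>t. h t * bump ((t - a) / \<epsilon>)) - h a * (\<epsilon> * c)\<bar> \<le> \<delta> * (\<epsilon> * c)"
    if e: "0 < \<epsilon>" "\<epsilon> < e" for \<epsilon>
  proof -
    let ?b = "\<lambda>t. bump ((t - a) / \<epsilon>)"
    have "(?b has_integral (\<epsilon> * B1 ((1 - a) / \<epsilon>) - \<epsilon> * B1 ((-1 - a) / \<epsilon>))) {-1..1}"
    proof (rule fundamental_theorem_of_calculus)
      show "((\<lambda>t. \<epsilon> * B1 ((t - a) / \<epsilon>)) has_vector_derivative ?b t) (at t within {-1..1})" for t
      proof -
        have "((\<lambda>t. (t - a) / \<epsilon>) has_real_derivative 1 / \<epsilon>) (at t)"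
          using e by (auto intro!: derivative_eq_intros)
        from DERIV_cmult[OF DERIV_chain2[OF B1 this], of \<epsilon>] e
        have "((\<lambda>t. \<epsilon> * B1 ((t - a) / \<epsilon>)) has_real_derivative ?b t) (at t)" by simp
        then show ?thesis
          by (simp add: has_real_derivative_iff_has_vector_derivative has_vector_derivative_at_within)
      qed
    qed simp
    moreover have "B1 ((1 - a) / \<epsilon>) = c" "B1 ((-1 - a) / \<epsilon>) = 0"
      using e a by (auto intro!: B1l B1r simp: e_def field_simps)
    ultimately have ib: "(?b has_integral (\<epsilon> * c)) {-1..1}" by simp
    have bc: "continuous_on {-1..1} ?b"
      using e by (intro continuous_on_compose2[OF Ck_continuous[OF Ck_bump[of UNIV]]] continuous_intros) auto
    have "((\<lambda>t. h t * ?b t) has_integral integral {-1..1} (\<lambda>t. h t * ?b t)) {-1..1}"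
      by (intro integrable_integral integrable_continuous_interval continuous_intros h bc)
    from has_integral_diff[OF this has_integral_mult_right[OF ib, of "h a"]]
    have d: "((\<lambda>t. (h t - h a) * ?b t) has_integral (integral {-1..1} (\<lambda>t. h t * ?b t) - h a * (\<epsilon> * c))) {-1..1}"
      by (simp add: algebra_simps)
    have "norm (integral {-1..1} (\<lambda>t. (h t - h a) * ?b t)) \<le> integral {-1..1} (\<lambda>t. \<delta> * ?b t)"
    proof (rule integral_norm_bound_integral)
      fix t :: real assume t: "t \<in> {-1..1}"
      show "norm ((h t - h a) * ?b t) \<le> \<delta> * ?b t"
      proof (cases "\<bar>t - a\<bar> < \<epsilon>")
        case True
        then have "\<bar>h t - h a\<bar> \<le> \<delta>" using r(2)[OF t] e by (auto simp: dist_real_def e_def)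
        then show ?thesis using bump_nonneg by (auto simp: abs_mult intro!: mult_right_mono)
      next
        case False
        then have "?b t = 0" using e by (intro bump_zero) (simp add: field_simps)
        then show ?thesis by simp
      qed
    qed (use d has_integral_mult_right[OF ib, of \<delta>] in \<open>auto intro: has_integral_integrable\<close>)
    moreover have "integral {-1..1} (\<lambda>t. \<delta> * ?b t) = \<delta> * (\<epsilon> * c)"
      using has_integral_mult_right[OF ib, of \<delta>] by (rule integral_unique)
    ultimately show ?thesis using integral_unique[OF d] by (simp only: real_norm_def)
  qed
  ultimately show ?thesis by blast
qed

text \<open>The test function has as second derivative three narrow bumps at \<open>a\<close>,
  \<open>p\<close>, \<open>b\<close> with weights b - p, -(b - a), p - a. These weights annihilate
  constants and linear functions, so the second primitive has compact support; shrinking the width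
  gives collinearity of three points of the graph of \<open>h\<close>.\<close>

lemma second_order_du_Bois_Reymond_3:
  fixes h :: "real \<Rightarrow> real"
  assumes h: "continuous_on {-1..1} h"
    and orth: "\<And>\<phi>. test_function \<phi> \<Longrightarrow> integral {-1..1} (\<lambda>s. h s * (ds ^^ 2) \<phi> s) = 0"
    and abc: "-1 < a" "a < p" "p < b" "b < 1"
  shows "(b - p) * h a + (p - a) * h b = (b - a) * h p"
proof (rule bump_primitives)
  fix B1 B2 :: "real \<Rightarrow> real" and c
  assume B: "\<And>x. (B1 has_real_derivative bump x) (at x)" "\<And>x. (B2 has_real_derivative B1 x) (at x)"
    "\<And>x. x \<le> -1 \<Longrightarrow> B1 x = 0" "\<And>x. x \<le> -1 \<Longrightarrow> B2 x = 0"
    "\<And>x. 1 \<le> x \<Longrightarrow> B1 x = c" "\<And>x. 1 \<le> x \<Longrightarrow> B2 x = B2 1 + c * (x - 1)" "0 < c"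
  let ?L = "(b - p) * h a - (b - a) * h p + (p - a) * h b"
  have bound: "\<bar>?L\<bar> \<le> \<delta> * (2 * (b - a))" if \<delta>: "\<delta> > 0" for \<delta>
  proof -
    define P where "P = (\<lambda>z e. 0 < e \<and> (\<forall>\<epsilon>. 0 < \<epsilon> \<and> \<epsilon> < e \<longrightarrow>
      \<bar>integral {-1..1} (\<lambda>t. h t * bump ((t - z) / \<epsilon>)) - h z * (\<epsilon> * c)\<bar> \<le> \<delta> * (\<epsilon> * c)))"
    have "\<exists>e. P z e" if "z \<in> {-1<..<1}" for z
      using integral_bump_approx[OF h that \<delta> B(1) B(3) B(5)] by (simp add: P_def)
    then obtain e0 where e0': "\<And>z. z \<in> {-1<..<1} \<Longrightarrow> P z (e0 z)" by metis
    have e0: "0 < e0 a" "0 < e0 b" "0 < e0 p"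
      using e0'[of a] e0'[of b] e0'[of p] abc by (auto simp: P_def)
    define \<epsilon> where "\<epsilon> = Min {e0 a, e0 b, e0 p, 1 + a, 1 - b} / 2"
    have "0 < Min {e0 a, e0 b, e0 p, 1 + a, 1 - b}"
      using e0 abc by (subst Min_gr_iff) auto
    then have e: "0 < \<epsilon>" "\<epsilon> < Min {e0 a, e0 b, e0 p, 1 + a, 1 - b}"
      by (auto simp: \<epsilon>_def)
    then have e': "\<epsilon> < e0 a" "\<epsilon> < e0 b" "\<epsilon> < e0 p" "\<epsilon> < 1 + a" "\<epsilon> < 1 - b"
      by (auto simp: Min_gr_iff)
    define \<phi>2 where "\<phi>2 = (\<lambda>t. (b - p) * bump ((t - a) / \<epsilon>) - (b - a) * bump ((t - p) / \<epsilon>) + (p - a) * bump ((t - b) / \<epsilon>))"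
    define \<phi>1 where "\<phi>1 = (\<lambda>t. \<epsilon> * ((b - p) * B1 ((t - a) / \<epsilon>) - (b - a) * B1 ((t - p) / \<epsilon>) + (p - a) * B1 ((t - b) / \<epsilon>)))"
    define \<phi> where "\<phi> = (\<lambda>t. \<epsilon>\<^sup>2 * ((b - p) * B2 ((t - a) / \<epsilon>) - (b - a) * B2 ((t - p) / \<epsilon>) + (p - a) * B2 ((t - b) / \<epsilon>)))"
    have aff: "((\<lambda>t. (t - z) / \<epsilon>) has_real_derivative 1 / \<epsilon>) (at t)" for z t
      using e by (auto intro!: derivative_eq_intros)
    have d1: "(\<phi>1 has_real_derivative \<phi>2 t) (at t)" for t
      unfolding \<phi>1_def \<phi>2_def using e
      by (auto intro!: derivative_eq_intros DERIV_chain2[OF B(1) aff] simp: field_simps)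
    have d0: "(\<phi> has_real_derivative \<phi>1 t) (at t)" for t
      unfolding \<phi>1_def \<phi>_def using e
      by (auto intro!: derivative_eq_intros DERIV_chain2[OF B(2) aff] simp: field_simps power2_eq_square)
    have ckb: "Ck UNIV n (\<lambda>t. bump ((t - z) / \<epsilon>))" for n z
      using Ck_affine[OF Ck_bump[of UNIV], of UNIV "1 / \<epsilon>" "- z / \<epsilon>" n] by (simp add: diff_divide_distrib)
    have "Ck UNIV n (\<lambda>t. (b - p) * bump ((t - a) / \<epsilon>) + (- (b - a)) * bump ((t - p) / \<epsilon>) + (p - a) * bump ((t - b) / \<epsilon>))" for n
      by (intro Ck_add Ck_mult Ck_const ckb)
    then have ck2: "Ck UNIV n \<phi>2" for n by (simp add: \<phi>2_def algebra_simps)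
    have ck: "Ck UNIV n \<phi>" for n
    proof -
      have "Ck UNIV (Suc (Suc n)) \<phi>"
        by (rule Ck_SucI[where f'=\<phi>1, OF _ Ck_SucI[OF _ ck2]])
          (simp_all add: d0 d1 flip: has_real_derivative_iff_has_vector_derivative)
      then show ?thesis by (rule Ck_le) simp
    qed
    have "test_function \<phi>"
    proof (rule test_functionI[OF ck, of "a - \<epsilon>" "b + \<epsilon>"])
      fix s assume "s \<notin> {a - \<epsilon>..b + \<epsilon>}"
      then consider "s < a - \<epsilon>" | "s > b + \<epsilon>" by fastforce
      then show "\<phi> s = 0"
      proof cases
        case 1
        then have "(s - a) / \<epsilon> \<le> -1" "(s - p) / \<epsilon> \<le> -1" "(s - b) / \<epsilon> \<le> -1"
          using e abc by (auto simp: field_simps)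
        then show ?thesis by (simp add: \<phi>_def B(4))
      next
        case 2
        then have *: "1 \<le> (s - a) / \<epsilon>" "1 \<le> (s - p) / \<epsilon>" "1 \<le> (s - b) / \<epsilon>"
          using e abc by (auto simp: field_simps)
        \<comment> \<open>To the right of all three supports every term is affine, and the weights
          annihilate affine functions of the centre.\<close>
        have "(b - p) * B2 ((s - a) / \<epsilon>) - (b - a) * B2 ((s - p) / \<epsilon>) + (p - a) * B2 ((s - b) / \<epsilon>) = 0"
          unfolding B(6)[OF *(1)] B(6)[OF *(2)] B(6)[OF *(3)] using e
          by (simp add: field_simps)
        then show ?thesis by (simp add: \<phi>_def)
      qed
    qed (use e' in auto)
    moreover have "(ds ^^ 2) \<phi> = \<phi>2"
    proof -
      have "ds \<phi> = \<phi>1" "ds \<phi>1 = \<phi>2"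
        using d0 d1 by (auto simp: ds_def has_real_derivative_iff_has_vector_derivative intro: vector_derivative_at)
      then show ?thesis by (simp add: numeral_2_eq_2)
    qed
    ultimately have "integral {-1..1} (\<lambda>s. h s * \<phi>2 s) = 0" using orth by fastforce
    let ?I = "\<lambda>z. integral {-1..1} (\<lambda>t. h t * bump ((t - z) / \<epsilon>))"
    have hi: "((\<lambda>t. h t * bump ((t - z) / \<epsilon>)) has_integral ?I z) {-1..1}" for z
      using continuous_on_subset[OF Ck_continuous[OF ckb]]
      by (intro integrable_integral integrable_continuous_interval continuous_intros h) auto
    have "((\<lambda>t. (b - p) * (h t * bump ((t - a) / \<epsilon>)) - (b - a) * (h t * bump ((t - p) / \<epsilon>)) + (p - a) * (h t * bump ((t - b) / \<epsilon>)))
       has_integral ((b - p) * ?I a - (b - a) * ?I p + (p - a) * ?I b)) {-1..1}"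
      by (intro has_integral_add has_integral_diff has_integral_mult_right hi)
    then have "((\<lambda>s. h s * \<phi>2 s) has_integral ((b - p) * ?I a - (b - a) * ?I p + (p - a) * ?I b)) {-1..1}"
      by (simp add: \<phi>2_def algebra_simps)
    then have z: "(b - p) * ?I a - (b - a) * ?I p + (p - a) * ?I b = 0"
      using \<open>integral {-1..1} (\<lambda>s. h s * \<phi>2 s) = 0\<close> by (simp add: integral_unique)
    define u where "u = \<epsilon> * c"
    have u: "u > 0" using e B(7) by (simp add: u_def)
    define x y w where "x = ?I a - h a * u" and "y = ?I p - h p * u" and "w = ?I b - h b * u"
    have xyw: "\<bar>x\<bar> \<le> \<delta> * u" "\<bar>y\<bar> \<le> \<delta> * u" "\<bar>w\<bar> \<le> \<delta> * u"
      using e0'[of a] e0'[of b] e0'[of p] e(1) e' abc by (auto simp: P_def x_def y_def w_def u_def)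
    have "?L * u = - ((b - p) * x - (b - a) * y + (p - a) * w)"
      using z by (simp add: x_def y_def w_def algebra_simps)
    then have "\<bar>?L\<bar> * u = \<bar>(b - p) * x - (b - a) * y + (p - a) * w\<bar>"
      using u by (metis abs_minus_cancel abs_mult abs_of_pos)
    also have "\<dots> \<le> (b - p) * \<bar>x\<bar> + (b - a) * \<bar>y\<bar> + (p - a) * \<bar>w\<bar>"
    proof -
      have "\<bar>(b - p) * x\<bar> = (b - p) * \<bar>x\<bar>" "\<bar>(b - a) * y\<bar> = (b - a) * \<bar>y\<bar>" "\<bar>(p - a) * w\<bar> = (p - a) * \<bar>w\<bar>"
        using abc by (auto simp: abs_mult)
      then show ?thesis by linarith
    qed
    also have "\<dots> \<le> (b - p) * (\<delta> * u) + (b - a) * (\<delta> * u) + (p - a) * (\<delta> * u)"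
      using abc xyw by (intro add_mono mult_left_mono) auto
    also have "\<dots> = \<delta> * (2 * (b - a)) * u" by (simp add: algebra_simps)
    finally show ?thesis using u by simp
  qed
  have "?L = 0"
  proof (rule ccontr)
    assume "?L \<noteq> 0"
    then have "\<bar>?L\<bar> / (4 * (b - a)) > 0" using abc by simp
    from bound[OF this] \<open>?L \<noteq> 0\<close> abc show False by (simp add: field_simps)
  qed
  then show ?thesis by simp
qed

lemma second_order_du_Bois_Reymond:
  fixes h :: "real \<Rightarrow> real"
  assumes h: "continuous_on {-1..1} h"
    and orth: "\<And>\<phi>. test_function \<phi> \<Longrightarrow> integral {-1..1} (\<lambda>s. h s * (ds ^^ 2) \<phi> s) = 0"
  obtains k m where "\<And>s. s \<in> {-1<..<1} \<Longrightarrow> h s = k * s + m"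
proof
  note three = second_order_du_Bois_Reymond_3[OF assms]
  fix s :: real assume s: "s \<in> {-1<..<1}"
  consider "s < 0" | "s = 0" | "0 < s" "s < 1/2" | "s = 1/2" | "1/2 < s" by linarith
  \<comment> \<open>The line through the values at 0 and 1/2; the cases differ in which of 0, 1/2
    and \<open>s\<close> is the middle point.\<close>
  then show "h s = 2 * (h (1/2) - h 0) * s + h 0"
  proof cases
    case 1 then show ?thesis using three[of s 0 "1/2"] s by (simp add: field_simps)
  next
    case 3 then show ?thesis using three[of 0 s "1/2"] s by (simp add: field_simps)
  next
    case 5 then show ?thesis using three[of 0 "1/2" s] s by (simp add: field_simps)
  next
    case 4 show ?thesis unfolding 4 by (simp add: field_simps)
  qed auto
qed

section \<open>Uniqueness of the distributional Green function\<close>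

context potential
begin

abbreviation Lq :: "(real \<Rightarrow> real) \<Rightarrow> real \<Rightarrow> real" where
  "Lq \<phi> s \<equiv> (ds ^^ 2) \<phi> s - q s * \<phi> s"

text \<open>A regularity argument: \<open>E\<close> satisfies E'' = q D classically, so
  \<open>D - E\<close> is orthogonal to all second derivatives of test functions and hence affine.
  Thus \<open>D\<close> is a classical solution with zero boundary values, and convexity of its
  square applies.\<close>

lemma distributional_solution_zero:
  assumes D: "continuous_on {-1..1} D" "D (-1) = 0" "D 1 = 0"
    and orth: "\<And>\<phi>. test_function \<phi> \<Longrightarrow> integral {-1..1} (\<lambda>s. D s * Lq \<phi> s) = 0"
    and s: "s \<in> {-1..1}"
  shows "D s = 0"
proof -
  define E1 where "E1 = prim (\<lambda>t. q t * D t)"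
  define E where "E = prim E1"
  have qD: "(\<lambda>t. q t * D t) integrable_on {-1..1}" by (intro q_mult_integrable D)
  have E1c: "continuous_on {-1..1} E1" unfolding E1_def by (intro continuous_on_prim qD)
  have E1i: "E1 integrable_on {-1..1}" by (intro integrable_continuous_interval E1c)
  have Ec: "continuous_on {-1..1} E" unfolding E_def by (intro continuous_on_prim E1i)
  have E1d: "(E1 has_real_derivative q s * D s) (at s)" if "s \<in> {-1<..<1}" for s
    unfolding E1_def using that
    by (intro prim_has_real_derivative qD continuous_intros q_cont continuous_on_subset[OF D(1)]) auto
  have Ed: "(E has_real_derivative E1 s) (at s)" if "s \<in> {-1<..<1}" for s
    unfolding E_def using that
    by (intro prim_has_real_derivative E1i continuous_on_subset[OF E1c]) auto
  have "integral {-1..1} (\<lambda>s. (D s - E s) * (ds ^^ 2) \<phi> s) = 0" if t: "test_function \<phi>" for \<phi>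
  proof -
    note td = test_function_deriv[OF t]
    have c2: "continuous_on {-1..1} ((ds ^^ 2) \<phi>)" using td(3) by (intro continuous_at_imp_continuous_on) auto
    have c1: "continuous_on {-1..1} (ds \<phi>)" and c0: "continuous_on {-1..1} \<phi>"
      using DERIV_isCont[OF td(2)] DERIV_isCont[OF td(1)] by (auto intro: continuous_at_imp_continuous_on)
    have "((\<lambda>s. E s * (ds ^^ 2) \<phi> s - q s * D s * \<phi> s) has_integral
       ((E 1 * ds \<phi> 1 - E1 1 * \<phi> 1) - (E (-1) * ds \<phi> (-1) - E1 (-1) * \<phi> (-1)))) {-1..1}"
    proof (rule fundamental_theorem_of_calculus_interior[where f="\<lambda>s. E s * ds \<phi> s - E1 s * \<phi> s"])
      show "continuous_on {-1..1} (\<lambda>s. E s * ds \<phi> s - E1 s * \<phi> s)"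
        by (intro continuous_intros Ec E1c c1 c0)
      show "((\<lambda>s. E s * ds \<phi> s - E1 s * \<phi> s) has_vector_derivative E s * (ds ^^ 2) \<phi> s - q s * D s * \<phi> s) (at s)"
        if "s \<in> {-1<..<1}" for s
        unfolding has_real_derivative_iff_has_vector_derivative[symmetric]
        using DERIV_diff[OF DERIV_mult[OF Ed[OF that] td(2)] DERIV_mult[OF E1d[OF that] td(1)]]
        by (simp add: algebra_simps)
    qed auto
    then have 1: "((\<lambda>s. E s * (ds ^^ 2) \<phi> s - q s * D s * \<phi> s) has_integral 0) {-1..1}" by (simp add: td)
    have "(\<lambda>s. D s * (ds ^^ 2) \<phi> s - q s * (D s * \<phi> s)) integrable_on {-1..1}"
      by (intro integrable_diff q_mult_integrable integrable_continuous_interval continuous_intros D c2 c0)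
    then have "(\<lambda>s. D s * Lq \<phi> s) integrable_on {-1..1}"
      by (simp add: algebra_simps)
    from integrable_integral[OF this] orth[OF t]
    have "((\<lambda>s. D s * Lq \<phi> s) has_integral 0) {-1..1}" by simp
    from has_integral_diff[OF this 1] show ?thesis
      by (intro integral_unique) (simp add: algebra_simps)
  qed
  moreover have "continuous_on {-1..1} (\<lambda>s. D s - E s)" by (intro continuous_intros D(1) Ec)
  ultimately obtain k m where km: "\<And>s. s \<in> {-1<..<1} \<Longrightarrow> D s - E s = k * s + m"
    using second_order_du_Bois_Reymond[of "\<lambda>s. D s - E s"] by blast
  show ?thesis
  proof (rule homogeneous_bvp_unique[where q=q and D=D and ?D1.0="\<lambda>s. E1 s + k", OF q_nonneg D _ _ s])
    fix x :: real assume x: "x \<in> {-1<..<1}"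
    have "((\<lambda>s. E s + (k * s + m)) has_real_derivative E1 x + k) (at x)"
      using x by (auto intro!: derivative_eq_intros Ed)
    then show "(D has_real_derivative E1 x + k) (at x)"
      by (rule has_field_derivative_transform_within_open[of _ _ _ "{-1<..<1}"])
        (use x km in \<open>auto simp: algebra_simps\<close>)
    show "((\<lambda>s. E1 s + k) has_real_derivative q x * D x) (at x)"
      using x by (auto intro!: derivative_eq_intros E1d)
  qed
qed

lemma test_rhs:
  assumes t: "test_function \<phi>"
  defines "f \<equiv> \<lambda>s. - Lq \<phi> s"
  shows "f absolutely_integrable_on {-1..1}" "continuous_on {-1<..<1} f"
proof -
  note td = test_function_deriv[OF t]
  have c2: "continuous_on A ((ds ^^ 2) \<phi>)" and c0: "continuous_on A \<phi>" for A
    using td(3) DERIV_isCont[OF td(1)] by (auto intro!: continuous_at_imp_continuous_on)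
  have "(\<lambda>s. q s * \<phi> s - (ds ^^ 2) \<phi> s) absolutely_integrable_on {-1..1}"
    by (intro set_integral_diff(1) q_mult_int c0 absolutely_integrable_continuous_real c2)
  then show "f absolutely_integrable_on {-1..1}"
    by (simp add: f_def)
  show "continuous_on {-1<..<1} f"
    unfolding f_def by (intro continuous_intros c2 c0 q_cont)
qed

text \<open>A test function vanishes at the ends, so it is itself the solution of the boundary value
  problem with right-hand side \<open>- Lq \<phi>\<close>. Its representation by
  \<open>green\<close> at the point \<open>x\<close> is the claim.\<close>

lemma green_distributional:
  assumes t: "test_function \<phi>" and x: "x \<in> {-1<..<1}"
  shows "integral {-1..1} (\<lambda>s. green s x * Lq \<phi> s) = - \<phi> x"
proof -
  note td = test_function_deriv[OF t]
  let ?f = "\<lambda>s. - Lq \<phi> s"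
  have "\<phi> x = bvp_sol ?f x"
    using x td DERIV_isCont[OF td(1)]
    by (intro bvp_sol_unique[OF test_rhs[OF t], where ?g1.0 = "ds \<phi>"])
      (auto intro!: continuous_at_imp_continuous_on)
  also have "\<dots> = integral {-1..1} (\<lambda>s. green x s * ?f s)"
    using x by (intro bvp_sol_eq_integral test_rhs t) auto
  also have "\<dots> = - integral {-1..1} (\<lambda>s. green s x * Lq \<phi> s)"
    by (simp add: green_sym[of x] algebra_simps flip: integral_neg)
  finally show ?thesis by simp
qed

lemma green_unique:
  assumes g: "continuous_on {-1..1} g" "g (-1) = 0" "g 1 = 0" and x: "x \<in> {-1<..<1}"
    and eq: "\<And>\<phi>. test_function \<phi> \<Longrightarrow> integral {-1..1} (\<lambda>s. g s * Lq \<phi> s) = - \<phi> x"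
    and s: "s \<in> {-1..1}"
  shows "g s = green s x"
proof -
  have x': "x \<in> {-1..1}" using x by auto
  have "g s - green s x = 0"
  proof (rule distributional_solution_zero[where D="\<lambda>s. g s - green s x", OF _ _ _ _ s])
    show "continuous_on {-1..1} (\<lambda>s. g s - green s x)"
      by (intro continuous_intros g green_cont1 x')
    fix \<phi> assume t: "test_function \<phi>"
    have i: "(\<lambda>s. k s * Lq \<phi> s) integrable_on {-1..1}" if "continuous_on {-1..1} k" for k
      using integrable_neg[OF mult_f_int[OF test_rhs[OF t] that]] by (simp add: algebra_simps)
    have "integral {-1..1} (\<lambda>s. (g s - green s x) * Lq \<phi> s)
      = integral {-1..1} (\<lambda>s. g s * Lq \<phi> s) - integral {-1..1} (\<lambda>s. green s x * Lq \<phi> s)"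
      by (subst integral_diff[symmetric, OF i[OF g(1)] i[OF green_cont1[OF x']]]) (simp add: algebra_simps)
    then show "integral {-1..1} (\<lambda>s. (g s - green s x) * Lq \<phi> s) = 0"
      using eq[OF t] green_distributional[OF t x] by simp
  qed (use g green_left[OF x'] green_right[OF x'] in auto)
  then show ?thesis by simp
qed

end

section \<open>Hardy inequality\<close>

lemma nn_integral_powr_half:
  assumes t: "0 \<le> t" "t < 1"
  shows "(\<integral>\<^sup>+s. ennreal ((1 - s) powr (-1/2)) * indicator {t..<1} s \<partial>lborel) = ennreal (2 * (1 - t) powr (1/2))"
proof -
  have "((\<lambda>s. (1 - s) powr (-1/2)) has_integral (- 2 * (1 - 1) powr (1/2) - (- 2 * (1 - t) powr (1/2)))) {t..1}"
  proof (rule fundamental_theorem_of_calculus_interior[where f="\<lambda>s. - 2 * (1 - s) powr (1/2)"])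
    show "continuous_on {t..1} (\<lambda>s. - 2 * (1 - s) powr (1/2))"
      by (intro continuous_intros continuous_on_powr') auto
    show "((\<lambda>s. - 2 * (1 - s) powr (1/2)) has_vector_derivative (1 - s) powr (-1/2)) (at s)" if "s \<in> {t<..<1}" for s
      unfolding has_real_derivative_iff_has_vector_derivative[symmetric]
      using that t by (auto intro!: derivative_eq_intros)
  qed (use t in auto)
  then have "((\<lambda>s. if s \<in> {t..1} then (1 - s) powr (-1/2) else 0) has_integral (2 * (1 - t) powr (1/2))) UNIV"
    by (subst has_integral_restrict_UNIV) simp
  then have "(\<integral>\<^sup>+s. ennreal (if s \<in> {t..1} then (1 - s) powr (-1/2) else 0) \<partial>lborel) = ennreal (2 * (1 - t) powr (1/2))"
    by (intro nn_integral_has_integral_lborel) auto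
  moreover have "ennreal (if s \<in> {t..1} then (1 - s) powr (-1/2) else 0) = ennreal ((1 - s) powr (-1/2)) * indicator {t..<1} s" for s
    by (auto simp: indicator_def)
  ultimately show ?thesis by simp
qed

lemma nn_integral_powr_three_halves:
  assumes s: "0 \<le> s" "s < 1"
  shows "(\<integral>\<^sup>+t. ennreal ((1 - t) powr (-3/2)) * indicator {0..s} t \<partial>lborel) \<le> ennreal (2 * (1 - s) powr (-1/2))"
proof -
  have "(\<integral>\<^sup>+t. ennreal ((1 - t) powr (-3/2)) * indicator {0..s} t \<partial>lborel)
    = ennreal (2 * (1 - s) powr (-1/2) - 2 * (1 - 0) powr (-1/2))"
    using s by (intro nn_integral_FTC_Icc) (auto intro!: derivative_eq_intros)
  also have "\<dots> \<le> ennreal (2 * (1 - s) powr (-1/2))"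
    by (rule ennreal_leI) simp
  finally show ?thesis .
qed

text \<open>Cauchy-Schwarz with \<open>k\<close> split by (1-t)^a for a = 3/4. Any a strictly
  between 1/2 and 1 leaves a singularity in \<open>s\<close> that is integrable up to 1; the
  constant of the resulting Hardy inequality is 1/((2a-1)(2-2a)), smallest at 3/4, where it is
  4.\<close>

lemma cauchy_schwarz_weighted:
  assumes [measurable]: "k \<in> borel_measurable borel" and k: "\<And>t. 0 \<le> k t" and s: "0 \<le> s" "s < 1"
  shows "(\<integral>\<^sup>+t. ennreal (k t) * indicator {0..s} t \<partial>lborel)\<^sup>2
    \<le> ennreal (2 * (1 - s) powr (-1/2)) * (\<integral>\<^sup>+t. ennreal ((1 - t) powr (3/2) * (k t)\<^sup>2) * indicator {0..s} t \<partial>lborel)"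
proof -
  let ?A = "\<lambda>t. ennreal ((1 - t) powr (-3/4)) * indicator {0..s} t"
  let ?B = "\<lambda>t. ennreal ((1 - t) powr (3/4) * k t) * indicator {0..s} t"
  have "?A t * ?B t = ennreal (k t) * indicator {0..s} t" for t
    using s k by (auto simp: indicator_def powr_minus ennreal_mult'[symmetric] field_simps)
  then have "(\<integral>\<^sup>+t. ennreal (k t) * indicator {0..s} t \<partial>lborel)\<^sup>2 = (\<integral>\<^sup>+t. ?A t * ?B t \<partial>lborel)\<^sup>2"
    by simp
  also have "\<dots> \<le> (\<integral>\<^sup>+t. (?A t)\<^sup>2 \<partial>lborel) * (\<integral>\<^sup>+t. (?B t)\<^sup>2 \<partial>lborel)"
    by (rule Cauchy_Schwarz_nn_integral) measurable
  also have "(\<lambda>t. (?A t)\<^sup>2) = (\<lambda>t. ennreal ((1 - t) powr (-3/2)) * indicator {0..s} t)"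
    using s by (auto simp: indicator_def ennreal_power powr_power fun_eq_iff)
  also have "(\<lambda>t. (?B t)\<^sup>2) = (\<lambda>t. ennreal ((1 - t) powr (3/2) * (k t)\<^sup>2) * indicator {0..s} t)"
    using s k by (auto simp: indicator_def ennreal_power power_mult_distrib powr_power fun_eq_iff)
  also have "(\<integral>\<^sup>+t. ennreal ((1 - t) powr (-3/2)) * indicator {0..s} t \<partial>lborel) *
      (\<integral>\<^sup>+t. ennreal ((1 - t) powr (3/2) * (k t)\<^sup>2) * indicator {0..s} t \<partial>lborel) \<le>
      ennreal (2 * (1 - s) powr (-1/2)) * (\<integral>\<^sup>+t. ennreal ((1 - t) powr (3/2) * (k t)\<^sup>2) * indicator {0..s} t \<partial>lborel)"
    by (intro mult_right_mono nn_integral_powr_three_halves s) simp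
  finally show ?thesis .
qed

text \<open>After the weighted Cauchy-Schwarz inequality the integrals are exchanged. For fixed
  \<open>t\<close> the variable \<open>s\<close> runs through {t..<1}, where (1-s)^j is at most
  (1-t)^j; the integral of (1-s)^(-1/2) then gives 2 (1-t)^(1/2), which completes the exponent 3/2
  to 2.\<close>

lemma hardy_scalar:
  assumes [measurable]: "k \<in> borel_measurable borel" and k: "\<And>t. 0 \<le> k t"
  shows "(\<integral>\<^sup>+s. ennreal ((1 - s) ^ j) * (\<integral>\<^sup>+t. ennreal (k t) * indicator {0..s} t \<partial>lborel)\<^sup>2 * indicator {0..<1} s \<partial>lborel)
    \<le> 4 * (\<integral>\<^sup>+t. ennreal ((1 - t) ^ (j + 2) * (k t)\<^sup>2) * indicator {0..<1} t \<partial>lborel)"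
proof -
  let ?w = "\<lambda>t. ennreal ((1 - t) ^ j * (1 - t) powr (3/2) * (k t)\<^sup>2)"
  let ?h = "\<lambda>s t. 2 * (ennreal ((1 - s) powr (-1/2)) * indicator {t..<1} s) * (?w t * indicator {0..<1} t)"
  have "(\<integral>\<^sup>+s. ennreal ((1 - s) ^ j) * (\<integral>\<^sup>+t. ennreal (k t) * indicator {0..s} t \<partial>lborel)\<^sup>2 * indicator {0..<1} s \<partial>lborel)
    \<le> (\<integral>\<^sup>+s. (\<integral>\<^sup>+t. ?h s t \<partial>lborel) \<partial>lborel)"
  proof (rule nn_integral_mono)
    fix s :: real
    show "ennreal ((1 - s) ^ j) * (\<integral>\<^sup>+t. ennreal (k t) * indicator {0..s} t \<partial>lborel)\<^sup>2 * indicator {0..<1} s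
      \<le> (\<integral>\<^sup>+t. ?h s t \<partial>lborel)"
    proof (cases "s \<in> {0..<1}")
      case True
      have "ennreal ((1 - s) ^ j) * (\<integral>\<^sup>+t. ennreal (k t) * indicator {0..s} t \<partial>lborel)\<^sup>2
        \<le> ennreal ((1 - s) ^ j) * (ennreal (2 * (1 - s) powr (-1/2)) *
            (\<integral>\<^sup>+t. ennreal ((1 - t) powr (3/2) * (k t)\<^sup>2) * indicator {0..s} t \<partial>lborel))"
        using True by (intro mult_left_mono cauchy_schwarz_weighted k) auto
      also have "\<dots> = (\<integral>\<^sup>+t. ennreal ((1 - s) ^ j) * (ennreal (2 * (1 - s) powr (-1/2)) *
            (ennreal ((1 - t) powr (3/2) * (k t)\<^sup>2) * indicator {0..s} t)) \<partial>lborel)"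
        by (simp add: nn_integral_cmult)
      also have "\<dots> \<le> (\<integral>\<^sup>+t. ?h s t \<partial>lborel)"
      proof (rule nn_integral_mono)
        fix t :: real
        show "ennreal ((1 - s) ^ j) * (ennreal (2 * (1 - s) powr (-1/2)) *
            (ennreal ((1 - t) powr (3/2) * (k t)\<^sup>2) * indicator {0..s} t)) \<le> ?h s t"
        proof (cases "t \<in> {0..s}")
          case t: True
          have "(1 - s) ^ j * (2 * (1 - s) powr (-1/2) * ((1 - t) powr (3/2) * (k t)\<^sup>2))
            \<le> (1 - t) ^ j * (2 * (1 - s) powr (-1/2) * ((1 - t) powr (3/2) * (k t)\<^sup>2))"
            using t True by (intro mult_right_mono power_mono mult_nonneg_nonneg) auto
          moreover have "ennreal ((1 - s) ^ j) * (ennreal (2 * (1 - s) powr (-1/2)) *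
            (ennreal ((1 - t) powr (3/2) * (k t)\<^sup>2) * indicator {0..s} t))
            = ennreal ((1 - s) ^ j * (2 * (1 - s) powr (-1/2) * ((1 - t) powr (3/2) * (k t)\<^sup>2)))"
            using t True by (simp add: ennreal_mult)
          moreover have "?h s t = ennreal ((1 - t) ^ j * (2 * (1 - s) powr (-1/2) * ((1 - t) powr (3/2) * (k t)\<^sup>2)))"
            using t True by (simp add: ennreal_mult mult_ac)
          ultimately show ?thesis by (simp only: ennreal_leI)
        qed auto
      qed
      finally show ?thesis using True by simp
    qed auto
  qed
  also have "\<dots> = (\<integral>\<^sup>+t. (\<integral>\<^sup>+s. ?h s t \<partial>lborel) \<partial>lborel)"
    unfolding indicator_def atLeastLessThan_iff by (rule lborel_pair.Fubini') measurable
  also have "\<dots> \<le> (\<integral>\<^sup>+t. 4 * (ennreal ((1 - t) ^ (j + 2) * (k t)\<^sup>2) * indicator {0..<1} t) \<partial>lborel)"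
  proof (rule nn_integral_mono)
    fix t :: real
    show "(\<integral>\<^sup>+s. ?h s t \<partial>lborel) \<le> 4 * (ennreal ((1 - t) ^ (j + 2) * (k t)\<^sup>2) * indicator {0..<1} t)"
    proof (cases "t \<in> {0..<1}")
      case True
      have "(\<integral>\<^sup>+s. ?h s t \<partial>lborel) = 2 * ennreal (2 * (1 - t) powr (1/2)) * ?w t"
        using True by (simp add: nn_integral_multc nn_integral_cmult nn_integral_powr_half[simplified])
      also have "\<dots> = ennreal (4 * ((1 - t) ^ j * ((1 - t) powr (1/2) * (1 - t) powr (3/2)) * (k t)\<^sup>2))"
      proof -
        have "2 * ennreal (2 * a) * ennreal w = ennreal (4 * (a * w))" if "0 \<le> a" "0 \<le> w" for a w
          using that by (simp add: ennreal_mult mult.assoc)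
        from this[of "(1 - t) powr (1/2)" "(1 - t) ^ j * (1 - t) powr (3/2) * (k t)\<^sup>2"]
        show ?thesis using True by (simp add: mult_ac)
      qed
      also have "(1 - t) powr (1/2) * (1 - t) powr (3/2) = (1 - t)\<^sup>2"
        using True by (simp add: powr_add[symmetric] flip: powr_numeral)
      also have "ennreal (4 * ((1 - t) ^ j * (1 - t)\<^sup>2 * (k t)\<^sup>2)) = 4 * ennreal ((1 - t) ^ (j + 2) * (k t)\<^sup>2)"
        unfolding power_add by (subst ennreal_mult'[of 4]) simp_all
      finally show ?thesis using True by simp
    qed auto
  qed
  also have "\<dots> = 4 * (\<integral>\<^sup>+t. ennreal ((1 - t) ^ (j + 2) * (k t)\<^sup>2) * indicator {0..<1} t \<partial>lborel)"
    by (rule nn_integral_cmult) measurable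
  finally show ?thesis .
qed

section \<open>Locally absolutely continuous functions\<close>

lemma locally_ACD:
  assumes "locally_AC f" "-1 < a" "a \<le> b" "b < 1"
  shows "set_integrable lborel {a..b} (ds f)" "(LINT s:{a..b}|lborel. ds f s) = f b - f a"
  using assms by (auto simp: locally_AC_def)

lemma locally_AC_indefinite:
  assumes "locally_AC f" "-1 < a" "a \<le> b" "b < 1"
  shows "ds f integrable_on {a..b}" "integral {a..b} (ds f) = f b - f a"
  using set_borel_integral_eq_integral[OF locally_ACD(1)[OF assms]] locally_ACD(2)[OF assms] by auto

lemma locally_AC_continuous:
  assumes "locally_AC f" shows "continuous_on {-1<..<1} f"
proof (rule continuous_at_imp_continuous_on, rule ballI)
  fix x :: real assume x: "x \<in> {-1<..<1}"
  define a b where "a = (x - 1) / 2" and "b = (x + 1) / 2"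
  have ab: "-1 < a" "a < x" "x < b" "b < 1" using x by (auto simp: a_def b_def)
  have "continuous_on {a..b} (\<lambda>x. f a + integral {a..x} (ds f))"
    using ab by (intro continuous_intros indefinite_integral_continuous_1 locally_AC_indefinite assms) auto
  then have "continuous_on {a..b} f"
    by (rule continuous_on_eq) (use ab locally_AC_indefinite(2)[OF assms, of a] in auto)
  then have "continuous_on {a<..<b} f" by (rule continuous_on_subset) auto
  then show "isCont f x"
    using ab by (simp add: continuous_on_eq_continuous_at)
qed

text \<open>\<open>locally_AC\<close> speaks only about integrals of \<open>ds f\<close>, whose
  value is arbitrary at a point of nondifferentiability. Continuity of \<open>ds f\<close> excludes
  such points by the fundamental theorem.\<close>

lemma locally_AC_has_derivative:
  assumes "locally_AC f" "continuous_on {-1<..<1} (ds f)" "x \<in> {-1<..<1}"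
  shows "(f has_vector_derivative ds f x) (at x)"
proof -
  define a b where "a = (x - 1) / 2" and "b = (x + 1) / 2"
  have ab: "-1 < a" "a < x" "x < b" "b < 1" using assms(3) by (auto simp: a_def b_def)
  have "((\<lambda>u. integral {a..u} (ds f)) has_vector_derivative ds f x) (at x within {a..b})"
    using ab by (intro integral_has_vector_derivative continuous_on_subset[OF assms(2)]) auto
  moreover have "at x within {a..b} = at x" using ab by (intro at_within_interior) auto
  ultimately have "((\<lambda>u. f a + integral {a..u} (ds f)) has_vector_derivative ds f x) (at x)"
    by (auto intro!: derivative_eq_intros)
  then show ?thesis
    by (rule has_vector_derivative_transform_within_open[of _ _ _ "{a<..<b}"])
      (use ab locally_AC_indefinite(2)[OF assms(1), of a] in auto)
qed

text \<open>The highest function in the hypothesis is only known to be continuous; each lower one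
  then has a continuous derivative. This loss of one order explains the strict inequality.\<close>

lemma locally_AC_Ck:
  assumes "\<And>k. k < m \<Longrightarrow> locally_AC ((ds ^^ k) \<eta>)"
  shows "n + k < m \<Longrightarrow> Ck {-1<..<1} n ((ds ^^ k) \<eta>)"
proof (induction n arbitrary: k)
  case 0
  then show ?case using assms locally_AC_continuous by auto
next
  case (Suc n)
  have 1: "Ck {-1<..<1} n ((ds ^^ Suc k) \<eta>)" using Suc.prems by (intro Suc.IH) simp
  have "((ds ^^ k) \<eta> has_vector_derivative (ds ^^ Suc k) \<eta> x) (at x)" if "x \<in> {-1<..<1}" for x
    using locally_AC_has_derivative[OF assms _ that, of k] Ck_continuous[OF 1] Suc.prems by simp
  then show ?case using 1 by (rule Ck_SucI)
qed

text \<open>\<open>ds g\<close> is known to be integrable, hence measurable, only on compact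
  subintervals; an exhaustion passes to the open interval.\<close>

lemma locally_AC_ds_measurable:
  assumes "locally_AC g"
  shows "(\<lambda>t. indicator {-1<..<1} t *\<^sub>R ds g t) \<in> borel_measurable borel"
proof (rule borel_measurable_LIMSEQ_metric)
  let ?I = "\<lambda>n. {- 1 + inverse (real (Suc (Suc n)))..1 - inverse (real (Suc (Suc n)))}"
  show "(\<lambda>t. indicator (?I n) t *\<^sub>R ds g t) \<in> borel_measurable borel" for n
  proof -
    have "inverse (real (Suc (Suc n))) \<le> 1 / 2" by (simp add: field_simps)
    then have "set_integrable lborel (?I n) (ds g)"
      by (intro locally_ACD(1)[OF assms]) auto
    then show ?thesis by (auto simp: set_integrable_def)
  qed
  show "(\<lambda>n. indicator (?I n) t *\<^sub>R ds g t) \<longlonglongrightarrow> indicator {-1<..<1} t *\<^sub>R ds g t" for t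
  proof (cases "t \<in> {-1<..<1}")
    case True
    have "eventually (\<lambda>n. inverse (real (Suc n)) < min (1 + t) (1 - t)) sequentially"
      using True order_tendstoD(2)[OF LIMSEQ_inverse_real_of_nat, of "min (1 + t) (1 - t)"] by auto
    then have "eventually (\<lambda>n. inverse (real (Suc (Suc n))) < min (1 + t) (1 - t)) sequentially"
      by (subst eventually_sequentially_Suc)
    then have "eventually (\<lambda>n. indicator (?I n) t *\<^sub>R ds g t = indicator {-1<..<1} t *\<^sub>R ds g t) sequentially"
      by eventually_elim (use True in \<open>auto simp: indicator_def\<close>)
    then show ?thesis by (rule tendsto_eventually)
  next
    case False
    have "t \<notin> ?I n" for n
    proof -
      define d where "d = inverse (real (Suc (Suc n)))"
      have "0 < d" unfolding d_def by simp
      then have "t \<notin> {- 1 + d..1 - d}" using False by auto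
      then show ?thesis by (simp only: d_def not_False_eq_True)
    qed
    with False show ?thesis by simp
  qed
qed

text \<open>Bounding through \<open>max a b\<close> avoids subtraction of extended reals. Only
  finiteness is drawn from this estimate, so the factor 4 in place of 2 is harmless.\<close>

lemma ennreal_add_square_le: "((a::ennreal) + b)\<^sup>2 \<le> 4 * (a\<^sup>2 + b\<^sup>2)"
proof -
  have "a + b \<le> 2 * max a b" by (simp add: add_mono mult_2)
  then have "(a + b)\<^sup>2 \<le> (2 * max a b)\<^sup>2" by (rule power_mono) simp
  also have "\<dots> = 4 * (max a b)\<^sup>2" by (simp add: power_mult_distrib)
  also have "(max a b)\<^sup>2 \<le> a\<^sup>2 + b\<^sup>2" by (auto simp: max_def)
  finally show ?thesis by (simp add: mult_left_mono)
qed

text \<open>In the applications \<open>h\<close> and \<open>k\<close> are the norms of a function and of its derivative.\<close>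

lemma hardy_half:
  fixes h :: "real \<Rightarrow> real"
  assumes [measurable]: "k \<in> borel_measurable borel" and k: "\<And>t. 0 \<le> k t" and h: "\<And>s. 0 \<le> h s" "0 \<le> h0"
    and le: "\<And>s. s \<in> {0..<1} \<Longrightarrow> ennreal (h s) \<le> ennreal h0 + (\<integral>\<^sup>+t. ennreal (k t) * indicator {0..s} t \<partial>lborel)"
    and fin: "(\<integral>\<^sup>+t. ennreal ((1 - t\<^sup>2) ^ (j + 2) * (k t)\<^sup>2) * indicator {0..<1} t \<partial>lborel) < \<infinity>"
  shows "(\<integral>\<^sup>+s. ennreal ((1 - s\<^sup>2) ^ j * (h s)\<^sup>2) * indicator {0..<1} s \<partial>lborel) < \<infinity>"
proof -
  let ?J = "\<lambda>s. (\<integral>\<^sup>+t. ennreal (k t) * indicator {0..s} t \<partial>lborel)"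
  \<comment> \<open>On [0,1) the weights 1 - s and 1 - s^2 are comparable, because 1 + s lies
    between 1 and 2; this transfers the one-sided inequality to the weight of the norms.\<close>
  have w: "0 \<le> 1 - s" "1 - s \<le> 1 - s\<^sup>2" "1 - s\<^sup>2 \<le> 2 * (1 - s)" "1 - s \<le> 1" if "s \<in> {0..<1}" for s :: real
  proof -
    have "1 - s\<^sup>2 = (1 - s) * (1 + s)" by (simp add: power2_eq_square algebra_simps)
    moreover have "(1 - s) * 1 \<le> (1 - s) * (1 + s)" "(1 - s) * (1 + s) \<le> (1 - s) * 2"
      using that by (intro mult_left_mono; simp)+
    ultimately show "0 \<le> 1 - s" "1 - s \<le> 1 - s\<^sup>2" "1 - s\<^sup>2 \<le> 2 * (1 - s)" "1 - s \<le> 1" using that by auto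
  qed
  have J: "(\<integral>\<^sup>+s. ennreal ((1 - s) ^ j) * (?J s)\<^sup>2 * indicator {0..<1} s \<partial>lborel) < \<infinity>"
  proof -
    have "(\<integral>\<^sup>+t. ennreal ((1 - t) ^ (j + 2) * (k t)\<^sup>2) * indicator {0..<1} t \<partial>lborel)
      \<le> (\<integral>\<^sup>+t. ennreal ((1 - t\<^sup>2) ^ (j + 2) * (k t)\<^sup>2) * indicator {0..<1} t \<partial>lborel)"
    proof (rule nn_integral_mono)
      fix t :: real
      show "ennreal ((1 - t) ^ (j + 2) * (k t)\<^sup>2) * indicator {0..<1} t
        \<le> ennreal ((1 - t\<^sup>2) ^ (j + 2) * (k t)\<^sup>2) * indicator {0..<1} t"
      proof (cases "t \<in> {0..<1}")
        case True
        then have "ennreal ((1 - t) ^ (j + 2) * (k t)\<^sup>2) \<le> ennreal ((1 - t\<^sup>2) ^ (j + 2) * (k t)\<^sup>2)"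
          by (intro ennreal_leI mult_right_mono power_mono w) auto
        then show ?thesis by (rule mult_right_mono) simp
      qed auto
    qed
    then have "4 * (\<integral>\<^sup>+t. ennreal ((1 - t) ^ (j + 2) * (k t)\<^sup>2) * indicator {0..<1} t \<partial>lborel) < \<infinity>"
      using fin by (auto simp: ennreal_mult_less_top)
    then show ?thesis
      using hardy_scalar[of k j] k by (auto intro: le_less_trans)
  qed
  have "(\<integral>\<^sup>+s. ennreal ((1 - s\<^sup>2) ^ j * (h s)\<^sup>2) * indicator {0..<1} s \<partial>lborel)
    \<le> (\<integral>\<^sup>+s. ennreal (2 ^ j) * 4 * (ennreal (h0\<^sup>2) * indicator {0..<1} s + ennreal ((1 - s) ^ j) * (?J s)\<^sup>2 * indicator {0..<1} s) \<partial>lborel)"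
  proof (rule nn_integral_mono)
    fix s :: real
    show "ennreal ((1 - s\<^sup>2) ^ j * (h s)\<^sup>2) * indicator {0..<1} s \<le>
      ennreal (2 ^ j) * 4 * (ennreal (h0\<^sup>2) * indicator {0..<1} s + ennreal ((1 - s) ^ j) * (?J s)\<^sup>2 * indicator {0..<1} s)"
    proof (cases "s \<in> {0..<1}")
      case True
      have "ennreal ((1 - s\<^sup>2) ^ j * (h s)\<^sup>2) \<le> ennreal ((2 * (1 - s)) ^ j * (h s)\<^sup>2)"
        using w[OF True] by (intro ennreal_leI mult_right_mono power_mono) auto
      also have "\<dots> = ennreal (2 ^ j) * (ennreal ((1 - s) ^ j) * (ennreal (h s))\<^sup>2)"
        using w[OF True] h by (subst power_mult_distrib) (simp add: ennreal_mult ennreal_power mult.assoc)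
      also have "\<dots> \<le> ennreal (2 ^ j) * (ennreal ((1 - s) ^ j) * (ennreal h0 + ?J s)\<^sup>2)"
        by (intro mult_left_mono power_mono le True) auto
      also have "\<dots> \<le> ennreal (2 ^ j) * (ennreal ((1 - s) ^ j) * (4 * ((ennreal h0)\<^sup>2 + (?J s)\<^sup>2)))"
        by (intro mult_left_mono ennreal_add_square_le) auto
      also have "\<dots> = ennreal (2 ^ j) * 4 * (ennreal ((1 - s) ^ j) * ennreal (h0\<^sup>2) + ennreal ((1 - s) ^ j) * (?J s)\<^sup>2)"
        using h by (simp add: ennreal_power algebra_simps)
      also have "\<dots> \<le> ennreal (2 ^ j) * 4 * (1 * ennreal (h0\<^sup>2) + ennreal ((1 - s) ^ j) * (?J s)\<^sup>2)"
        using w[OF True] by (intro mult_left_mono add_right_mono mult_right_mono) (auto intro: power_le_one)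
      finally show ?thesis using True by simp
    qed auto
  qed
  also have "\<dots> = ennreal (2 ^ j) * 4 * ((\<integral>\<^sup>+s. ennreal (h0\<^sup>2) * indicator {0..<1::real} s \<partial>lborel) +
     (\<integral>\<^sup>+s. ennreal ((1 - s) ^ j) * (?J s)\<^sup>2 * indicator {0..<1} s \<partial>lborel))"
  proof -
    have "(\<lambda>s. \<integral>\<^sup>+t. ennreal (k t) * (if 0 \<le> t \<and> t \<le> s then 1 else 0) \<partial>lborel) \<in> borel_measurable borel"
      by measurable
    then have [measurable]: "?J \<in> borel_measurable lborel"
      by (simp add: indicator_def)
    show ?thesis
      by (subst nn_integral_cmult, measurable, subst nn_integral_add, measurable)
  qed
  also have "\<dots> < \<infinity>"
    using J by (auto simp: ennreal_mult_less_top nn_integral_cmult_indicator)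
  finally show ?thesis .
qed

text \<open>On each side of 0 the norm of \<open>g\<close> is at most its value at 0 plus the
  integral of the norm of \<open>ds g\<close>, so the half-interval estimate applies to
  \<open>g\<close> and to its reflection. Because of the value at 0 the conclusion is finiteness
  rather than a bound by the hypothesis.\<close>

lemma hardy:
  fixes g :: "real \<Rightarrow> 'a::euclidean_space"
  assumes ac: "locally_AC g"
    and fin: "(\<integral>\<^sup>+s\<in>{-1..1}. ennreal ((1 - s\<^sup>2) ^ (j + 2) * (norm (ds g s))\<^sup>2) \<partial>lborel) < \<infinity>"
  shows "(\<integral>\<^sup>+s\<in>{-1..1}. ennreal ((1 - s\<^sup>2) ^ j * (norm (g s))\<^sup>2) \<partial>lborel) < \<infinity>"
proof -
  let ?E = "\<lambda>k A. \<integral>\<^sup>+t. ennreal ((1 - t\<^sup>2) ^ (j + 2) * (k t)\<^sup>2) * indicator A t \<partial>lborel"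
  \<comment> \<open>The cut-off yields a Borel function on the whole line; outside the open interval
    nothing is known about \<open>ds g\<close>.\<close>
  define k where "k = (\<lambda>t. norm (indicator {-1<..<1} t *\<^sub>R ds g t))"
  have km [measurable]: "k \<in> borel_measurable borel"
    unfolding k_def using locally_AC_ds_measurable[OF ac] by measurable
  have k: "0 \<le> k t" "t \<in> {-1<..<1} \<Longrightarrow> k t = norm (ds g t)" for t by (auto simp: k_def)
  have inc: "ennreal (norm (g b - g a)) \<le> (\<integral>\<^sup>+t. ennreal (k t) * indicator {a..b} t \<partial>lborel)"
    if "-1 < a" "a \<le> b" "b < 1" for a b
  proof -
    have "ennreal (norm (g b - g a)) = ennreal (norm (LINT t|lborel. indicator {a..b} t *\<^sub>R ds g t))"
      using locally_ACD(2)[OF ac that] by (simp add: set_lebesgue_integral_def)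
    also have "\<dots> \<le> (\<integral>\<^sup>+t. norm (indicator {a..b} t *\<^sub>R ds g t) \<partial>lborel)"
      using locally_ACD(1)[OF ac that] by (intro integral_norm_bound_ennreal) (simp add: set_integrable_def)
    also have "\<dots> = (\<integral>\<^sup>+t. ennreal (k t) * indicator {a..b} t \<partial>lborel)"
      using that by (intro nn_integral_cong) (auto simp: k_def indicator_def)
    finally show ?thesis .
  qed
  have le: "ennreal (norm (g s)) \<le> ennreal (norm (g 0)) + ennreal (norm (g s - g 0))" for s
    by (simp add: ennreal_plus[symmetric] norm_triangle_sub del: ennreal_plus)
  have sub: "?E k A < \<infinity>" if "A \<subseteq> {-1<..<1}" for A
  proof (rule le_less_trans[OF _ fin], rule nn_integral_mono)
    fix t
    show "ennreal ((1 - t\<^sup>2) ^ (j + 2) * (k t)\<^sup>2) * indicator A t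
      \<le> ennreal ((1 - t\<^sup>2) ^ (j + 2) * (norm (ds g t))\<^sup>2) * indicator {-1..1} t"
      using that k(2)[of t] by (cases "t \<in> A") auto
  qed
  have right: "(\<integral>\<^sup>+s. ennreal ((1 - s\<^sup>2) ^ j * (norm (g s))\<^sup>2) * indicator {0..<1} s \<partial>lborel) < \<infinity>"
  proof (rule hardy_half[OF km k(1), where ?h0.0="norm (g 0)"])
    show "ennreal (norm (g s)) \<le> ennreal (norm (g 0)) + (\<integral>\<^sup>+t. ennreal (k t) * indicator {0..s} t \<partial>lborel)"
      if "s \<in> {0..<1}" for s
      using that by (intro order_trans[OF le] add_left_mono inc) auto
    show "?E k {0..<1} < \<infinity>"
      by (rule sub) auto
  qed auto
  have left': "(\<integral>\<^sup>+s. ennreal ((1 - s\<^sup>2) ^ j * (norm (g (- s)))\<^sup>2) * indicator {0..<1} s \<partial>lborel) < \<infinity>"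
  proof (rule hardy_half[where k="\<lambda>t. k (- t)" and ?h0.0="norm (g 0)"])
    show "ennreal (norm (g (- s))) \<le> ennreal (norm (g 0)) + (\<integral>\<^sup>+t. ennreal (k (- t)) * indicator {0..s} t \<partial>lborel)"
      if s: "s \<in> {0..<1}" for s
    proof -
      have "ennreal (norm (g (- s) - g 0)) \<le> (\<integral>\<^sup>+t. ennreal (k t) * indicator {- s..0} t \<partial>lborel)"
        using inc[of "- s" 0] s by (simp add: norm_minus_commute)
      also have "\<dots> = (\<integral>\<^sup>+t. ennreal (k (- t)) * indicator {- s..0} (- t) \<partial>lborel)"
        using nn_integral_real_affine[of "\<lambda>t. ennreal (k t) * indicator {- s..0} t" "-1" 0] by simp
      also have "\<dots> = (\<integral>\<^sup>+t. ennreal (k (- t)) * indicator {0..s} t \<partial>lborel)"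
        by (intro nn_integral_cong) (auto simp: indicator_def)
      finally show ?thesis by (intro order_trans[OF le] add_left_mono)
    qed
    have "?E k {-1<..0}
      = (\<integral>\<^sup>+t. ennreal ((1 - t\<^sup>2) ^ (j + 2) * (k (- t))\<^sup>2) * indicator {-1<..0} (- t) \<partial>lborel)"
      using nn_integral_real_affine[of "\<lambda>t. ennreal ((1 - t\<^sup>2) ^ (j + 2) * (k t)\<^sup>2) * indicator {-1<..0} t" "-1" 0] by simp
    also have "\<dots> = ?E (\<lambda>t. k (- t)) {0..<1}"
      by (intro nn_integral_cong) (auto simp: indicator_def)
    finally show "?E (\<lambda>t. k (- t)) {0..<1} < \<infinity>"
      using sub[of "{-1<..0}"] by (simp only:) (simp add: subset_iff)?
  qed (use k(1) in auto)
  let ?F = "\<lambda>s. ennreal ((1 - s\<^sup>2) ^ j * (norm (g s))\<^sup>2)"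
  have gm: "(\<lambda>s. indicator {-1<..<1} s *\<^sub>R g s) \<in> borel_measurable borel"
    by (intro borel_measurable_continuous_on_indicator locally_AC_continuous[OF ac]) auto
  have m: "(\<lambda>s. ?F s * indicator A s) \<in> borel_measurable borel" if "A \<subseteq> {-1<..<1}" "A \<in> sets borel" for A
  proof -
    have "(\<lambda>s. ennreal ((1 - s\<^sup>2) ^ j * (norm (indicator {-1<..<1} s *\<^sub>R g s))\<^sup>2) * indicator A s) \<in> borel_measurable borel"
      using gm that(2) by measurable
    moreover have "(\<lambda>s. ennreal ((1 - s\<^sup>2) ^ j * (norm (indicator {-1<..<1} s *\<^sub>R g s))\<^sup>2) * indicator A s) = (\<lambda>s. ?F s * indicator A s)"
      using that(1) by (auto simp: indicator_def fun_eq_iff)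
    ultimately show ?thesis by simp
  qed
  have Fm: "(\<lambda>s. ?F s * indicator {-1<..0} s) \<in> borel_measurable borel"
    and Fm': "(\<lambda>s. ?F s * indicator {0..<1} s) \<in> borel_measurable borel"
    by (rule m; force)+
  have "(\<integral>\<^sup>+s. ?F s * indicator {-1<..0} s \<partial>lborel) = (\<integral>\<^sup>+s. ?F (- s) * indicator {-1<..0} (- s) \<partial>lborel)"
    using nn_integral_real_affine[OF Fm, of "-1" 0] by simp
  also have "\<dots> = (\<integral>\<^sup>+s. ennreal ((1 - s\<^sup>2) ^ j * (norm (g (- s)))\<^sup>2) * indicator {0..<1} s \<partial>lborel)"
    by (intro nn_integral_cong) (auto simp: indicator_def)
  finally have left: "(\<integral>\<^sup>+s. ?F s * indicator {-1<..0} s \<partial>lborel) < \<infinity>" using left' by simp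
  have "(\<integral>\<^sup>+s\<in>{-1..1}. ?F s \<partial>lborel) \<le> (\<integral>\<^sup>+s. ?F s * indicator {-1<..0} s + ?F s * indicator {0..<1} s \<partial>lborel)"
  proof (rule nn_integral_mono_AE)
    show "AE s in lborel. ?F s * indicator {-1..1} s \<le> ?F s * indicator {-1<..0} s + ?F s * indicator {0..<1} s"
      using AE_lborel_singleton[of "-1::real"] AE_lborel_singleton[of "1::real"]
      by eventually_elim (auto simp: indicator_def)
  qed
  also have "\<dots> = (\<integral>\<^sup>+s. ?F s * indicator {-1<..0} s \<partial>lborel) + (\<integral>\<^sup>+s. ?F s * indicator {0..<1} s \<partial>lborel)"
    using Fm Fm' by (intro nn_integral_add) auto
  also have "\<dots> < \<infinity>" using left right by simp
  finally show ?thesis .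
qed

section \<open>Between gauge and Lebesgue integrals on [-1,1]\<close>

lemma continuous_imp_set_borel_measurable:
  fixes f :: "real \<Rightarrow> 'a::real_normed_vector"
  assumes "continuous_on {-1<..<1} f"
  shows "set_borel_measurable lborel {-1..1} f"
proof -
  have [measurable]: "(\<lambda>s. indicator {-1<..<1} s *\<^sub>R f s) \<in> borel_measurable borel"
    by (intro borel_measurable_continuous_on_indicator assms) auto
  have "(\<lambda>s. if s = -1 then f (-1) else if s = 1 then f 1 else indicator {-1<..<1} s *\<^sub>R f s) \<in> borel_measurable borel"
    by measurable
  moreover have "(\<lambda>s. if s = -1 then f (-1) else if s = 1 then f 1 else indicator {-1<..<1} s *\<^sub>R f s) = (\<lambda>s. indicator {-1..1} s *\<^sub>R f s)"
    by (auto simp: indicator_def fun_eq_iff)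
  ultimately show ?thesis by (simp add: set_borel_measurable_def)
qed

text \<open>Absolute integrability refers to the completed measure. Borel measurability, supplied by
  interior continuity, brings it back to \<open>lborel\<close>.\<close>

lemma absolutely_integrable_imp_set_integrable_lborel:
  fixes f :: "real \<Rightarrow> 'a::euclidean_space"
  assumes "continuous_on {-1<..<1} f" "f absolutely_integrable_on {-1..1}"
  shows "set_integrable lborel {-1..1} f"
  using assms continuous_imp_set_borel_measurable[OF assms(1)]
  unfolding set_integrable_def set_borel_measurable_def by (subst (asm) integrable_completion) auto

lemma set_integrable_lborel_imp_absolutely_integrable:
  fixes f :: "real \<Rightarrow> 'a::euclidean_space"
  shows "set_integrable lborel S f \<Longrightarrow> f absolutely_integrable_on S"
  unfolding set_integrable_def by (rule integrable_completion[THEN iffD2]) auto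

lemma set_integrable_inner_L2:
  fixes f g :: "real \<Rightarrow> 'a::euclidean_space"
  assumes f: "set_borel_measurable lborel S f" "(\<integral>\<^sup>+s\<in>S. ennreal ((norm (f s))\<^sup>2) \<partial>lborel) < \<infinity>"
    and g: "set_borel_measurable lborel S g" "(\<integral>\<^sup>+s\<in>S. ennreal ((norm (g s))\<^sup>2) \<partial>lborel) < \<infinity>"
  shows "set_integrable lborel S (\<lambda>s. f s \<bullet> g s)"
proof -
  have sq: "integrable lborel (\<lambda>s. (norm (indicator S s *\<^sub>R f s))\<^sup>2)"
    if "set_borel_measurable lborel S f" "(\<integral>\<^sup>+s\<in>S. ennreal ((norm (f s))\<^sup>2) \<partial>lborel) < \<infinity>"
    for f :: "real \<Rightarrow> 'a"
  proof (rule integrableI_bounded)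
    show "(\<lambda>s. (norm (indicator S s *\<^sub>R f s))\<^sup>2) \<in> borel_measurable lborel"
      using that(1) unfolding set_borel_measurable_def by measurable
    have "(\<integral>\<^sup>+s. ennreal (norm ((norm (indicator S s *\<^sub>R f s))\<^sup>2)) \<partial>lborel) = (\<integral>\<^sup>+s\<in>S. ennreal ((norm (f s))\<^sup>2) \<partial>lborel)"
      by (intro nn_integral_cong) (auto simp: indicator_def)
    then show "(\<integral>\<^sup>+s. ennreal (norm ((norm (indicator S s *\<^sub>R f s))\<^sup>2)) \<partial>lborel) < \<infinity>"
      using that(2) by simp
  qed
  have m: "(\<lambda>s. (indicator S s *\<^sub>R f s) \<bullet> (indicator S s *\<^sub>R g s)) \<in> borel_measurable lborel"
    using f(1) g(1) unfolding set_borel_measurable_def by measurable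
  have "integrable lborel (\<lambda>s. (indicator S s *\<^sub>R f s) \<bullet> (indicator S s *\<^sub>R g s))"
  proof (rule Bochner_Integration.integrable_bound[OF Bochner_Integration.integrable_add[OF sq[OF f] sq[OF g]] m], rule AE_I2)
    fix s
    show "norm ((indicator S s *\<^sub>R f s) \<bullet> (indicator S s *\<^sub>R g s)) \<le> norm ((norm (indicator S s *\<^sub>R f s))\<^sup>2 + (norm (indicator S s *\<^sub>R g s))\<^sup>2)"
    proof -
      have "\<bar>a \<bullet> b\<bar> \<le> (norm a)\<^sup>2 + (norm b)\<^sup>2" for a b :: 'a
      proof -
        have "\<bar>a \<bullet> b\<bar> \<le> norm a * norm b" by (rule Cauchy_Schwarz_ineq2)
        also have "\<dots> \<le> (norm a)\<^sup>2 + (norm b)\<^sup>2"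
          using sum_squares_bound[of "norm a" "norm b"] mult_nonneg_nonneg[OF norm_ge_zero[of a] norm_ge_zero[of b]] by linarith
        finally show ?thesis .
      qed
      then show ?thesis by (cases "s \<in> S") simp_all
    qed
  qed
  moreover have "(\<lambda>s. (indicator S s *\<^sub>R f s) \<bullet> (indicator S s *\<^sub>R g s)) = (\<lambda>s. indicator S s *\<^sub>R (f s \<bullet> g s))"
    by (auto simp: indicator_def fun_eq_iff)
  ultimately show ?thesis by (simp add: set_integrable_def)
qed

section \<open>Spectral gap and lower bound for the numerator\<close>

text \<open>The spectral gap \<open>2\<close> of the Legendre operator on functions vanishing at \<open>0\<close>: with
  \<open>F = \<bar>f\<bar>\<^sup>2 (1 - s\<^sup>2) / s\<close> one has \<open>(1 - s\<^sup>2) \<bar>f'\<bar>\<^sup>2 - 2 \<bar>f\<bar>\<^sup>2 - F' = (1 - s\<^sup>2) \<bar>f' - f / s\<bar>\<^sup>2\<close>.\<close>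

lemma legendre_inequality:
  fixes f f1 :: "real \<Rightarrow> 'a::euclidean_space"
  assumes der: "\<And>s. s \<in> {-1<..<1} \<Longrightarrow> (f has_vector_derivative f1 s) (at s)" and f0: "f 0 = 0"
    and i0: "(\<lambda>s. (norm (f s))\<^sup>2) integrable_on {-1..1}"
    and i1: "(\<lambda>s. (1 - s\<^sup>2) * (norm (f1 s))\<^sup>2) integrable_on {-1..1}"
  shows "2 * integral {-1..1} (\<lambda>s. (norm (f s))\<^sup>2) \<le> integral {-1..1} (\<lambda>s. (1 - s\<^sup>2) * (norm (f1 s))\<^sup>2)"
proof -
  define h where "h = (\<lambda>s. (1 - s\<^sup>2) * (norm (f1 s))\<^sup>2 - 2 * (norm (f s))\<^sup>2)"
  have hi: "h integrable_on {-1..1}"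
    unfolding h_def by (intro integrable_diff i1 integrable_on_mult_right i0)
  define n where "n = (\<lambda>s. (norm (f s))\<^sup>2)"
  define F where "F = (\<lambda>s. n s * (1 - s\<^sup>2) / s)"
  define F1 where "F1 = (\<lambda>s. 2 * (f s \<bullet> f1 s) * (1 - s\<^sup>2) / s - n s * (1 + 1 / s\<^sup>2))"
  have nd: "(n has_real_derivative 2 * (f s \<bullet> f1 s)) (at s)" if "s \<in> {-1<..<1}" for s
  proof -
    have "((\<lambda>s. f s \<bullet> f s) has_vector_derivative f s \<bullet> f1 s + f1 s \<bullet> f s) (at s)"
      by (rule bounded_bilinear.has_vector_derivative[OF bounded_bilinear_inner der[OF that] der[OF that]])
    then show ?thesis
      by (simp add: n_def power2_norm_eq_inner has_real_derivative_iff_has_vector_derivative inner_commute)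
  qed
  have Fd: "(F has_real_derivative F1 s) (at s)" if "s \<in> {-1<..<1}" "s \<noteq> 0" for s
  proof -
    have "((\<lambda>s. n s * (1 - s\<^sup>2) / s) has_real_derivative
      ((2 * (f s \<bullet> f1 s) * (1 - s\<^sup>2) + (- 2 * s) * n s) * s - n s * (1 - s\<^sup>2) * 1) / (s * s)) (at s)"
      using that by (intro DERIV_divide DERIV_mult nd) (auto intro!: derivative_eq_intros)
    moreover have "((2 * (f s \<bullet> f1 s) * (1 - s\<^sup>2) + (- 2 * s) * n s) * s - n s * (1 - s\<^sup>2) * 1) / (s * s) = F1 s"
      using that by (simp add: F1_def field_simps power2_eq_square)
    ultimately show ?thesis by (simp add: F_def)
  qed
  \<comment> \<open>\<open>F\<close> has a removable singularity: \<open>n s / s\<close> tends to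
    the derivative of \<open>n\<close> at 0, which vanishes with \<open>f 0\<close>. The convention
    for division by 0 sets \<open>F 0\<close> to this limit.\<close>
  have F0: "isCont F 0"
  proof -
    have "((\<lambda>s. (n (0 + s) - n 0) / s) \<longlongrightarrow> 2 * (f 0 \<bullet> f1 0)) (at 0)"
      using nd[of 0] unfolding DERIV_def by simp
    then have "((\<lambda>s. n s / s) \<longlongrightarrow> 0) (at 0)" by (simp add: f0 n_def)
    then have "((\<lambda>s. n s / s * (1 - s\<^sup>2)) \<longlongrightarrow> 0 * (1 - 0\<^sup>2)) (at 0)"
      by (intro tendsto_intros)
    then show ?thesis by (simp add: isCont_def F_def)
  qed
  have alg: "(1 - s\<^sup>2) * a - 2 * n - (2 * c * (1 - s\<^sup>2) / s - n * (1 + 1 / s\<^sup>2)) = (1 - s\<^sup>2) * (a - 2 * c / s + n / s\<^sup>2)"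
    if "s \<noteq> 0" for a n c s :: real
  proof -
    have "n / s\<^sup>2 * s\<^sup>2 = n" using that by simp
    then show ?thesis by (simp add: algebra_simps diff_divide_distrib)
  qed
  have le: "F1 s \<le> h s" if "s \<in> {-1<..<1}" for s
  proof (cases "s = 0")
    case True then show ?thesis by (simp add: F1_def h_def n_def f0)
  next
    case False
    have sq: "s\<^sup>2 \<le> 1" using that by (auto simp: abs_square_le_1)
    have "(norm (f1 s - (1 / s) *\<^sub>R f s))\<^sup>2 = (norm (f1 s))\<^sup>2 - 2 * (f s \<bullet> f1 s) / s + n s / s\<^sup>2"
      by (simp add: power2_norm_eq_inner inner_diff_left inner_diff_right n_def inner_commute)
        (simp add: power2_eq_square)
    then have "h s - F1 s = (1 - s\<^sup>2) * (norm (f1 s - (1 / s) *\<^sub>R f s))\<^sup>2"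
      using alg[OF False, of "(norm (f1 s))\<^sup>2" "n s" "f s \<bullet> f1 s"] by (simp add: h_def F1_def n_def)
    moreover have "0 \<le> (1 - s\<^sup>2) * (norm (f1 s - (1 / s) *\<^sub>R f s))\<^sup>2"
      using sq by (intro mult_nonneg_nonneg) auto
    ultimately show ?thesis by linarith
  qed
  \<comment> \<open>The boundary terms of \<open>F\<close> at \<open>r\<close> and
    \<open>- r\<close> have the favourable sign for every \<open>r\<close>. So letting
    \<open>r\<close> tend to 1 needs only continuity of the integral and no decay of
    \<open>F\<close>.\<close>
  have pos: "0 \<le> prim h r - prim h (- r)" if r: "r \<in> {0<..<1}" for r
  proof -
    have "(F1 has_integral (F r - F (- r))) {-r..r}"
    proof (rule fundamental_theorem_of_calculus_interior_strong[where S="{0}"])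
      show "(F has_vector_derivative F1 x) (at x)" if "x \<in> {-r<..<r} - {0}" for x
        using Fd[of x] that r by (auto simp: has_real_derivative_iff_has_vector_derivative)
      show "continuous_on {-r..r} F"
      proof (intro continuous_at_imp_continuous_on ballI)
        fix x assume "x \<in> {-r..r}"
        then show "isCont F x" using F0 DERIV_isCont[OF Fd[of x]] r by (cases "x = 0") auto
      qed
    qed (use r in auto)
    moreover have "(h has_integral (prim h r - prim h (- r))) {-r..r}"
    proof -
      have "h integrable_on {-1..r}" "h integrable_on {-r..r}"
        using r by (auto intro: integrable_on_subinterval[OF hi])
      moreover from this have "integral {-r..r} h = prim h r - prim h (- r)"
        using r Henstock_Kurzweil_Integration.integral_combine[of "-1" "- r" r h] by (simp add: prim_def)
      ultimately show ?thesis by (simp add: has_integral_integral)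
    qed
    ultimately have "F r - F (- r) \<le> prim h r - prim h (- r)"
      by (rule has_integral_le) (use r in \<open>auto intro!: le\<close>)
    moreover have "r\<^sup>2 \<le> 1" using r by (auto simp: abs_square_le_1)
    then have "0 \<le> F r" "F (- r) \<le> 0" using r by (auto simp: F_def n_def)
    ultimately show ?thesis by linarith
  qed
  have c: "continuous_on {0..1} (\<lambda>r. prim h r - prim h (- r))"
    by (intro continuous_intros continuous_on_compose2[OF continuous_on_prim[OF hi], of _ "\<lambda>r. - r"]
      continuous_on_subset[OF continuous_on_prim[OF hi]]) auto
  have "0 \<le> prim h 1 - prim h (- 1)"
    using continuous_ge_on_closure[of "{0<..<1}" "\<lambda>r. prim h r - prim h (- r)" 1 0] c pos by simp
  then have "0 \<le> integral {-1..1} h" by (simp add: prim_def)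
  also have "integral {-1..1} h = integral {-1..1} (\<lambda>s. (1 - s\<^sup>2) * (norm (f1 s))\<^sup>2) - 2 * integral {-1..1} (\<lambda>s. (norm (f s))\<^sup>2)"
    unfolding h_def by (subst integral_diff) (auto intro!: i1 integrable_on_mult_right i0)
  finally show ?thesis by simp
qed

section \<open>Quadratic forms in two variables\<close>

lemma psd_form_discriminant:
  fixes x y z :: real
  assumes "\<And>a b. 0 \<le> a\<^sup>2 * x + 2 * a * b * y + b\<^sup>2 * z"
  shows "0 \<le> x" "0 \<le> z" "y\<^sup>2 \<le> x * z"
proof -
  show x: "0 \<le> x" and z: "0 \<le> z" using assms[of 1 0] assms[of 0 1] by auto
  show "y\<^sup>2 \<le> x * z"
  proof (cases "x = 0")
    case True
    have "y = 0"
    proof (rule ccontr)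
      assume "y \<noteq> 0"
      \<comment> \<open>With \<open>x = 0\<close> the form takes the value -1 at this point.\<close>
      then show False using assms[of "- (z + 1) / (2 * y)" 1] True by (simp add: field_simps)
    qed
    then show ?thesis using True by simp
  next
    case False
    have "0 \<le> x * (x * z - y\<^sup>2)"
      using assms[of "- y" x] by (simp add: power2_eq_square algebra_simps)
    then show ?thesis using x False by (simp add: zero_le_mult_iff)
  qed
qed

text \<open>The determinant of a sum is the sum of the determinants plus the mixed term
  \<open>p * z + r * x - 2 * (q * y)\<close>. The two discriminant inequalities and the
  arithmetic-geometric mean make the mixed term nonnegative.\<close>

lemma det_mono_2:
  fixes x y z x' y' z' :: real
  assumes P: "\<And>a b. 0 \<le> a\<^sup>2 * x + 2 * a * b * y + b\<^sup>2 * z"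
    and Q: "\<And>a b. a\<^sup>2 * x + 2 * a * b * y + b\<^sup>2 * z \<le> a\<^sup>2 * x' + 2 * a * b * y' + b\<^sup>2 * z'"
  shows "x * z - y\<^sup>2 \<le> x' * z' - y'\<^sup>2"
proof -
  define p q r where "p = x' - x" and "q = y' - y" and "r = z' - z"
  have "0 \<le> a\<^sup>2 * p + 2 * a * b * q + b\<^sup>2 * r" for a b
    using Q[of a b] by (simp add: p_def q_def r_def algebra_simps)
  note D = psd_form_discriminant[OF this] and E = psd_form_discriminant[OF P]
  have "(2 * (q * y))\<^sup>2 \<le> (p * z + r * x)\<^sup>2"
  proof -
    have "q\<^sup>2 * y\<^sup>2 \<le> (p * r) * (x * z)"
      by (intro mult_mono D E) (use D E in auto)
    moreover have "4 * ((p * z) * (r * x)) \<le> (p * z + r * x)\<^sup>2"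
      using zero_le_power2[of "p * z - r * x"] by (simp add: power2_eq_square algebra_simps)
    ultimately show ?thesis by (simp add: power_mult_distrib algebra_simps)
  qed
  then have "2 * (q * y) \<le> p * z + r * x"
    by (rule power2_le_imp_le) (use D E in auto)
  then have "0 \<le> (p * r - q\<^sup>2) + (p * z + r * x - 2 * (q * y))"
    using D by linarith
  also have "\<dots> = (x' * z' - y'\<^sup>2) - (x * z - y\<^sup>2)"
    by (simp add: p_def q_def r_def power2_eq_square algebra_simps)
  finally show ?thesis by simp
qed

section \<open>Comparison of the Green kernel with a product kernel\<close>

context potential
begin

lemma integral_bvp_sol_commute:
  assumes f: "f absolutely_integrable_on {-1..1}" "continuous_on {-1<..<1} f"
    and g: "g absolutely_integrable_on {-1..1}" "continuous_on {-1<..<1} g"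
  shows "integral {-1..1} (\<lambda>s. bvp_sol f s * g s) = integral {-1..1} (\<lambda>s. bvp_sol g s * f s)"
  using has_integral_unique[OF energy_identity[OF f g]] energy_identity[OF g f]
  by (simp add: mult_ac)

text \<open>Evenness of \<open>M\<close> allows \<open>green x s\<close> to be replaced by the
  average over \<open>s\<close> and \<open>- s\<close>, to which \<open>green_lower\<close> applies.
  Averaging turns its factor 1/2 into 1/4.\<close>

lemma integral_green_even_lower:
  fixes \<rho> defines "\<rho> \<equiv> integral {0..1} (\<lambda>s. (1 - s) * q s)"
  assumes M: "M absolutely_integrable_on {-1..1}"
    and even: "\<And>s. s \<in> {-1<..<1} \<Longrightarrow> M (- s) = M s" and nonneg: "\<And>s. 0 \<le> M s"
    and x: "x \<in> {-1..1}"
  shows "exp (- \<rho>) / 4 * (1 - x\<^sup>2) * integral {-1..1} (\<lambda>s. (1 - s\<^sup>2) * M s)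
    \<le> integral {-1..1} (\<lambda>s. green x s * M s)"
proof -
  have int: "(\<lambda>s. g s * M s) integrable_on {-1..1}" if "continuous_on {-1..1} g" for g
    using absolutely_integrable_mult_continuous[OF M that] set_lebesgue_integral_eq_integral(1) by blast
  have c1: "continuous_on {-1..1} (\<lambda>s. green x s)" using green_cont1[OF x] by (simp add: green_sym[of x])
  have c2: "continuous_on {-1..1} (\<lambda>s. green x (- s))"
    by (rule continuous_on_compose2[OF c1]) (auto intro!: continuous_intros)
  have "integral {-1..1} (\<lambda>s. green x s * M s) = integral {-1..1} (\<lambda>s. green x (- s) * M (- s))"
    using Henstock_Kurzweil_Integration.integral_reflect_real[of 1 "-1" "\<lambda>s. green x s * M s"] by simp
  also have "\<dots> = integral {-1..1} (\<lambda>s. green x (- s) * M s)"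
  proof (rule integral_cong)
    fix s :: real assume s: "s \<in> {-1..1}"
    \<comment> \<open>\<open>M\<close> is even only on the open interval; at the end points both
      sides vanish with the Green function.\<close>
    show "green x (- s) * M (- s) = green x (- s) * M s"
      using s even[of s] green_left[OF x] green_right[OF x] green_sym[of x]
      by (cases "s = 1 \<or> s = -1") auto
  qed
  finally have "2 * integral {-1..1} (\<lambda>s. green x s * M s)
      = integral {-1..1} (\<lambda>s. green x s * M s) + integral {-1..1} (\<lambda>s. green x (- s) * M s)"
    by simp
  also have "\<dots> = integral {-1..1} (\<lambda>s. (green s x + green (- s) x) * M s)"
    by (subst Henstock_Kurzweil_Integration.integral_add[symmetric, OF int[OF c1] int[OF c2]])
      (simp add: green_sym[of x] algebra_simps)
  also have "\<dots> \<ge> integral {-1..1} (\<lambda>s. exp (- \<rho>) / 2 * (1 - x\<^sup>2) * ((1 - s\<^sup>2) * M s))"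
  proof (rule integral_le)
    have "(\<lambda>s. (exp (- \<rho>) / 2 * (1 - x\<^sup>2) * (1 - s\<^sup>2)) * M s) integrable_on {-1..1}"
      by (intro int continuous_intros)
    then show "(\<lambda>s. exp (- \<rho>) / 2 * (1 - x\<^sup>2) * ((1 - s\<^sup>2) * M s)) integrable_on {-1..1}"
      by (simp add: mult.assoc)
    have "continuous_on {-1..1} (\<lambda>s. green x s + green x (- s))" by (intro continuous_intros c1 c2)
    from int[OF this] show "(\<lambda>s. (green s x + green (- s) x) * M s) integrable_on {-1..1}"
      by (simp add: green_sym[of x])
    show "exp (- \<rho>) / 2 * (1 - x\<^sup>2) * ((1 - s\<^sup>2) * M s) \<le> (green s x + green (- s) x) * M s" if "s \<in> {-1..1}" for s
      using mult_right_mono[OF green_lower[OF that x] nonneg[of s]] by (simp add: \<rho>_def mult_ac)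
  qed
  finally show ?thesis by simp
qed

text \<open>For fixed \<open>x\<close> the symmetrized integrand \<open>M\<close> is even and
  nonnegative in \<open>s\<close>, so \<open>integral_green_even_lower\<close> applies; then one
  integrates over \<open>x\<close>. Symmetry of the Green function shows that symmetrizing counts
  the numerator exactly twice.\<close>

lemma curvature_numerator_lower:
  fixes \<rho> defines "\<rho> \<equiv> integral {0..1} (\<lambda>s. (1 - s) * q s)"
  defines "J \<equiv> \<lambda>f. integral {-1..1} (\<lambda>s. (1 - s\<^sup>2) * f s)"
  assumes A: "A absolutely_integrable_on {-1..1}" "continuous_on {-1<..<1} A" "\<And>s. s \<in> {-1<..<1} \<Longrightarrow> A (- s) = A s"
    and B: "B absolutely_integrable_on {-1..1}" "continuous_on {-1<..<1} B" "\<And>s. s \<in> {-1<..<1} \<Longrightarrow> B (- s) = B s"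
    and C: "C absolutely_integrable_on {-1..1}" "continuous_on {-1<..<1} C" "\<And>s. s \<in> {-1<..<1} \<Longrightarrow> C (- s) = C s"
    and nonneg: "\<And>s. 0 \<le> A s" "\<And>s. 0 \<le> B s" and CS: "\<And>s. (C s)\<^sup>2 \<le> A s * B s"
  shows "exp (- \<rho>) / 4 * (J A * J B - (J C)\<^sup>2)
    \<le> integral {-1..1} (\<lambda>s. bvp_sol A s * B s) - integral {-1..1} (\<lambda>s. bvp_sol C s * C s)"
proof -
  let ?k = "exp (- \<rho>) / 4"
  have wc: "continuous_on {-1..1} (\<lambda>s. 1 - s\<^sup>2 :: real)" by (intro continuous_intros)
  have wi: "(\<lambda>s. (1 - s\<^sup>2) * f s) integrable_on {-1..1}" if "f absolutely_integrable_on {-1..1}" for f :: "real \<Rightarrow> real"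
    using absolutely_integrable_mult_continuous[OF that wc] set_lebesgue_integral_eq_integral(1) by blast
  have pointwise: "?k * ((1 - x\<^sup>2) * (J A * B x + J B * A x - 2 * (J C * C x)))
     \<le> bvp_sol A x * B x + bvp_sol B x * A x - 2 * (bvp_sol C x * C x)" if x: "x \<in> {-1..1}" for x
  proof -
    define M where "M = (\<lambda>s. A s * B x + B s * A x - 2 * (C s * C x))"
    have Mi: "M absolutely_integrable_on {-1..1}"
      unfolding M_def by (intro set_integral_add(1) set_integral_diff(1) set_integrable_mult_left set_integrable_mult_right A B C)
    have M0: "0 \<le> M s" for s
    proof -
      have "(2 * (C s * C x))\<^sup>2 \<le> (A s * B x + B s * A x)\<^sup>2"
      proof -
        have "(C s)\<^sup>2 * (C x)\<^sup>2 \<le> (A s * B s) * (A x * B x)"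
          by (intro mult_mono CS mult_nonneg_nonneg nonneg) auto
        moreover have "4 * ((A s * B x) * (B s * A x)) \<le> (A s * B x + B s * A x)\<^sup>2"
          using zero_le_power2[of "A s * B x - B s * A x"] by (simp add: power2_eq_square algebra_simps)
        ultimately show ?thesis by (simp add: power_mult_distrib algebra_simps)
      qed
      then have "2 * (C s * C x) \<le> A s * B x + B s * A x"
        by (rule power2_le_imp_le) (auto intro!: add_nonneg_nonneg mult_nonneg_nonneg nonneg)
      then show ?thesis by (simp add: M_def)
    qed
    have "?k * (1 - x\<^sup>2) * integral {-1..1} (\<lambda>s. (1 - s\<^sup>2) * M s) \<le> integral {-1..1} (\<lambda>s. green x s * M s)"
      unfolding \<rho>_def using A(3) B(3) C(3)
      by (intro integral_green_even_lower Mi M0 x) (simp add: M_def)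
    moreover have lin: "integral {-1..1} (\<lambda>s. g s * M s) =
        integral {-1..1} (\<lambda>s. g s * A s) * B x + integral {-1..1} (\<lambda>s. g s * B s) * A x - 2 * (integral {-1..1} (\<lambda>s. g s * C s) * C x)"
      (is "_ = ?r") if g: "continuous_on {-1..1} g" for g
    proof (rule integral_unique)
      have i: "((\<lambda>s. g s * f s) has_integral integral {-1..1} (\<lambda>s. g s * f s)) {-1..1}"
        if "f absolutely_integrable_on {-1..1}" for f
        using absolutely_integrable_mult_continuous[OF that g] set_lebesgue_integral_eq_integral(1) integrable_integral by blast
      have "((\<lambda>s. g s * A s * B x + g s * B s * A x - 2 * (g s * C s * C x)) has_integral
        ?r) {-1..1}"
        by (intro has_integral_add has_integral_diff has_integral_mult_left has_integral_mult_right i A B C)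
      then show "((\<lambda>s. g s * M s) has_integral
        ?r) {-1..1}"
        by (simp add: M_def algebra_simps)
    qed
    moreover have "continuous_on {-1..1} (green x)" using green_cont1[OF x] by (simp add: green_sym[of x] eta_contract_eq)
    ultimately show ?thesis
      using lin[OF wc] lin[of "green x"]
      by (simp add: bvp_sol_eq_integral[OF A(1,2) x] bvp_sol_eq_integral[OF B(1,2) x] bvp_sol_eq_integral[OF C(1,2) x] J_def mult.assoc)
  qed
  have i: "((\<lambda>x. bvp_sol f x * g x) has_integral integral {-1..1} (\<lambda>x. bvp_sol f x * g x)) {-1..1}"
    if "f absolutely_integrable_on {-1..1}" "continuous_on {-1<..<1} f" "g absolutely_integrable_on {-1..1}" for f g
    using absolutely_integrable_mult_continuous[OF that(3) bvp_sol_cont[OF that(1,2)]]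
      set_lebesgue_integral_eq_integral(1) integrable_integral by blast
  have r: "((\<lambda>x. bvp_sol A x * B x + bvp_sol B x * A x - 2 * (bvp_sol C x * C x)) has_integral
     (integral {-1..1} (\<lambda>x. bvp_sol A x * B x) + integral {-1..1} (\<lambda>x. bvp_sol B x * A x)
       - 2 * integral {-1..1} (\<lambda>x. bvp_sol C x * C x))) {-1..1}"
    by (intro has_integral_add has_integral_diff has_integral_mult_right i A B C)
  have j: "((\<lambda>s. (1 - s\<^sup>2) * f s) has_integral J f) {-1..1}" if "f absolutely_integrable_on {-1..1}" for f
    unfolding J_def by (intro integrable_integral wi that)
  have "((\<lambda>x. ?k * (J A * ((1 - x\<^sup>2) * B x) + J B * ((1 - x\<^sup>2) * A x) - 2 * (J C * ((1 - x\<^sup>2) * C x)))) has_integral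
    ?k * (J A * J B + J B * J A - 2 * (J C * J C))) {-1..1}"
    by (intro has_integral_add has_integral_diff has_integral_mult_right j A B C)
  then have l: "((\<lambda>x. ?k * ((1 - x\<^sup>2) * (J A * B x + J B * A x - 2 * (J C * C x)))) has_integral
    ?k * (J A * J B + J B * J A - 2 * (J C * J C))) {-1..1}"
    by (simp add: algebra_simps)
  have "?k * (J A * J B + J B * J A - 2 * (J C * J C)) \<le> integral {-1..1} (\<lambda>x. bvp_sol A x * B x) + integral {-1..1} (\<lambda>x. bvp_sol B x * A x)
       - 2 * integral {-1..1} (\<lambda>x. bvp_sol C x * C x)"
    by (rule has_integral_le[OF l r]) (rule pointwise)
  then show ?thesis
    using integral_bvp_sol_commute[OF B(1,2) A(1,2)] by (simp add: power2_eq_square algebra_simps)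
qed

end

section \<open>Second fundamental form and sectional curvature\<close>

lemma LINT_eq_integral:
  fixes f :: "real \<Rightarrow> real"
  assumes "continuous_on {-1<..<1} f" "f absolutely_integrable_on {-1..1}"
  shows "(LINT s:{-1..1}|lborel. f s) = integral {-1..1} f"
  by (rule set_borel_integral_eq_integral(2)[OF absolutely_integrable_imp_set_integrable_lborel[OF assms]])

text \<open>Derivatives and Green functions may take arbitrary values at the end points or for a
  source there, so agreement can be asked for only in the interior.\<close>

lemma LINT_cong_interior:
  fixes f g :: "real \<Rightarrow> real"
  assumes eq: "\<And>s. s \<in> {-1<..<1} \<Longrightarrow> f s = g s" and g: "continuous_on {-1<..<1} g" "g absolutely_integrable_on {-1..1}"
  shows "(LINT s:{-1..1}|lborel. f s) = integral {-1..1} g"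
proof -
  have "continuous_on {-1<..<1} f" using g(1) eq continuous_on_cong[of "{-1<..<1}" "{-1<..<1}" f g] by simp
  note m = continuous_imp_set_borel_measurable[OF this] continuous_imp_set_borel_measurable[OF g(1)]
  have "(LINT s:{-1..1}|lborel. f s) = (LINT s:{-1..1}|lborel. g s)"
    unfolding set_lebesgue_integral_def
  proof (rule integral_cong_AE)
    show "AE s in lborel. indicator {-1..1} s *\<^sub>R f s = indicator {-1..1} s *\<^sub>R g s"
      using AE_lborel_singleton[of "-1::real"] AE_lborel_singleton[of "1::real"]
      by eventually_elim (auto simp: indicator_def eq)
  qed (use m in \<open>auto simp: set_borel_measurable_def\<close>)
  then show ?thesis using LINT_eq_integral[OF g] by simp
qed

text \<open>The set of disagreement is open, and a nonempty open set is not null. This turns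
  almost-everywhere conditions such as the one in \<open>Aspace\<close> into pointwise ones.\<close>

lemma continuous_AE_imp_eq:
  fixes f g :: "real \<Rightarrow> real"
  assumes f: "continuous_on {-1<..<1} f" and g: "continuous_on {-1<..<1} g"
    and ae: "AE s in lborel. s \<in> {-1<..<1} \<longrightarrow> f s = g s" and x: "x \<in> {-1<..<1}"
  shows "f x = g x"
proof (rule ccontr)
  assume ne: "f x \<noteq> g x"
  let ?U = "{-1<..<1} \<inter> (\<lambda>s. f s - g s) -` (- {0})"
  have "open ?U"
    by (rule continuous_open_preimage) (auto intro!: continuous_intros f g)
  moreover have "?U \<noteq> {}" using ne x by auto
  ultimately have "\<not> negligible ?U" by (rule open_not_negligible)
  moreover have "AE s in lebesgue. s \<notin> ?U"
    using AE_completion[OF ae] by eventually_elim auto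
  then have "?U \<in> null_sets lebesgue"
    using \<open>open ?U\<close> by (subst (asm) AE_iff_null_sets[symmetric]) (auto simp: lmeasurable_open)
  ultimately show False by (simp add: negligible_iff_null_sets)
qed

text \<open>Covers both parities, \<open>c = -1\<close> for odd and \<open>c = 1\<close> for even
  functions; differentiation exchanges them.\<close>

lemma ds_reflect:
  fixes f :: "real \<Rightarrow> 'a::real_normed_vector"
  assumes f: "\<And>s. s \<in> {-1<..<1} \<Longrightarrow> (f has_vector_derivative ds f s) (at s)"
    and ref: "\<And>s. s \<in> {-1<..<1} \<Longrightarrow> f (- s) = c *\<^sub>R f s" and s: "s \<in> {-1<..<1}"
  shows "ds f (- s) = - c *\<^sub>R ds f s"
proof -
  have "((\<lambda>s. - s) has_vector_derivative -1) (at s)"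
    by (auto intro!: derivative_eq_intros)
  from vector_diff_chain_at[OF this] f[of "- s"] s
  have 1: "((\<lambda>s. f (- s)) has_vector_derivative - ds f (- s)) (at s)" by (simp add: o_def)
  have "((\<lambda>s. c *\<^sub>R f s) has_vector_derivative c *\<^sub>R ds f s) (at s)"
    by (rule bounded_linear.has_vector_derivative[OF bounded_linear_scaleR_right f[OF s]])
  then have "((\<lambda>s. f (- s)) has_vector_derivative c *\<^sub>R ds f s) (at s)"
    by (rule has_vector_derivative_transform_within_open[of _ _ _ "{-1<..<1}"]) (use s ref in auto)
  from vector_derivative_unique_at[OF 1 this] show ?thesis
    by (metis minus_minus scaleR_minus_left)
qed

text \<open>The only properties of \<open>u \<in> T\<^sub>\<gamma>\<A>\<^sup>m\<close> that enter the curvature estimates.\<close>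

definition odd_H1 :: "(real \<Rightarrow> 'a::euclidean_space) \<Rightarrow> bool" where
  "odd_H1 u \<longleftrightarrow> (\<forall>s\<in>{-1<..<1}. (u has_vector_derivative ds u s) (at s)) \<and>
     continuous_on {-1<..<1} (ds u) \<and> (\<forall>s\<in>{-1<..<1}. ds u (- s) = ds u s) \<and> u 0 = 0 \<and>
     set_borel_measurable lborel {-1..1} u \<and>
     (\<integral>\<^sup>+s\<in>{-1..1}. ennreal ((norm (u s))\<^sup>2) \<partial>lborel) < \<infinity> \<and>
     (\<integral>\<^sup>+s\<in>{-1..1}. ennreal ((norm (ds u s))\<^sup>2) \<partial>lborel) < \<infinity>"

lemma KspaceD:
  assumes "\<eta> \<in> Kspace m"
  shows "set_borel_measurable lborel {-1..1} \<eta>" "\<And>s. s \<in> {-1..1} \<Longrightarrow> \<eta> (- s) = - \<eta> s"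
    "\<And>k. k < m \<Longrightarrow> locally_AC ((ds ^^ k) \<eta>)"
    "\<And>j. j \<le> m \<Longrightarrow> (\<integral>\<^sup>+s\<in>{-1..1}. ennreal ((1 - s\<^sup>2) ^ j * (norm ((ds ^^ j) \<eta> s))\<^sup>2) \<partial>lborel) < \<infinity>"
  using assms by (auto simp: Kspace_def wnorm2_def)

lemma Kspace_Ck: "\<eta> \<in> Kspace m \<Longrightarrow> n + k < m \<Longrightarrow> Ck {-1<..<1} n ((ds ^^ k) \<eta>)"
  by (rule locally_AC_Ck[of m]) (auto dest: KspaceD)

lemma Kspace_ds:
  assumes "\<eta> \<in> Kspace m" "Suc k < m" "s \<in> {-1<..<1}"
  shows "((ds ^^ k) \<eta> has_vector_derivative (ds ^^ Suc k) \<eta> s) (at s)"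
  using Ck_ds(2)[OF _ Kspace_Ck[OF assms(1), of "Suc 0" k] assms(3)] assms(2) by simp

lemma Kspace_hardy:
  assumes "\<eta> \<in> Kspace m" "k < m"
    "(\<integral>\<^sup>+s\<in>{-1..1}. ennreal ((1 - s\<^sup>2) ^ (j + 2) * (norm ((ds ^^ Suc k) \<eta> s))\<^sup>2) \<partial>lborel) < \<infinity>"
  shows "(\<integral>\<^sup>+s\<in>{-1..1}. ennreal ((1 - s\<^sup>2) ^ j * (norm ((ds ^^ k) \<eta> s))\<^sup>2) \<partial>lborel) < \<infinity>"
  using hardy[OF KspaceD(3)[OF assms(1,2)], of j] assms(3) by simp

lemma Kspace_odd_H1:
  assumes u: "u \<in> Kspace m" and m: "m \<ge> 2"
  shows "odd_H1 u"
  unfolding odd_H1_def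
proof (intro conjI ballI)
  show der: "(u has_vector_derivative ds u s) (at s)" if "s \<in> {-1<..<1}" for s
    using Kspace_ds[OF u, of 0] m that by simp
  show "continuous_on {-1<..<1} (ds u)"
    using Ck_continuous[OF Kspace_Ck[OF u, of 0 1]] m by simp
  show "ds u (- s) = ds u s" if "s \<in> {-1<..<1}" for s
    using ds_reflect[OF der, of "-1" s] KspaceD(2)[OF u] that by simp
  have "u 0 = - u 0" using KspaceD(2)[OF u, of 0] by simp
  then have "2 *\<^sub>R u 0 = 0" by (metis add.right_inverse scaleR_2)
  then show "u 0 = 0" by simp
  show "set_borel_measurable lborel {-1..1} u" by (rule KspaceD(1)[OF u])
  show "(\<integral>\<^sup>+s\<in>{-1..1}. ennreal ((norm (u s))\<^sup>2) \<partial>lborel) < \<infinity>"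
    using KspaceD(4)[OF u, of 0] by simp
  \<comment> \<open>Hardy's inequality for u': it needs the exponent 2 on u'', which is one of the
    norms of \<open>Kspace m\<close> since \<open>m\<close> is at least 2.\<close>
  show "(\<integral>\<^sup>+s\<in>{-1..1}. ennreal ((norm (ds u s))\<^sup>2) \<partial>lborel) < \<infinity>"
    using Kspace_hardy[OF u, of 1 0] KspaceD(4)[OF u, of 2] m by (simp add: numeral_2_eq_2)
qed

context
  fixes u v :: "real \<Rightarrow> 'a::euclidean_space"
  assumes u: "odd_H1 u" and v: "odd_H1 v"
begin

lemma ds_inner_cont: "continuous_on {-1<..<1} (\<lambda>s. ds u s \<bullet> ds v s)"
  using u v by (auto simp: odd_H1_def intro!: continuous_intros)

lemma ds_inner_int: "(\<lambda>s. ds u s \<bullet> ds v s) absolutely_integrable_on {-1..1}"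
  using u v unfolding odd_H1_def
  by (intro set_integrable_lborel_imp_absolutely_integrable set_integrable_inner_L2
      continuous_imp_set_borel_measurable) auto

lemma ds_inner_even: "s \<in> {-1<..<1} \<Longrightarrow> ds u (- s) \<bullet> ds v (- s) = ds u s \<bullet> ds v s"
  using u v by (auto simp: odd_H1_def)

lemma odd_H1_inner_int: "set_integrable lborel {-1..1} (\<lambda>s. u s \<bullet> v s)"
  using u v unfolding odd_H1_def by (intro set_integrable_inner_L2) auto

end

definition dirichlet :: "(real \<Rightarrow> 'a::euclidean_space) \<Rightarrow> (real \<Rightarrow> 'a) \<Rightarrow> real" where
  "dirichlet u v = integral {-1..1} (\<lambda>s. (1 - s\<^sup>2) * (ds u s \<bullet> ds v s))"

lemma weak_metric_has_integral:
  "odd_H1 u \<Longrightarrow> odd_H1 v \<Longrightarrow> ((\<lambda>s. u s \<bullet> v s) has_integral weak_metric u v) {-1..1}"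
  using set_borel_integral_eq_integral[OF odd_H1_inner_int, of u v]
  by (simp add: weak_metric_def has_integral_integral)

lemma dirichlet_has_integral:
  assumes "odd_H1 u" "odd_H1 v"
  shows "((\<lambda>s. (1 - s\<^sup>2) * (ds u s \<bullet> ds v s)) has_integral dirichlet u v) {-1..1}"
  unfolding dirichlet_def
proof (rule integrable_integral)
  have "continuous_on {-1..1} (\<lambda>s. 1 - s\<^sup>2 :: real)" by (intro continuous_intros)
  from absolutely_integrable_mult_continuous[OF ds_inner_int[OF assms] this]
  show "(\<lambda>s. (1 - s\<^sup>2) * (ds u s \<bullet> ds v s)) integrable_on {-1..1}"
    using set_lebesgue_integral_eq_integral(1) by blast
qed

lemma norm_combination_square:
  "(norm (a *\<^sub>R x + b *\<^sub>R y))\<^sup>2 = a\<^sup>2 * (x \<bullet> x) + 2 * a * b * (x \<bullet> y) + b\<^sup>2 * (y \<bullet> y)"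
  unfolding power2_norm_eq_inner
  by (simp add: inner_add_left inner_add_right inner_commute power2_eq_square algebra_simps)

lemma combination_has_integral:
  assumes "odd_H1 u" "odd_H1 v"
  shows "((\<lambda>s. (norm (a *\<^sub>R u s + b *\<^sub>R v s))\<^sup>2) has_integral
    a\<^sup>2 * weak_metric u u + 2 * a * b * weak_metric u v + b\<^sup>2 * weak_metric v v) {-1..1}"
  unfolding norm_combination_square
  by (intro has_integral_add has_integral_mult_right weak_metric_has_integral assms)

lemma weak_metric_form_nonneg:
  assumes "odd_H1 u" "odd_H1 v"
  shows "0 \<le> a\<^sup>2 * weak_metric u u + 2 * a * b * weak_metric u v + b\<^sup>2 * weak_metric v v"
  by (rule has_integral_nonneg[OF combination_has_integral[OF assms]]) simp

text \<open>The spectral gap is applied to all combinations of \<open>u\<close> and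
  \<open>v\<close>: comparing determinants requires an inequality of quadratic forms on the whole
  plane, not just for the two fields.\<close>

lemma weak_metric_le_dirichlet:
  assumes u: "odd_H1 u" and v: "odd_H1 v"
  shows "2 * (a\<^sup>2 * weak_metric u u + 2 * a * b * weak_metric u v + b\<^sup>2 * weak_metric v v)
    \<le> a\<^sup>2 * dirichlet u u + 2 * a * b * dirichlet u v + b\<^sup>2 * dirichlet v v"
proof -
  let ?f = "\<lambda>s. a *\<^sub>R u s + b *\<^sub>R v s" and ?f1 = "\<lambda>s. a *\<^sub>R ds u s + b *\<^sub>R ds v s"
  have "((\<lambda>s. a\<^sup>2 * ((1 - s\<^sup>2) * (ds u s \<bullet> ds u s)) + 2 * a * b * ((1 - s\<^sup>2) * (ds u s \<bullet> ds v s)) + b\<^sup>2 * ((1 - s\<^sup>2) * (ds v s \<bullet> ds v s)))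
     has_integral (a\<^sup>2 * dirichlet u u + 2 * a * b * dirichlet u v + b\<^sup>2 * dirichlet v v)) {-1..1}"
    by (intro has_integral_add has_integral_mult_right dirichlet_has_integral assms)
  then have D: "((\<lambda>s. (1 - s\<^sup>2) * (norm (?f1 s))\<^sup>2) has_integral (a\<^sup>2 * dirichlet u u + 2 * a * b * dirichlet u v + b\<^sup>2 * dirichlet v v)) {-1..1}"
    unfolding norm_combination_square by (simp add: algebra_simps)
  note W = combination_has_integral[OF assms, of a b]
  have "2 * integral {-1..1} (\<lambda>s. (norm (?f s))\<^sup>2) \<le> integral {-1..1} (\<lambda>s. (1 - s\<^sup>2) * (norm (?f1 s))\<^sup>2)"
  proof (rule legendre_inequality)
    show "(?f has_vector_derivative ?f1 s) (at s)" if "s \<in> {-1<..<1}" for s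
      using u v that unfolding odd_H1_def
      by (intro has_vector_derivative_add bounded_linear.has_vector_derivative[OF bounded_linear_scaleR_right]) auto
    show "?f 0 = 0" using u v by (simp add: odd_H1_def)
  qed (use D W in \<open>auto intro: has_integral_integrable\<close>)
  then show ?thesis using integral_unique[OF D] integral_unique[OF W] by simp
qed

lemma gram_le_dirichlet_det:
  assumes u: "odd_H1 u" and v: "odd_H1 v"
  shows "4 * (weak_metric u u * weak_metric v v - (weak_metric u v)\<^sup>2)
    \<le> dirichlet u u * dirichlet v v - (dirichlet u v)\<^sup>2"
proof -
  have "(2 * weak_metric u u) * (2 * weak_metric v v) - (2 * weak_metric u v)\<^sup>2
    \<le> dirichlet u u * dirichlet v v - (dirichlet u v)\<^sup>2"
  proof (rule det_mono_2)
    show "0 \<le> a\<^sup>2 * (2 * weak_metric u u) + 2 * a * b * (2 * weak_metric u v) + b\<^sup>2 * (2 * weak_metric v v)" for a b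
      using weak_metric_form_nonneg[OF assms, of a b] by (simp add: algebra_simps)
    show "a\<^sup>2 * (2 * weak_metric u u) + 2 * a * b * (2 * weak_metric u v) + b\<^sup>2 * (2 * weak_metric v v)
      \<le> a\<^sup>2 * dirichlet u u + 2 * a * b * dirichlet u v + b\<^sup>2 * dirichlet v v" for a b
      using weak_metric_le_dirichlet[OF assms, of a b] by (simp add: algebra_simps)
  qed
  then show ?thesis by (simp add: power_mult_distrib)
qed

text \<open>If the determinant vanished, the combination of \<open>u\<close> and \<open>v\<close>
  with coefficients \<open>weak_metric v v\<close> and \<open>- weak_metric u v\<close> would have
  norm 0. Independence then forces \<open>weak_metric v v = 0\<close>, so \<open>v\<close> is null,
  a contradiction.\<close>

lemma gram_det_pos:
  fixes u v :: "real \<Rightarrow> real ^ 'n"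
  assumes u: "odd_H1 u" and v: "odd_H1 v" and ind: "lin_indep2 u v"
  shows "0 < weak_metric u u * weak_metric v v - (weak_metric u v)\<^sup>2"
proof (rule ccontr)
  let ?I = "weak_metric"
  assume neg: "\<not> ?thesis"
  have "(?I u v)\<^sup>2 \<le> ?I u u * ?I v v"
    using weak_metric_form_nonneg[OF u v] by (intro psd_form_discriminant(3))
  with neg have eq: "?I u u * ?I v v = (?I u v)\<^sup>2" by simp
  have null: "a = 0 \<and> b = 0" if z: "a\<^sup>2 * ?I u u + 2 * a * b * ?I u v + b\<^sup>2 * ?I v v = 0" for a b
  proof -
    let ?f = "\<lambda>s. a *\<^sub>R u s + b *\<^sub>R v s"
    have "set_integrable lborel {-1..1} (\<lambda>s. (norm (?f s))\<^sup>2)"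
      unfolding norm_combination_square
      by (intro set_integral_add(1) set_integrable_mult_right odd_H1_inner_int u v)
    moreover from this have "(LINT s:{-1..1}|lborel. (norm (?f s))\<^sup>2) = 0"
      using set_borel_integral_eq_integral(2) integral_unique[OF combination_has_integral[OF u v, of a b]] z by metis
    ultimately have "AE s in lborel. indicator {-1..1} s *\<^sub>R (norm (?f s))\<^sup>2 = 0"
      unfolding set_integrable_def set_lebesgue_integral_def
      by (subst (asm) integral_nonneg_eq_0_iff_AE) auto
    then have "AE s in lborel. s \<in> {-1..1} \<longrightarrow> ?f s = 0"
      by eventually_elim auto
    then show ?thesis using ind by (simp add: lin_indep2_def)
  qed
  have "(?I v v)\<^sup>2 * ?I u u + 2 * ?I v v * (- ?I u v) * ?I u v + (- ?I u v)\<^sup>2 * ?I v v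
    = ?I v v * (?I u u * ?I v v - (?I u v)\<^sup>2)"
    by (simp add: power2_eq_square algebra_simps)
  then have "?I v v = 0" using null[of "?I v v" "- ?I u v"] eq by simp
  then show False using null[of 0 1] by simp
qed

section \<open>A fixed arc-length curve and its potential\<close>

locale arc_length_curve =
  fixes m :: nat and \<gamma> :: "real \<Rightarrow> real ^ 'n"
  assumes m: "m \<ge> 2" and \<gamma>: "\<gamma> \<in> Aspace (m + 2)"
begin

lemma \<gamma>_K: "\<gamma> \<in> Kspace (m + 2)" using \<gamma> by (simp add: Aspace_def)

lemma \<gamma>_deriv: "s \<in> {-1<..<1} \<Longrightarrow> (\<gamma> has_vector_derivative ds \<gamma> s) (at s)"
  and ds_\<gamma>_deriv: "s \<in> {-1<..<1} \<Longrightarrow> (ds \<gamma> has_vector_derivative (ds ^^ 2) \<gamma> s) (at s)"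
  using Kspace_ds[OF \<gamma>_K, of 0 s] Kspace_ds[OF \<gamma>_K, of 1 s] m
  by (auto simp: eval_nat_numeral)

lemma ds_\<gamma>_cont: "continuous_on {-1<..<1} (ds \<gamma>)"
  and ds2_\<gamma>_cont: "continuous_on {-1<..<1} ((ds ^^ 2) \<gamma>)"
  using Ck_continuous[OF Kspace_Ck[OF \<gamma>_K, of 0 1]] Ck_continuous[OF Kspace_Ck[OF \<gamma>_K, of 0 2]] m by auto

lemma ds_\<gamma>_even: "s \<in> {-1<..<1} \<Longrightarrow> ds \<gamma> (- s) = ds \<gamma> s"
  using ds_reflect[OF \<gamma>_deriv, of "-1" s] KspaceD(2)[OF \<gamma>_K] by simp

lemma ds2_\<gamma>_odd: "s \<in> {-1<..<1} \<Longrightarrow> (ds ^^ 2) \<gamma> (- s) = - (ds ^^ 2) \<gamma> s"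
  using ds_reflect[of "ds \<gamma>" 1 s] ds_\<gamma>_deriv ds_\<gamma>_even by (simp add: eval_nat_numeral)

text \<open>Two uses of Hardy's inequality: the exponents 4, 2, 0 go with the derivatives of orders
  4, 3, 2. The first is finite because m + 2 is at least 4.\<close>

lemma ds2_\<gamma>_L2: "(\<integral>\<^sup>+s\<in>{-1..1}. ennreal ((norm ((ds ^^ 2) \<gamma> s))\<^sup>2) \<partial>lborel) < \<infinity>"
proof -
  have "(\<integral>\<^sup>+s\<in>{-1..1}. ennreal ((1 - s\<^sup>2) ^ (2 + 2) * (norm ((ds ^^ Suc 3) \<gamma> s))\<^sup>2) \<partial>lborel) < \<infinity>"
    using KspaceD(4)[OF \<gamma>_K, of 4] m by (simp add: eval_nat_numeral)
  from Kspace_hardy[OF \<gamma>_K _ this] m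
  have "(\<integral>\<^sup>+s\<in>{-1..1}. ennreal ((1 - s\<^sup>2) ^ (0 + 2) * (norm ((ds ^^ Suc 2) \<gamma> s))\<^sup>2) \<partial>lborel) < \<infinity>"
    by (simp add: eval_nat_numeral)
  from Kspace_hardy[OF \<gamma>_K _ this] m show ?thesis by simp
qed

sublocale potential "\<lambda>s. (norm ((ds ^^ 2) \<gamma> s))\<^sup>2"
proof
  show "continuous_on {-1<..<1} (\<lambda>s. (norm ((ds ^^ 2) \<gamma> s))\<^sup>2)"
    by (intro continuous_intros ds2_\<gamma>_cont)
  have "set_integrable lborel {-1..1} (\<lambda>s. (ds ^^ 2) \<gamma> s \<bullet> (ds ^^ 2) \<gamma> s)"
    by (intro set_integrable_inner_L2 continuous_imp_set_borel_measurable ds2_\<gamma>_cont ds2_\<gamma>_L2)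
  then show "(\<lambda>s. (norm ((ds ^^ 2) \<gamma> s))\<^sup>2) absolutely_integrable_on {-1..1}"
    unfolding power2_norm_eq_inner by (rule set_integrable_lborel_imp_absolutely_integrable)
  show "(norm ((ds ^^ 2) \<gamma> (- s)))\<^sup>2 = (norm ((ds ^^ 2) \<gamma> s))\<^sup>2" if "s \<in> {-1<..<1}" for s
    using ds2_\<gamma>_odd[OF that] by simp
qed auto

abbreviation q where "q \<equiv> \<lambda>s. (norm ((ds ^^ 2) \<gamma> s))\<^sup>2"

lemma norm_ds_\<gamma>:
  assumes "s \<in> {-1<..<1}" shows "norm (ds \<gamma> s) = 1"
  using continuous_AE_imp_eq[of "\<lambda>s. norm (ds \<gamma> s)" "\<lambda>s. 1" s] \<gamma> assms ds_\<gamma>_cont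
  by (auto simp: Aspace_def intro: continuous_intros)

lemma ds_\<gamma>_orthogonal:
  assumes s: "s \<in> {-1<..<1}" shows "ds \<gamma> s \<bullet> (ds ^^ 2) \<gamma> s = 0"
proof -
  have "((\<lambda>s. ds \<gamma> s \<bullet> ds \<gamma> s) has_vector_derivative ds \<gamma> s \<bullet> (ds ^^ 2) \<gamma> s + (ds ^^ 2) \<gamma> s \<bullet> ds \<gamma> s) (at s)"
    by (rule bounded_bilinear.has_vector_derivative[OF bounded_bilinear_inner]) (use ds_\<gamma>_deriv s in auto)
  moreover have "((\<lambda>s. ds \<gamma> s \<bullet> ds \<gamma> s) has_vector_derivative 0) (at s)"
    by (rule has_vector_derivative_transform_within_open[OF has_vector_derivative_const[of 1], of "{-1<..<1}"])
      (use s norm_ds_\<gamma> in \<open>auto simp: dot_square_norm\<close>)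
  ultimately show ?thesis
    using vector_derivative_unique_at by (fastforce simp: inner_commute)
qed

lemma varrho_eq: "varrho \<gamma> = integral {0..1} (\<lambda>s. (1 - s) * q s)"
proof -
  have "set_integrable lborel {-1..1} q"
    by (intro absolutely_integrable_imp_set_integrable_lborel q_cont q_int)
  then have "set_integrable lborel {0..1} q" by (rule set_integrable_subset) auto
  moreover have "set_integrable lborel {0..1} (\<lambda>s. s * q s)"
  proof (rule set_integrable_bound[OF calculation])
    have "continuous_on {-1<..<1} (\<lambda>s. s * q s)" by (intro continuous_intros q_cont)
    from continuous_imp_set_borel_measurable[OF this]
    show "set_borel_measurable lborel {0..1} (\<lambda>s. s * q s)"
      by (rule set_borel_measurable_subset) auto
    show "AE s in lborel. s \<in> {0..1} \<longrightarrow> norm (s * q s) \<le> norm (q s)"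
      by (rule AE_I2) (auto simp: abs_mult mult_left_le_one_le)
  qed
  ultimately have "set_integrable lborel {0..1} (\<lambda>s. q s - s * q s)" by (rule set_integral_diff(1))
  then show ?thesis
    using set_borel_integral_eq_integral(2) unfolding varrho_def by (simp add: left_diff_distrib)
qed

lemma varrho_nonneg: "0 \<le> varrho \<gamma>"
  unfolding varrho_eq
  by (rule Henstock_Kurzweil_Integration.integral_nonneg)
    (auto intro!: integrable_on_subinterval[OF mult_f_int[OF q_int q_cont, of "\<lambda>s. 1 - s"]] continuous_intros)

text \<open>\<open>sigma\<close> is a definite description, so existence and uniqueness are both
  required. The witness is \<open>bvp_sol\<close> extended by 0, as the description demands;
  interior derivatives do not see the extension.\<close>

lemma sigma_eq:
  assumes u: "odd_H1 u" and v: "odd_H1 v" and s: "s \<in> {-1..1}"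
  defines "f \<equiv> \<lambda>s. ds u s \<bullet> ds v s"
  shows "sigma \<gamma> u v s = bvp_sol f s"
    and "s \<in> {-1<..<1} \<Longrightarrow> (sigma \<gamma> u v has_real_derivative dbvp_sol f s) (at s)"
proof -
  note f = ds_inner_int[OF u v, folded f_def] ds_inner_cont[OF u v, folded f_def]
  define \<sigma> where "\<sigma> = (\<lambda>s. if s \<in> {-1..1} then bvp_sol f s else 0)"
  have \<sigma>d: "(\<sigma> has_real_derivative dbvp_sol f s) (at s)" if "s \<in> {-1<..<1}" for s
    by (rule has_field_derivative_transform_within_open[OF bvp_sol_deriv[OF f that], of "{-1<..<1}"])
      (use that in \<open>auto simp: \<sigma>_def\<close>)
  then have ds\<sigma>: "ds \<sigma> s = dbvp_sol f s" if "s \<in> {-1<..<1}" for s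
    using that by (auto simp: ds_def has_real_derivative_iff_has_vector_derivative intro!: vector_derivative_at)
  have \<sigma>d2: "(ds \<sigma> has_real_derivative q s * \<sigma> s - f s) (at s)" if "s \<in> {-1<..<1}" for s
    by (rule has_field_derivative_transform_within_open[of "dbvp_sol f" _ _ "{-1<..<1}"])
      (use that dbvp_sol_deriv[OF f that] ds\<sigma> in \<open>auto simp: \<sigma>_def\<close>)
  have sol: "solves_sigma \<gamma> u v \<sigma>"
    unfolding solves_sigma_def
  proof (intro conjI ballI)
    show "continuous_on {-1..1} \<sigma>"
      by (rule continuous_on_eq[OF bvp_sol_cont[OF f]]) (simp add: \<sigma>_def)
    show "\<sigma> (-1) = 0" "\<sigma> 1 = 0" by (simp_all add: \<sigma>_def bvp_sol_left[OF f] bvp_sol_right[OF f])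
    fix s :: real assume s: "s \<in> {-1<..<1}"
    show "\<sigma> differentiable at s" "ds \<sigma> differentiable at s"
      using \<sigma>d[OF s] \<sigma>d2[OF s] by (auto simp: real_differentiable_def)
    have "(ds ^^ 2) \<sigma> s = q s * \<sigma> s - f s"
      using \<sigma>d2[OF s] by (auto simp: eval_nat_numeral ds_def[of "ds \<sigma>"] has_real_derivative_iff_has_vector_derivative intro!: vector_derivative_at)
    then show "(ds ^^ 2) \<sigma> s - q s * \<sigma> s = - (ds u s \<bullet> ds v s)" by (simp add: f_def)
  qed
  have uniq: "\<tau> = \<sigma>" if \<tau>: "solves_sigma \<gamma> u v \<tau>" "\<forall>s. s \<notin> {-1..1} \<longrightarrow> \<tau> s = 0" for \<tau>
  proof
    fix s
    show "\<tau> s = \<sigma> s"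
    proof (cases "s \<in> {-1..1}")
      case True
      have d: "(\<tau> has_real_derivative ds \<tau> x) (at x)" "(ds \<tau> has_real_derivative q x * \<tau> x - f x) (at x)"
        if x: "x \<in> {-1<..<1}" for x
      proof -
        have *: "\<tau> differentiable (at x)" "ds \<tau> differentiable (at x)" "(ds ^^ 2) \<tau> x = q x * \<tau> x - f x"
          using \<tau>(1) x unfolding solves_sigma_def by (auto simp: f_def algebra_simps)
        show "(\<tau> has_real_derivative ds \<tau> x) (at x)"
          using *(1) by (simp add: ds_def has_real_derivative_iff_has_vector_derivative vector_derivative_works)
        have "(ds \<tau> has_vector_derivative ds (ds \<tau>) x) (at x)"
          using *(2) by (simp add: ds_def[of "ds \<tau>"] vector_derivative_works)
        then show "(ds \<tau> has_real_derivative q x * \<tau> x - f x) (at x)"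
          using *(3) by (simp add: has_real_derivative_iff_has_vector_derivative eval_nat_numeral)
      qed
      have "\<tau> s = bvp_sol f s"
        using \<tau>(1) by (intro bvp_sol_unique[OF f, where ?g1.0="ds \<tau>"] d True) (auto simp: solves_sigma_def)
      then show ?thesis using True by (simp add: \<sigma>_def)
    next
      case False
      then show ?thesis using \<tau>(2) unfolding \<sigma>_def by presburger
    qed
  qed
  have "sigma \<gamma> u v = \<sigma>"
    unfolding sigma_def
  proof (rule the_equality)
    show "solves_sigma \<gamma> u v \<sigma> \<and> (\<forall>s. s \<notin> {-1..1} \<longrightarrow> \<sigma> s = 0)"
      using sol by (intro conjI allI impI) (simp_all only: \<sigma>_def if_False)
  qed (use uniq in blast)
  then show "sigma \<gamma> u v s = bvp_sol f s"
    and "s \<in> {-1<..<1} \<Longrightarrow> (sigma \<gamma> u v has_real_derivative dbvp_sol f s) (at s)"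
    using s \<sigma>d by (auto simp: \<sigma>_def)
qed

lemma second_ff_eq:
  assumes u: "odd_H1 u" and v: "odd_H1 v" and s: "s \<in> {-1<..<1}"
  defines "f \<equiv> \<lambda>s. ds u s \<bullet> ds v s"
  shows "second_ff \<gamma> u v s = dbvp_sol f s *\<^sub>R ds \<gamma> s + bvp_sol f s *\<^sub>R (ds ^^ 2) \<gamma> s"
proof -
  have "((\<lambda>s. sigma \<gamma> u v s *\<^sub>R ds \<gamma> s) has_vector_derivative
     sigma \<gamma> u v s *\<^sub>R (ds ^^ 2) \<gamma> s + dbvp_sol f s *\<^sub>R ds \<gamma> s) (at s)"
    unfolding f_def
    by (rule has_vector_derivative_scaleR) (use sigma_eq(2)[OF u v _ s] ds_\<gamma>_deriv[OF s] s in auto)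
  then show ?thesis
    using sigma_eq(1)[OF u v, of s] s unfolding second_ff_def ds_def[of "\<lambda>s. sigma \<gamma> u v s *\<^sub>R ds \<gamma> s"]
    by (simp add: vector_derivative_at f_def add.commute)
qed

lemma weak_metric_second_ff:
  assumes u: "odd_H1 u" and v: "odd_H1 v" and w: "odd_H1 w" and z: "odd_H1 z"
  shows "weak_metric (second_ff \<gamma> u v) (second_ff \<gamma> w z)
    = integral {-1..1} (\<lambda>s. bvp_sol (\<lambda>s. ds u s \<bullet> ds v s) s * (ds w s \<bullet> ds z s))"
proof -
  define f g where "f = (\<lambda>s. ds u s \<bullet> ds v s)" and "g = (\<lambda>s. ds w s \<bullet> ds z s)"
  note f = ds_inner_int[OF u v, folded f_def] ds_inner_cont[OF u v, folded f_def]
  note g = ds_inner_int[OF w z, folded g_def] ds_inner_cont[OF w z, folded g_def]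
  let ?E = "\<lambda>s. dbvp_sol f s * dbvp_sol g s + q s * bvp_sol f s * bvp_sol g s"
  have "(LINT s:{-1..1}|lborel. second_ff \<gamma> u v s \<bullet> second_ff \<gamma> w z s) = integral {-1..1} ?E"
  proof (rule LINT_cong_interior)
    show "second_ff \<gamma> u v s \<bullet> second_ff \<gamma> w z s = ?E s" if s: "s \<in> {-1<..<1}" for s
      using second_ff_eq[OF u v s] second_ff_eq[OF w z s] norm_ds_\<gamma>[OF s] ds_\<gamma>_orthogonal[OF s]
      by (simp add: f_def[symmetric] g_def[symmetric] inner_add_left inner_add_right inner_commute dot_square_norm)
    show "continuous_on {-1<..<1} ?E"
      by (intro continuous_intros q_cont continuous_on_subset[OF bvp_sol_cont[OF f]] continuous_on_subset[OF bvp_sol_cont[OF g]]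
          continuous_on_subset[OF dbvp_sol_cont[OF f]] continuous_on_subset[OF dbvp_sol_cont[OF g]]) auto
    have "(\<lambda>s. q s * (bvp_sol f s * bvp_sol g s)) absolutely_integrable_on {-1..1}"
      by (intro q_mult_int continuous_intros bvp_sol_cont f g)
    moreover have "(\<lambda>s. dbvp_sol f s * dbvp_sol g s) absolutely_integrable_on {-1..1}"
      by (intro absolutely_integrable_continuous_real continuous_intros dbvp_sol_cont f g)
    ultimately show "?E absolutely_integrable_on {-1..1}"
      using set_integral_add(1) by (fastforce simp: mult.assoc)
  qed
  also have "\<dots> = integral {-1..1} (\<lambda>s. bvp_sol f s * g s)"
    by (rule integral_unique[OF energy_identity[OF f g]])
  finally show ?thesis by (simp add: weak_metric_def f_def g_def)
qed

end

lemma double_integral_gram: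
  fixes u v :: "real \<Rightarrow> real ^ 'n"
  assumes u: "odd_H1 u" and v: "odd_H1 v"
  shows "(LINT x:{-1..1}|lborel. (LINT s:{-1..1}|lborel.
      (norm (u s))\<^sup>2 * (norm (v x))\<^sup>2 - (u x \<bullet> v x) * (u s \<bullet> v s)))
    = weak_metric u u * weak_metric v v - (weak_metric u v)\<^sup>2"
proof -
  have "(LINT s:{-1..1}|lborel. (norm (u s))\<^sup>2 * (norm (v x))\<^sup>2 - (u x \<bullet> v x) * (u s \<bullet> v s))
    = weak_metric u u * (v x \<bullet> v x) - (u x \<bullet> v x) * weak_metric u v" for x
    unfolding power2_norm_eq_inner weak_metric_def
    by (subst set_integral_diff(2)) (auto intro!: set_integrable_mult_left set_integrable_mult_right odd_H1_inner_int u v)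
  then have "(LINT x:{-1..1}|lborel. (LINT s:{-1..1}|lborel.
      (norm (u s))\<^sup>2 * (norm (v x))\<^sup>2 - (u x \<bullet> v x) * (u s \<bullet> v s)))
    = (LINT x:{-1..1}|lborel. weak_metric u u * (v x \<bullet> v x) - (u x \<bullet> v x) * weak_metric u v)"
    by simp
  also have "\<dots> = weak_metric u u * weak_metric v v - weak_metric u v * weak_metric u v"
    by (subst set_integral_diff(2))
      (auto intro!: set_integrable_mult_left set_integrable_mult_right odd_H1_inner_int u v simp: weak_metric_def)
  finally show ?thesis by (simp add: power2_eq_square)
qed

context arc_length_curve
begin

lemma test_integrand:
  assumes t: "test_function \<phi>" and g: "continuous_on {-1..1} g"
  shows "continuous_on {-1<..<1} (\<lambda>s. g s * Lq \<phi> s)"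
    and "(\<lambda>s. g s * Lq \<phi> s) absolutely_integrable_on {-1..1}"
proof -
  have g': "continuous_on {-1..1} (\<lambda>s. - g s)" by (intro continuous_intros g)
  have eq: "- g s * - Lq \<phi> s = g s * Lq \<phi> s" for s
    by (simp only: minus_mult_minus)
  show "continuous_on {-1<..<1} (\<lambda>s. g s * Lq \<phi> s)"
    using mult_f_cont[OF test_rhs[OF t] g'] unfolding eq .
  show "(\<lambda>s. g s * Lq \<phi> s) absolutely_integrable_on {-1..1}"
    using absolutely_integrable_mult_continuous[OF test_rhs(1)[OF t] g'] unfolding eq .
qed

lemma green_function_green: "green_function \<gamma> green"
  unfolding green_function_def
proof (intro ballI conjI allI impI)
  fix x :: real assume x: "x \<in> {-1<..<1}"
  then have x': "x \<in> {-1..1}" by auto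
  show c: "continuous_on {-1..1} (\<lambda>s. green s x)" by (rule green_cont1[OF x'])
  show "green (-1) x = 0" "green 1 x = 0" by (rule green_left[OF x'], rule green_right[OF x'])
  fix \<phi> assume t: "test_function \<phi>"
  show "(LINT s:{-1..1}|lborel. green s x * Lq \<phi> s) = - \<phi> x"
    using LINT_eq_integral[OF test_integrand[OF t c]] green_distributional[OF t x] by simp
qed

lemma green_function_unique:
  assumes G: "green_function \<gamma> G" and x: "x \<in> {-1<..<1}" and s: "s \<in> {-1..1}"
  shows "G s x = green s x"
proof (rule green_unique[OF _ _ _ x _ s])
  show c: "continuous_on {-1..1} (\<lambda>s. G s x)" and "G (-1) x = 0" "G 1 x = 0"
    using G x by (auto simp: green_function_def)
  fix \<phi> assume t: "test_function \<phi>"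
  then have "(LINT s:{-1..1}|lborel. G s x * Lq \<phi> s) = - \<phi> x"
    using G x by (auto simp: green_function_def)
  then show "integral {-1..1} (\<lambda>s. G s x * Lq \<phi> s) = - \<phi> x"
    using LINT_eq_integral[OF test_integrand[OF t c]] by simp
qed

lemma sec_curv_eq:
  assumes u: "odd_H1 u" and v: "odd_H1 v"
  shows "sec_curv \<gamma> u v =
    (integral {-1..1} (\<lambda>s. bvp_sol (\<lambda>s. ds u s \<bullet> ds u s) s * (ds v s \<bullet> ds v s))
      - integral {-1..1} (\<lambda>s. bvp_sol (\<lambda>s. ds u s \<bullet> ds v s) s * (ds u s \<bullet> ds v s)))
    / (weak_metric u u * weak_metric v v - (weak_metric u v)\<^sup>2)"
  unfolding sec_curv_def by (simp add: weak_metric_second_ff u v)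

lemma double_integral_green:
  assumes u: "odd_H1 u" and v: "odd_H1 v" and G: "green_function \<gamma> G"
  shows "(LINT x:{-1..1}|lborel. (LINT s:{-1..1}|lborel.
      G s x * ((norm (ds u s))\<^sup>2 * (norm (ds v x))\<^sup>2 - (ds u x \<bullet> ds v x) * (ds u s \<bullet> ds v s))))
    = integral {-1..1} (\<lambda>s. bvp_sol (\<lambda>s. ds u s \<bullet> ds u s) s * (ds v s \<bullet> ds v s))
      - integral {-1..1} (\<lambda>s. bvp_sol (\<lambda>s. ds u s \<bullet> ds v s) s * (ds u s \<bullet> ds v s))"
proof -
  define A B C where "A = (\<lambda>s. ds u s \<bullet> ds u s)" and "B = (\<lambda>s. ds v s \<bullet> ds v s)" and "C = (\<lambda>s. ds u s \<bullet> ds v s)"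
  note A = ds_inner_int[OF u u, folded A_def] ds_inner_cont[OF u u, folded A_def]
  note B = ds_inner_int[OF v v, folded B_def] ds_inner_cont[OF v v, folded B_def]
  note C = ds_inner_int[OF u v, folded C_def] ds_inner_cont[OF u v, folded C_def]
  have inner: "(LINT s:{-1..1}|lborel. G s x * (A s * B x - C x * C s)) = bvp_sol A x * B x - bvp_sol C x * C x"
    if x: "x \<in> {-1<..<1}" for x
  proof -
    have x': "x \<in> {-1..1}" using x by auto
    have c: "continuous_on {-1..1} (green x)"
      using green_cont1[OF x'] green_sym[of x] by (simp add: eta_contract_eq)
    have M: "(\<lambda>s. A s * B x - C x * C s) absolutely_integrable_on {-1..1}" "continuous_on {-1<..<1} (\<lambda>s. A s * B x - C x * C s)"
      by (intro set_integral_diff(1) set_integrable_mult_left set_integrable_mult_right A C)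
        (intro continuous_intros A C)
    have "(LINT s:{-1..1}|lborel. G s x * (A s * B x - C x * C s)) = integral {-1..1} (\<lambda>s. green x s * (A s * B x - C x * C s))"
    proof (rule LINT_cong_interior)
      show "G s x * (A s * B x - C x * C s) = green x s * (A s * B x - C x * C s)" if "s \<in> {-1<..<1}" for s
        using green_function_unique[OF G x, of s] green_sym[of x s] that by simp
    qed (rule mult_f_cont[OF M c], rule absolutely_integrable_mult_continuous[OF M(1) c])
    also have "\<dots> = integral {-1..1} (\<lambda>s. green x s * A s) * B x - C x * integral {-1..1} (\<lambda>s. green x s * C s)"
      (is "_ = ?r")
    proof (rule integral_unique)
      have "((\<lambda>s. (green x s * A s) * B x - C x * (green x s * C s)) has_integral
        ?r) {-1..1}"
        by (intro has_integral_diff has_integral_mult_left has_integral_mult_right integrable_integral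
            mult_f_int[OF A c] mult_f_int[OF C c])
      then show "((\<lambda>s. green x s * (A s * B x - C x * C s)) has_integral
        ?r) {-1..1}"
        by (simp add: algebra_simps)
    qed
    finally show ?thesis
      by (simp add: bvp_sol_eq_integral[OF A x'] bvp_sol_eq_integral[OF C x'])
  qed
  have "(LINT x:{-1..1}|lborel. (LINT s:{-1..1}|lborel. G s x * (A s * B x - C x * C s)))
    = integral {-1..1} (\<lambda>x. bvp_sol A x * B x - bvp_sol C x * C x)"
  \<comment> \<open>\<open>green_function\<close> constrains \<open>G\<close> only for sources in
    the open interval; the sources 1 and -1 form a null set.\<close>
  proof (rule LINT_cong_interior[OF inner])
    show "continuous_on {-1<..<1} (\<lambda>x. bvp_sol A x * B x - bvp_sol C x * C x)"
      by (intro continuous_intros mult_f_cont[OF B] mult_f_cont[OF C] bvp_sol_cont A C)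
    show "(\<lambda>x. bvp_sol A x * B x - bvp_sol C x * C x) absolutely_integrable_on {-1..1}"
      by (intro set_integral_diff(1) absolutely_integrable_mult_continuous bvp_sol_cont A B C)
  qed
  also have "\<dots> = integral {-1..1} (\<lambda>x. bvp_sol A x * B x) - integral {-1..1} (\<lambda>x. bvp_sol C x * C x)"
    by (intro Henstock_Kurzweil_Integration.integral_diff mult_f_int[OF B] mult_f_int[OF C] bvp_sol_cont A C)
  finally show ?thesis
    by (simp add: A_def B_def C_def power2_norm_eq_inner)
qed

text \<open>The Dirichlet determinant is kept in the bound because it serves twice: the spectral gap
  turns it into the uniform bound, and narrow pulses make it large relative to the Gram
  determinant.\<close>

lemma sec_curv_ge:
  assumes u: "odd_H1 u" and v: "odd_H1 v" and ind: "lin_indep2 u v"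
  shows "exp (- varrho \<gamma>) / 4 * (dirichlet u u * dirichlet v v - (dirichlet u v)\<^sup>2)
      / (weak_metric u u * weak_metric v v - (weak_metric u v)\<^sup>2) \<le> sec_curv \<gamma> u v"
  unfolding sec_curv_eq[OF u v]
proof (rule divide_right_mono)
  show "0 \<le> weak_metric u u * weak_metric v v - (weak_metric u v)\<^sup>2"
    using gram_det_pos[OF u v ind] by simp
  show "exp (- varrho \<gamma>) / 4 * (dirichlet u u * dirichlet v v - (dirichlet u v)\<^sup>2)
    \<le> integral {-1..1} (\<lambda>s. bvp_sol (\<lambda>s. ds u s \<bullet> ds u s) s * (ds v s \<bullet> ds v s))
      - integral {-1..1} (\<lambda>s. bvp_sol (\<lambda>s. ds u s \<bullet> ds v s) s * (ds u s \<bullet> ds v s))"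
    unfolding varrho_eq dirichlet_def
    by (rule curvature_numerator_lower)
      (auto intro!: ds_inner_int ds_inner_cont ds_inner_even u v Cauchy_Schwarz_ineq simp del: greaterThanLessThan_iff)
qed

lemma sec_curv_lower_bound:
  assumes u: "odd_H1 u" and v: "odd_H1 v" and ind: "lin_indep2 u v"
  shows "exp (- varrho \<gamma>) \<le> sec_curv \<gamma> u v"
proof -
  let ?D = "weak_metric u u * weak_metric v v - (weak_metric u v)\<^sup>2"
  have D: "0 < ?D" by (rule gram_det_pos[OF u v ind])
  have "exp (- varrho \<gamma>) = exp (- varrho \<gamma>) / 4 * (4 * ?D) / ?D" using D by simp
  also have "\<dots> \<le> exp (- varrho \<gamma>) / 4 * (dirichlet u u * dirichlet v v - (dirichlet u v)\<^sup>2) / ?D"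
    using D by (intro divide_right_mono mult_left_mono gram_le_dirichlet_det u v) auto
  also have "\<dots> \<le> sec_curv \<gamma> u v" by (rule sec_curv_ge[OF u v ind])
  finally show ?thesis .
qed

end

section \<open>Unboundedness\<close>

lemma Ck_imp_locally_AC:
  fixes f :: "real \<Rightarrow> 'a::euclidean_space"
  assumes f: "Ck {-1<..<1} (Suc 0) f"
  shows "locally_AC f"
  unfolding locally_AC_def
proof (intro allI impI)
  fix a b :: real assume ab: "-1 < a \<and> a \<le> b \<and> b < 1"
  have c: "continuous_on {a..b} (ds f)"
    using Ck_ds(1)[OF _ f] ab by (auto intro: continuous_on_subset)
  have i: "set_integrable lborel {a..b} (ds f)"
    using borel_integrable_atLeastAtMost'[OF c] .
  have "(ds f has_integral (f b - f a)) {a..b}"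
    using ab Ck_ds(2)[OF _ f]
    by (intro fundamental_theorem_of_calculus) (auto intro: has_vector_derivative_at_within)
  then show "set_integrable lborel {a..b} (ds f) \<and> (LINT s:{a..b}|lborel. ds f s) = f b - f a"
    using i set_borel_integral_eq_integral(2)[OF i] by (auto dest: integral_unique)
qed

lemma funpow_ds_zero:
  assumes U: "open U" and z: "\<And>x. x \<in> U \<Longrightarrow> f x = 0" and x: "x \<in> U"
  shows "(ds ^^ n) f x = 0"
  using x
proof (induction n arbitrary: x)
  case (Suc n)
  have "((ds ^^ n) f has_vector_derivative 0) (at x)"
    by (rule has_vector_derivative_transform_within_open[OF has_vector_derivative_const[of 0] U Suc.prems])
      (simp add: Suc.IH)
  then show ?case by (simp add: ds_def[of "(ds ^^ n) f"] vector_derivative_at)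
qed (use z in auto)

lemma nn_integral_bounded_finite:
  fixes f :: "real \<Rightarrow> 'a::real_normed_vector"
  assumes M: "\<And>s. s \<in> {-1..1} \<Longrightarrow> norm (f s) \<le> M"
  shows "(\<integral>\<^sup>+s\<in>{-1..1}. ennreal ((1 - s\<^sup>2) ^ j * (norm (f s))\<^sup>2) \<partial>lborel) < \<infinity>"
proof -
  have "(\<integral>\<^sup>+s\<in>{-1..1}. ennreal ((1 - s\<^sup>2) ^ j * (norm (f s))\<^sup>2) \<partial>lborel)
    \<le> (\<integral>\<^sup>+s\<in>{-1..1::real}. ennreal (M\<^sup>2) \<partial>lborel)"
  proof (rule nn_integral_mono)
    fix s :: real
    show "ennreal ((1 - s\<^sup>2) ^ j * (norm (f s))\<^sup>2) * indicator {-1..1} s \<le> ennreal (M\<^sup>2) * indicator {-1..1} s"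
    proof (cases "s \<in> {-1..1}")
      case True
      then have "s\<^sup>2 \<le> 1" by (auto simp: abs_square_le_1)
      then have "(1 - s\<^sup>2) ^ j * (norm (f s))\<^sup>2 \<le> 1 * M\<^sup>2"
        using M[OF True] by (intro mult_mono power_le_one power_mono) auto
      then show ?thesis using True by (simp add: ennreal_leI)
    qed simp
  qed
  also have "\<dots> < \<infinity>" by (simp add: nn_integral_cmult_indicator ennreal_mult_less_top)
  finally show ?thesis .
qed

text \<open>Mirrored bumps at \<open>c\<close> and \<open>- c\<close>: the derivative of an odd
  field has to be even.\<close>

definition pulse :: "real \<Rightarrow> real \<Rightarrow> real \<Rightarrow> real" where
  "pulse c \<epsilon> s = bump ((s - c) / \<epsilon>) + bump ((- s - c) / \<epsilon>)"

lemma pulse_even: "pulse c \<epsilon> (- s) = pulse c \<epsilon> s"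
  by (simp add: pulse_def)

lemma pulse_nonneg: "0 \<le> pulse c \<epsilon> s" and pulse_le_2: "pulse c \<epsilon> s \<le> 2"
  using bump_nonneg[of "(s - c) / \<epsilon>"] bump_nonneg[of "(- s - c) / \<epsilon>"] bump_le_1[of "(s - c) / \<epsilon>"] bump_le_1[of "(- s - c) / \<epsilon>"]
  by (auto simp: pulse_def)

lemma pulse_zero:
  assumes "0 < \<epsilon>" "\<epsilon> \<le> c" "\<epsilon> \<le> \<bar>\<bar>s\<bar> - c\<bar>"
  shows "pulse c \<epsilon> s = 0"
proof -
  have "1 \<le> \<bar>(s - c) / \<epsilon>\<bar>" "1 \<le> \<bar>(- s - c) / \<epsilon>\<bar>"
    using assms by (auto simp: abs_divide field_simps)
  then show ?thesis by (simp add: pulse_def bump_zero)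
qed

lemma Ck_pulse: "Ck S n (pulse c \<epsilon>)"
proof -
  have "Ck S n (\<lambda>s. bump (1 / \<epsilon> * s + - c / \<epsilon>) + bump (- 1 / \<epsilon> * s + - c / \<epsilon>))"
    by (intro Ck_add Ck_affine[OF Ck_bump[of UNIV]]) auto
  moreover have "(\<lambda>s. bump (1 / \<epsilon> * s + - c / \<epsilon>) + bump (- 1 / \<epsilon> * s + - c / \<epsilon>)) = pulse c \<epsilon>"
    by (simp add: pulse_def[abs_def] diff_divide_distrib)
  ultimately show ?thesis by simp
qed

lemma bump_lower: obtains \<beta> where "0 < \<beta>" "\<And>x. \<bar>x\<bar> \<le> 1/2 \<Longrightarrow> \<beta> \<le> bump x"
proof -
  obtain x where x: "x \<in> {-1/2..1/2}" "\<And>y. y \<in> {-1/2..1/2} \<Longrightarrow> bump x \<le> bump y"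
    using continuous_attains_inf[of "{-1/2..1/2}" bump] Ck_continuous[OF Ck_bump] by auto
  show thesis
  proof
    show "0 < bump x" using x(1) by (intro bump_pos) auto
    show "bump x \<le> bump y" if "\<bar>y\<bar> \<le> 1/2" for y
      using that by (intro x(2)) (auto simp: abs_le_iff)
  qed
qed

section \<open>Tangent fields with derivative concentrated in narrow pulses\<close>

context arc_length_curve
begin

text \<open>The orthogonal projection of the constant vector \<open>e\<close> along the unit
  tangent. Any field whose derivative is a scalar multiple of it meets the tangency
  condition.\<close>

definition normal_field :: "real ^ 'n \<Rightarrow> real \<Rightarrow> real ^ 'n" where
  "normal_field e s = e - (e \<bullet> ds \<gamma> s) *\<^sub>R ds \<gamma> s"

lemma Ck_normal_field: "Ck {-1<..<1} m (normal_field e)"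
proof -
  have "Ck {-1<..<1} m (ds \<gamma>)" using Kspace_Ck[OF \<gamma>_K, of m 1] by simp
  then have "Ck {-1<..<1} m (\<lambda>s. e + (-1 * (e \<bullet> ds \<gamma> s)) *\<^sub>R ds \<gamma> s)"
    by (intro Ck_add Ck_scaleR Ck_mult Ck_inner Ck_const)
  moreover have "(\<lambda>s. e + (-1 * (e \<bullet> ds \<gamma> s)) *\<^sub>R ds \<gamma> s) = normal_field e"
    by (simp add: normal_field_def[abs_def])
  ultimately show ?thesis by simp
qed

lemma normal_field_orthogonal: "s \<in> {-1<..<1} \<Longrightarrow> normal_field e s \<bullet> ds \<gamma> s = 0"
  using norm_ds_\<gamma>[of s] by (simp add: normal_field_def inner_diff_left dot_square_norm)

lemma norm_normal_field_le:
  assumes "s \<in> {-1<..<1}" "norm e = 1" shows "norm (normal_field e s) \<le> 1"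
proof -
  have "(norm (normal_field e s))\<^sup>2 = 1 - (e \<bullet> ds \<gamma> s)\<^sup>2"
  proof -
    have "ds \<gamma> s \<bullet> ds \<gamma> s = 1" "e \<bullet> e = 1"
      using norm_ds_\<gamma>[OF assms(1)] assms(2) by (simp_all add: dot_square_norm)
    then show ?thesis
      by (simp add: normal_field_def power2_norm_eq_inner inner_diff_left inner_diff_right inner_commute)
        (simp add: power2_eq_square inner_commute)
  qed
  then have "(norm (normal_field e s))\<^sup>2 \<le> 1\<^sup>2" by simp
  then show ?thesis by (rule power2_le_imp_le) simp
qed

lemma normal_field_even: "s \<in> {-1<..<1} \<Longrightarrow> normal_field e (- s) = normal_field e s"
  using ds_\<gamma>_even[of s] by (simp add: normal_field_def)

text \<open>\<open>u\<close> is the primitive of the pulsed normal field that vanishes at 0;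
  evenness of the derivative makes it odd. On [0,1] the derivative has norm at most 2 and lives on
  an interval of length \<open>2 * \<epsilon>\<close>, whence the bound
  \<open>4 * \<epsilon>\<close>.\<close>

lemma pulse_tangent_exists:
  assumes e: "norm e = 1" and \<epsilon>: "0 < \<epsilon>" "\<epsilon> < c" "c + \<epsilon> < 1"
  obtains u where "u \<in> tangent m \<gamma>" "\<And>s. ds u s = pulse c \<epsilon> s *\<^sub>R normal_field e s"
    "\<And>s. s \<in> {-1..1} \<Longrightarrow> norm (u s) \<le> 4 * \<epsilon>"
proof -
  define W where "W = (\<lambda>s. pulse c \<epsilon> s *\<^sub>R normal_field e s)"
  \<comment> \<open>\<open>W\<close> vanishes off {-d..d}, a compact part of (-1,1). Continuity
    bounds the derivatives of \<open>W\<close> there, although those of \<gamma> may be unbounded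
    near the ends; so all weighted norms of \<open>u\<close> are finite.\<close>
  define d where "d = c + \<epsilon>"
  have d: "0 < d" "d < 1" using \<epsilon> by (auto simp: d_def)
  have Wz: "W s = 0" if "\<epsilon> \<le> \<bar>\<bar>s\<bar> - c\<bar>" for s
    using pulse_zero[of \<epsilon> c s] \<epsilon> that by (simp add: W_def)
  have CkW: "Ck {-1<..<1} m W"
    unfolding W_def by (intro Ck_scaleR Ck_pulse Ck_normal_field)
  have Wz': "W s = 0" if "s \<in> - {-d..d}" for s
    using that by (intro Wz) (auto simp: d_def)
  have oU: "open (- {-d..d})" by auto
  have "continuous_on (- {-d..d}) W"
    by (rule continuous_on_eq[OF continuous_on_const]) (rule Wz'[symmetric])
  then have "continuous_on ({-1<..<1} \<union> - {-d..d}) W"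
    using Ck_continuous[OF CkW] by (intro continuous_on_open_Un oU) auto
  moreover have "{-1<..<1} \<union> - {-d..d} = UNIV" using d by auto
  ultimately have cW: "continuous_on UNIV W" by simp
  obtain u where u: "u 0 = 0" "\<And>x. (u has_vector_derivative W x) (at x)"
    by (rule continuous_antiderivative_exists[OF cW]) auto
  have dsu: "ds u = W" using u(2) by (auto simp: ds_def intro!: vector_derivative_at)
  have even: "W (- s) = W s" for s
  proof (cases "s \<in> {-1<..<1}")
    case True
    then show ?thesis by (simp add: W_def pulse_even normal_field_even)
  next
    case False
    then have "s \<in> - {-d..d}" "- s \<in> - {-d..d}" using d by auto
    then show ?thesis using Wz' by metis
  qed
  have odd: "u (- s) = - u s" for s
  proof -
    have "((\<lambda>s. u s + u (- s)) has_vector_derivative 0) (at x within UNIV)" for x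
    proof -
      have "((\<lambda>s. - s) has_vector_derivative -1) (at x)"
        by (auto intro!: derivative_eq_intros)
      from has_vector_derivative_add[OF u(2) vector_diff_chain_at[OF this u(2)]]
      show ?thesis by (simp add: o_def even)
    qed
    then obtain k where "\<And>x. u x + u (- x) = k"
      using has_vector_derivative_zero_constant[of UNIV "\<lambda>s. u s + u (- s)"] by auto
    from this[of s] this[of 0] u(1) show ?thesis by (simp add: eq_neg_iff_add_eq_0 add.commute)
  qed
  have cu: "continuous_on A u" for A
    using u(2) by (intro continuous_at_imp_continuous_on ballI has_vector_derivative_continuous) auto
  have Cku: "Ck {-1<..<1} (Suc m) u" using u(2) CkW by (intro Ck_SucI)
  have bounded: "\<exists>M. \<forall>s\<in>{-1..1}. norm ((ds ^^ j) u s) \<le> M" if j: "j \<le> m" for j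
  proof (cases j)
    case 0
    have "bounded (u ` {-1..1})" by (intro compact_imp_bounded compact_continuous_image cu) auto
    then show ?thesis unfolding 0 by (auto simp: bounded_iff)
  next
    case (Suc i)
    have c: "continuous_on {-d..d} ((ds ^^ i) W)"
      using Ck_continuous[OF Ck_funpow_ds[OF _ Ck_le[OF CkW, of "0 + i"]]] j Suc d
      by (auto intro: continuous_on_subset)
    then have "bounded ((ds ^^ i) W ` {-d..d})" by (intro compact_imp_bounded compact_continuous_image) auto
    then obtain M where M: "\<And>s. s \<in> {-d..d} \<Longrightarrow> norm ((ds ^^ i) W s) \<le> M" unfolding bounded_iff by blast
    have "norm ((ds ^^ i) W s) \<le> max M 0" for s
      using M[of s] funpow_ds_zero[OF oU Wz', where x=s and n=i] by (cases "s \<in> {-d..d}") auto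
    then show ?thesis unfolding Suc funpow_Suc_right o_def dsu by blast
  qed
  have "u \<in> Kspace m"
    unfolding Kspace_def
  proof (intro CollectI conjI allI impI ballI)
    show "set_borel_measurable lborel {-1..1} u" by (rule continuous_imp_set_borel_measurable[OF cu])
    show "u (- s) = - u s" for s by (rule odd)
    show "locally_AC ((ds ^^ k) u)" if "k < m" for k
      using that by (intro Ck_imp_locally_AC Ck_funpow_ds Ck_le[OF Cku]) auto
    show "wnorm2 j j u < \<infinity>" if j: "j \<le> m" for j
    proof -
      obtain M where "\<And>s. s \<in> {-1..1} \<Longrightarrow> norm ((ds ^^ j) u s) \<le> M" using bounded[OF j] by blast
      then show ?thesis unfolding wnorm2_def by (rule nn_integral_bounded_finite)
    qed
  qed
  then have "u \<in> tangent m \<gamma>"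
    by (simp add: tangent_def dsu W_def normal_field_orthogonal)
  moreover have "ds u s = pulse c \<epsilon> s *\<^sub>R normal_field e s" for s by (simp add: dsu W_def)
  moreover have "norm (u s) \<le> 4 * \<epsilon>" if "s \<in> {-1..1}" for s
  proof -
    have lip: "norm (u x - u y) \<le> B * norm (x - y)"
      if "x \<in> {a..b}" "y \<in> {a..b}" "\<And>t. t \<in> {a..b} \<Longrightarrow> norm (W t) \<le> B" for x y a b B
    proof (rule differentiable_bound[OF convex_real_interval(5)[of a b] _ _ that(1,2)])
      show "(u has_derivative (\<lambda>h. h *\<^sub>R W t)) (at t within {a..b})" for t
        using u(2)[of t] by (auto simp: has_vector_derivative_def intro: has_derivative_at_withinI)
      show "onorm (\<lambda>h. h *\<^sub>R W t) \<le> B" if "t \<in> {a..b}" for t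
        using \<open>\<And>t. t \<in> {a..b} \<Longrightarrow> norm (W t) \<le> B\<close>[OF that]
        by (simp add: onorm_scaleR_left[OF bounded_linear_ident] onorm_id)
    qed
    have pos: "norm (u s) \<le> 4 * \<epsilon>" if s: "0 \<le> s" "s \<le> 1" for s
    proof -
      have W2: "norm (W t) \<le> 2" if "t \<in> {-1<..<1}" for t
        using mult_mono[OF pulse_le_2 norm_normal_field_le[OF that e]] pulse_nonneg[of c \<epsilon> t] by (simp add: W_def)
      have "norm (u (c - \<epsilon>) - u 0) \<le> 0 * norm (c - \<epsilon> - 0)"
        using \<epsilon> by (intro lip[of _ 0 "c - \<epsilon>"]) (auto intro!: Wz)
      then have l0: "u (c - \<epsilon>) = 0" using u(1) by simp
      consider "s \<le> c - \<epsilon>" | "c - \<epsilon> \<le> s" "s \<le> c + \<epsilon>" | "c + \<epsilon> \<le> s" by linarith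
      then show ?thesis
      proof cases
        case 1
        have "norm (u s - u 0) \<le> 0 * norm (s - 0)"
          using s 1 \<epsilon> by (intro lip[of _ 0 "c - \<epsilon>"]) (auto intro!: Wz)
        then show ?thesis using u(1) \<epsilon> by simp
      next
        case 2
        have "norm (u s - u (c - \<epsilon>)) \<le> 2 * norm (s - (c - \<epsilon>))"
          using 2 \<epsilon> by (intro lip[of _ "c - \<epsilon>" "c + \<epsilon>"]) (auto intro!: W2)
        then show ?thesis using 2 l0 by simp
      next
        case 3
        have "norm (u (c + \<epsilon>) - u (c - \<epsilon>)) \<le> 2 * norm (c + \<epsilon> - (c - \<epsilon>))"
          using \<epsilon> by (intro lip[of _ "c - \<epsilon>" "c + \<epsilon>"]) (auto intro!: W2)
        moreover have "norm (u s - u (c + \<epsilon>)) \<le> 0 * norm (s - (c + \<epsilon>))"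
          using 3 s \<epsilon> by (intro lip[of _ "c + \<epsilon>" 1]) (auto intro!: Wz)
        ultimately show ?thesis using \<epsilon> l0 by simp
      qed
    qed
    show ?thesis
      using pos[of s] pos[of "- s"] odd[of s] that by (cases "0 \<le> s") auto
  qed
  ultimately show ?thesis by (rule that)
qed

lemma weak_metric_le_sup:
  assumes u: "odd_H1 u" and b: "\<And>s. s \<in> {-1..1} \<Longrightarrow> norm (u s) \<le> b"
  shows "weak_metric u u \<le> 2 * b\<^sup>2"
proof -
  have "((\<lambda>s. b\<^sup>2) has_integral 2 * b\<^sup>2) {-1..1::real}"
    using has_integral_const_real[of "b\<^sup>2" "-1" 1] by simp
  moreover have "u s \<bullet> u s \<le> b\<^sup>2" if "s \<in> {-1..1}" for s
    unfolding dot_square_norm using b[OF that] by (intro power_mono) auto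
  ultimately show ?thesis by (rule has_integral_le[OF weak_metric_has_integral[OF u u]])
qed

text \<open>The weight is at least 1 - (3/4)^2 = 7/16 on the interval, whose length is
  \<open>2 * \<epsilon>\<close>.\<close>

lemma dirichlet_lower:
  assumes u: "odd_H1 u" and \<epsilon>: "0 \<le> \<epsilon>" "0 \<le> c - \<epsilon>" "c + \<epsilon> \<le> 3/4"
    and b: "\<And>s. s \<in> {c - \<epsilon>..c + \<epsilon>} \<Longrightarrow> b \<le> (norm (ds u s))\<^sup>2" and b0: "0 \<le> b"
  shows "7 / 8 * b * \<epsilon> \<le> dirichlet u u"
proof -
  let ?f = "\<lambda>s. (1 - s\<^sup>2) * (ds u s \<bullet> ds u s)"
  have i: "?f integrable_on {-1..1}" using dirichlet_has_integral[OF u u] by (rule has_integral_integrable)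
  have "7 / 8 * b * \<epsilon> = integral {c - \<epsilon>..c + \<epsilon>} (\<lambda>s. 7 / 16 * b)" using \<epsilon> by simp
  also have "\<dots> \<le> integral {c - \<epsilon>..c + \<epsilon>} ?f"
  proof (rule integral_le)
    show "?f integrable_on {c - \<epsilon>..c + \<epsilon>}" using \<epsilon> by (intro integrable_on_subinterval[OF i]) auto
    show "7 / 16 * b \<le> ?f s" if s: "s \<in> {c - \<epsilon>..c + \<epsilon>}" for s
    proof -
      have "s\<^sup>2 \<le> (3/4)\<^sup>2" using s \<epsilon> by (intro power_mono) auto
      then have "7 / 16 \<le> 1 - s\<^sup>2" by (simp add: power2_eq_square)
      then show ?thesis
        using b[OF s] b0 by (intro mult_mono) (auto simp: power2_norm_eq_inner)
    qed
  qed auto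
  also have "\<dots> \<le> integral {-1..1} ?f"
  proof (rule integral_subset_le[OF _ _ i])
    show "{c - \<epsilon>..c + \<epsilon>} \<subseteq> {-1..1}" using \<epsilon> by auto
    then show "?f integrable_on {c - \<epsilon>..c + \<epsilon>}" by (rule integrable_on_subinterval[OF i])
    show "\<forall>s\<in>{-1..1}. 0 \<le> ?f s"
      by (intro ballI mult_nonneg_nonneg) (auto simp: abs_square_le_1)
  qed
  finally show ?thesis by (simp add: dirichlet_def)
qed

text \<open>A relation that holds almost everywhere holds everywhere inside by continuity and can be
  differentiated. At \<open>x\<close> only the derivative of \<open>u\<close> survives, at
  \<open>y\<close> only that of \<open>v\<close>.\<close>

lemma pulses_lin_indep:
  assumes u: "odd_H1 u" and v: "odd_H1 v"
    and x: "x \<in> {-1<..<1}" "ds u x \<noteq> 0" "ds v x = 0" and y: "y \<in> {-1<..<1}" "ds v y \<noteq> 0" "ds u y = 0"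
  shows "lin_indep2 u v"
  unfolding lin_indep2_def
proof (intro allI impI)
  fix a b assume ae: "AE s in lborel. s \<in> {-1..1} \<longrightarrow> a *\<^sub>R u s + b *\<^sub>R v s = 0"
  let ?f = "\<lambda>s. a *\<^sub>R u s + b *\<^sub>R v s"
  have d: "(?f has_vector_derivative (a *\<^sub>R ds u s + b *\<^sub>R ds v s)) (at s)" if "s \<in> {-1<..<1}" for s
    using u v that unfolding odd_H1_def
    by (intro has_vector_derivative_add bounded_linear.has_vector_derivative[OF bounded_linear_scaleR_right]) auto
  have c: "continuous_on {-1<..<1} ?f"
    using has_vector_derivative_continuous[OF d] by (intro continuous_at_imp_continuous_on) auto
  have z: "?f s = 0" if "s \<in> {-1<..<1}" for s
  proof -
    have "AE s in lborel. s \<in> {-1<..<1} \<longrightarrow> norm (?f s) = 0"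
      using ae by eventually_elim auto
    from continuous_AE_imp_eq[OF continuous_on_norm[OF c] continuous_on_const this that] show ?thesis by simp
  qed
  have "a *\<^sub>R ds u s + b *\<^sub>R ds v s = 0" if "s \<in> {-1<..<1}" for s
  proof -
    have "(?f has_vector_derivative 0) (at s)"
      by (rule has_vector_derivative_transform_within_open[OF has_vector_derivative_const _ that]) (simp_all add: z)
    from vector_derivative_unique_at[OF d[OF that] this] show ?thesis .
  qed
  from this[OF x(1)] this[OF y(1)] x y show "a = 0 \<and> b = 0" by simp
qed

text \<open>For a pulse of width \<open>\<epsilon>\<close> the Dirichlet form is of order \<open>\<epsilon>\<close> and the \<open>L\<^sup>2\<close> form of order \<open>\<epsilon>\<^sup>2\<close>.\<close>

lemma sec_curv_unbounded:
  assumes n: "CARD('n) \<ge> 2"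
  shows "\<exists>u\<in>tangent m \<gamma>. \<exists>v\<in>tangent m \<gamma>. lin_indep2 u v \<and> sec_curv \<gamma> u v > C"
proof -
  \<comment> \<open>Dimension at least 2 provides a unit normal at 1/2. There the normal field
    equals \<open>e\<close>, so by continuity its squared norm exceeds 1/2 nearby.\<close>
  obtain e where e: "norm e = 1" "e \<bullet> ds \<gamma> (1/2) = 0"
  proof -
    have "2 \<le> DIM(real ^ 'n)" using n by simp
    then obtain y where y: "y \<noteq> 0" "orthogonal (ds \<gamma> (1/2)) y"
      by (rule orthogonal_to_vector_exists)
    show thesis
      by (rule that[of "(1 / norm y) *\<^sub>R y"]) (use y in \<open>auto simp: orthogonal_def inner_commute\<close>)
  qed
  have "continuous_on {-1<..<1} (normal_field e)" by (rule Ck_continuous[OF Ck_normal_field])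
  then have "isCont (normal_field e) (1/2)"
    by (simp add: continuous_on_eq_continuous_at)
  then have "isCont (\<lambda>s. (norm (normal_field e s))\<^sup>2) (1/2)" by (intro continuous_intros)
  moreover have "(norm (normal_field e (1/2)))\<^sup>2 = 1" by (simp add: normal_field_def e)
  ultimately obtain \<delta>0 where \<delta>0: "0 < \<delta>0" "\<And>s. dist s (1/2) < \<delta>0 \<Longrightarrow> dist ((norm (normal_field e s))\<^sup>2) 1 < 1/2"
    unfolding continuous_at_eps_delta by (metis half_gt_zero_iff zero_less_one)
  define \<delta> where "\<delta> = min \<delta>0 (1/4) / 2"
  have \<delta>: "0 < \<delta>" "2 * \<delta> \<le> 1/4" using \<delta>0 by (auto simp: \<delta>_def)
  have \<delta>3: "1/2 < (norm (normal_field e s))\<^sup>2" if "\<bar>s - 1/2\<bar> < 2 * \<delta>" for s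
  proof -
    have "dist s (1/2) < \<delta>0" using that by (auto simp: \<delta>_def dist_real_def)
    from \<delta>0(2)[OF this] show ?thesis unfolding dist_real_def by linarith
  qed
  obtain \<beta> where \<beta>: "0 < \<beta>" "\<And>x. \<bar>x\<bar> \<le> 1/2 \<Longrightarrow> \<beta> \<le> bump x" using bump_lower by blast
  \<comment> \<open>\<open>dirichlet_lower\<close> with half-width \<open>\<epsilon> / 2\<close> and
    lower bound \<open>\<beta>\<^sup>2 / 2\<close> gives 7/8 times 1/2 times 1/2.\<close>
  define \<kappa> where "\<kappa> = 7/32 * \<beta>\<^sup>2"
  have \<kappa>: "0 < \<kappa>" using \<beta> by (simp add: \<kappa>_def)
  \<comment> \<open>\<open>K / \<epsilon>\<^sup>2\<close> is the curvature bound for two pulses: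
    each Dirichlet form is at least \<open>\<kappa> * \<epsilon>\<close>, and each squared norm is
    at most twice the square of \<open>4 * \<epsilon>\<close>, hence the 32.\<close>
  define K where "K = exp (- varrho \<gamma>) / 4 * \<kappa>\<^sup>2 / 32\<^sup>2"
  have K: "0 < K" using \<kappa> by (simp add: K_def)
  \<comment> \<open>The bound by \<open>\<delta> / 2\<close> separates the pulses centred at 1/2 -
    \<delta> and 1/2 + \<delta>, the bound by 1 gives
    \<open>\<epsilon>\<^sup>2 \<le> \<epsilon>\<close>, and the last one pushes
    \<open>K / \<epsilon>\<^sup>2\<close> above \<open>C\<close>; its extra factor 1/2 makes the
    inequality strict.\<close>
  define \<epsilon> where "\<epsilon> = min (\<delta> / 2) (min 1 (K / (\<bar>C\<bar> + 1) / 2))"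
  have "0 < \<epsilon>" using \<delta> K by (auto simp: \<epsilon>_def)
  then have \<epsilon>: "0 < \<epsilon>" "\<epsilon> \<le> \<delta> / 2" "\<epsilon> \<le> 1" "\<epsilon> \<le> K / (\<bar>C\<bar> + 1) / 2"
    unfolding \<epsilon>_def by (blast intro: min.cobounded1 min.cobounded2 order_trans)+
  have pulse_field: "\<exists>w. w \<in> tangent m \<gamma> \<and> odd_H1 w \<and> (\<forall>s. ds w s = pulse c \<epsilon> s *\<^sub>R normal_field e s) \<and>
      weak_metric w w \<le> 32 * \<epsilon>\<^sup>2 \<and> \<kappa> * \<epsilon> \<le> dirichlet w w \<and> ds w c \<noteq> 0"
    if c: "\<bar>c - 1/2\<bar> \<le> \<delta>" for c
  proof -
    have c': "1/4 + \<delta> / 2 < c" "c + \<delta> / 2 < 3/4" using c \<delta> by (auto simp: abs_le_iff)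
    obtain w where w: "w \<in> tangent m \<gamma>" "\<And>s. ds w s = pulse c \<epsilon> s *\<^sub>R normal_field e s"
      "\<And>s. s \<in> {-1..1} \<Longrightarrow> norm (w s) \<le> 4 * \<epsilon>"
    proof -
      have "\<epsilon> < c" "c + \<epsilon> < 1" using \<epsilon> \<delta> c' by auto
      from pulse_tangent_exists[OF e(1) \<epsilon>(1) this] show ?thesis using that by blast
    qed
    have w1: "odd_H1 w" using w(1) m Kspace_odd_H1 by (auto simp: tangent_def)
    have low: "\<beta>\<^sup>2 / 2 \<le> (norm (ds w s))\<^sup>2" if s: "\<bar>s - c\<bar> \<le> \<epsilon> / 2" for s
    proof -
      have "\<bar>(s - c) / \<epsilon>\<bar> \<le> 1/2" using s \<epsilon>(1) by (simp add: abs_divide field_simps)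
      then have "\<beta> \<le> pulse c \<epsilon> s" using \<beta>(2) bump_nonneg[of "(- s - c) / \<epsilon>"] by (fastforce simp: pulse_def)
      then have "\<beta>\<^sup>2 \<le> (pulse c \<epsilon> s)\<^sup>2" using \<beta> by (intro power_mono) auto
      moreover have "1/2 \<le> (norm (normal_field e s))\<^sup>2"
      proof -
        have "\<bar>s - 1/2\<bar> < 2 * \<delta>" using s c \<epsilon>(1,2) \<delta>(1) by linarith
        then show ?thesis by (intro less_imp_le \<delta>3)
      qed
      ultimately have "\<beta>\<^sup>2 * (1/2) \<le> (pulse c \<epsilon> s)\<^sup>2 * (norm (normal_field e s))\<^sup>2"
        by (intro mult_mono) auto
      then show ?thesis by (simp add: w(2) power_mult_distrib)
    qed
    have "7 / 8 * (\<beta>\<^sup>2 / 2) * (\<epsilon> / 2) \<le> dirichlet w w"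
    proof (rule dirichlet_lower[OF w1, where c=c])
      show "\<beta>\<^sup>2 / 2 \<le> (norm (ds w s))\<^sup>2" if "s \<in> {c - \<epsilon> / 2..c + \<epsilon> / 2}" for s
      proof (rule low)
        show "\<bar>s - c\<bar> \<le> \<epsilon> / 2" using that unfolding atLeastAtMost_iff by linarith
      qed
    qed (use \<epsilon> \<delta> c' in auto)
    then have "\<kappa> * \<epsilon> \<le> dirichlet w w" by (simp add: \<kappa>_def)
    moreover have "weak_metric w w \<le> 32 * \<epsilon>\<^sup>2"
      using weak_metric_le_sup[OF w1 w(3)] by (simp add: power_mult_distrib)
    moreover have "ds w c \<noteq> 0" using low[of c] \<epsilon> \<beta> by (auto simp: not_le)
    ultimately show ?thesis using w w1 by blast
  qed
  obtain u where u: "u \<in> tangent m \<gamma>" "odd_H1 u" "\<And>s. ds u s = pulse (1/2 - \<delta>) \<epsilon> s *\<^sub>R normal_field e s"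
    "weak_metric u u \<le> 32 * \<epsilon>\<^sup>2" "\<kappa> * \<epsilon> \<le> dirichlet u u" "ds u (1/2 - \<delta>) \<noteq> 0"
    using pulse_field[of "1/2 - \<delta>"] \<delta> by auto
  obtain v where v: "v \<in> tangent m \<gamma>" "odd_H1 v" "\<And>s. ds v s = pulse (1/2 + \<delta>) \<epsilon> s *\<^sub>R normal_field e s"
    "weak_metric v v \<le> 32 * \<epsilon>\<^sup>2" "\<kappa> * \<epsilon> \<le> dirichlet v v" "ds v (1/2 + \<delta>) \<noteq> 0"
    using pulse_field[of "1/2 + \<delta>"] \<delta> by auto
  have disjoint: "ds u s = 0 \<or> ds v s = 0" for s
  proof (cases "\<epsilon> \<le> \<bar>\<bar>s\<bar> - (1/2 - \<delta>)\<bar>")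
    case True
    then show ?thesis using pulse_zero[of \<epsilon> "1/2 - \<delta>" s] \<epsilon> \<delta> by (simp add: u(3))
  next
    case False
    then have "\<epsilon> \<le> \<bar>\<bar>s\<bar> - (1/2 + \<delta>)\<bar>" using \<epsilon> \<delta> by linarith
    then show ?thesis using pulse_zero[of \<epsilon> "1/2 + \<delta>" s] \<epsilon> \<delta> by (simp add: v(3))
  qed
  have ind: "lin_indep2 u v"
    by (rule pulses_lin_indep[OF u(2) v(2), of "1/2 - \<delta>" "1/2 + \<delta>"])
      (use disjoint[of "1/2 - \<delta>"] disjoint[of "1/2 + \<delta>"] u(6) v(6) \<delta> in auto)
  have "ds u s \<bullet> ds v s = 0" for s using disjoint[of s] by auto
  then have uv: "dirichlet u v = 0" by (simp add: dirichlet_def)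
  let ?D = "weak_metric u u * weak_metric v v - (weak_metric u v)\<^sup>2"
  have D: "0 < ?D" by (rule gram_det_pos[OF u(2) v(2) ind])
  have nn: "0 \<le> weak_metric u u" "0 \<le> weak_metric v v"
    using psd_form_discriminant(1,2)[OF weak_metric_form_nonneg[OF u(2) v(2)]] by auto
  have "?D \<le> weak_metric u u * weak_metric v v" by simp
  also have "\<dots> \<le> (32 * \<epsilon>\<^sup>2) * (32 * \<epsilon>\<^sup>2)"
    by (intro mult_mono u v nn) (use \<epsilon> in auto)
  finally have D2: "?D \<le> (32 * \<epsilon>\<^sup>2) * (32 * \<epsilon>\<^sup>2)" .
  have "C < K / \<epsilon>\<^sup>2"
  proof -
    have "\<epsilon>\<^sup>2 \<le> \<epsilon>" using \<epsilon> by (simp add: power2_eq_square mult_left_le_one_le)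
    also have "\<dots> < K / (\<bar>C\<bar> + 1)"
    proof -
      have "0 < K / (\<bar>C\<bar> + 1)" using K by (intro divide_pos_pos) auto
      moreover have "a < b" if "a \<le> b / 2" "0 < b" for a b :: real using that by simp
      ultimately show ?thesis using \<epsilon>(4) by blast
    qed
    finally have "\<epsilon>\<^sup>2 * (\<bar>C\<bar> + 1) < K" by (simp add: pos_less_divide_eq)
    then have "\<bar>C\<bar> + 1 < K / \<epsilon>\<^sup>2" using \<epsilon> by (simp add: pos_less_divide_eq mult.commute)
    then show ?thesis by linarith
  qed
  also have "K / \<epsilon>\<^sup>2 = exp (- varrho \<gamma>) / 4 * ((\<kappa> * \<epsilon>) * (\<kappa> * \<epsilon>)) / ((32 * \<epsilon>\<^sup>2) * (32 * \<epsilon>\<^sup>2))"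
    using \<epsilon>(1) by (simp add: K_def power2_eq_square field_simps)
  also have "\<dots> \<le> exp (- varrho \<gamma>) / 4 * (dirichlet u u * dirichlet v v) / ?D"
  proof (rule frac_le)
    have "(\<kappa> * \<epsilon>) * (\<kappa> * \<epsilon>) \<le> dirichlet u u * dirichlet v v"
      using \<kappa> \<epsilon>(1) u(5) by (intro mult_mono u v) (auto intro: order_trans[OF _ u(5)])
    then show "exp (- varrho \<gamma>) / 4 * ((\<kappa> * \<epsilon>) * (\<kappa> * \<epsilon>)) \<le> exp (- varrho \<gamma>) / 4 * (dirichlet u u * dirichlet v v)"
      by (intro mult_left_mono) auto
    have "0 \<le> dirichlet u u" "0 \<le> dirichlet v v"
      using mult_pos_pos[OF \<kappa> \<epsilon>(1)] u(5) v(5) by linarith+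
    then show "0 \<le> exp (- varrho \<gamma>) / 4 * (dirichlet u u * dirichlet v v)" by simp
  qed (use D D2 in auto)
  also have "\<dots> \<le> sec_curv \<gamma> u v"
    using sec_curv_ge[OF u(2) v(2) ind] by (simp add: uv)
  finally show ?thesis using u(1) v(1) ind by blast
qed

end

theorem theorem5p1:
  fixes m :: nat and \<gamma> :: "real \<Rightarrow> real ^ 'n"
  assumes "CARD('n) \<ge> 2"
    and "m \<ge> 2"
    and "\<gamma> \<in> Aspace (m + 2)"
  shows "(\<exists>G. green_function \<gamma> G) \<and>
    (\<forall>u\<in>tangent m \<gamma>. \<forall>v\<in>tangent m \<gamma>. lin_indep2 u v \<longrightarrow>
       (\<forall>G. green_function \<gamma> G \<longrightarrow>
          sec_curv \<gamma> u v =
            (LINT x:{-1..1}|lborel. (LINT s:{-1..1}|lborel.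
               G s x * ((norm (ds u s))\<^sup>2 * (norm (ds v x))\<^sup>2
                        - (ds u x \<bullet> ds v x) * (ds u s \<bullet> ds v s)))) /
            (LINT x:{-1..1}|lborel. (LINT s:{-1..1}|lborel.
               (norm (u s))\<^sup>2 * (norm (v x))\<^sup>2 - (u x \<bullet> v x) * (u s \<bullet> v s)))) \<and>
       sec_curv \<gamma> u v \<ge> exp (- varrho \<gamma>) / (1 + varrho \<gamma>) \<and>
       sec_curv \<gamma> u v > 0) \<and>
    (\<forall>C. \<exists>u\<in>tangent m \<gamma>. \<exists>v\<in>tangent m \<gamma>. lin_indep2 u v \<and> sec_curv \<gamma> u v > C)"
proof -
  interpret arc_length_curve m \<gamma> by unfold_locales (use assms in auto)
  have H1: "odd_H1 u" if "u \<in> tangent m \<gamma>" for u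
    using that assms(2) Kspace_odd_H1 by (auto simp: tangent_def)
  \<comment> \<open>The argument yields the stronger bound exp(-\<rho>); nonnegativity of \<rho>
    weakens it to the stated one.\<close>
  have rho: "exp (- varrho \<gamma>) / (1 + varrho \<gamma>) \<le> exp (- varrho \<gamma>)"
    using varrho_nonneg by (simp add: divide_le_eq)
  have "sec_curv \<gamma> u v =
      (LINT x:{-1..1}|lborel. (LINT s:{-1..1}|lborel.
         G s x * ((norm (ds u s))\<^sup>2 * (norm (ds v x))\<^sup>2 - (ds u x \<bullet> ds v x) * (ds u s \<bullet> ds v s)))) /
      (LINT x:{-1..1}|lborel. (LINT s:{-1..1}|lborel.
         (norm (u s))\<^sup>2 * (norm (v x))\<^sup>2 - (u x \<bullet> v x) * (u s \<bullet> v s)))"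
    if "u \<in> tangent m \<gamma>" "v \<in> tangent m \<gamma>" "green_function \<gamma> G" for u v G
    unfolding double_integral_green[OF H1[OF that(1)] H1[OF that(2)] that(3)]
      double_integral_gram[OF H1[OF that(1)] H1[OF that(2)]]
    by (rule sec_curv_eq[OF H1[OF that(1)] H1[OF that(2)]])
  moreover have "exp (- varrho \<gamma>) \<le> sec_curv \<gamma> u v"
    if "u \<in> tangent m \<gamma>" "v \<in> tangent m \<gamma>" "lin_indep2 u v" for u v
    by (rule sec_curv_lower_bound[OF H1[OF that(1)] H1[OF that(2)] that(3)])
  then have "exp (- varrho \<gamma>) / (1 + varrho \<gamma>) \<le> sec_curv \<gamma> u v \<and> 0 < sec_curv \<gamma> u v"
    if "u \<in> tangent m \<gamma>" "v \<in> tangent m \<gamma>" "lin_indep2 u v" for u v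
    using that rho exp_gt_zero[of "- varrho \<gamma>"] by (meson order_less_le_trans order_trans)
  ultimately show ?thesis
    using green_function_green sec_curv_unbounded[OF assms(1)] by blast
qed

end
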